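(* Let $G_1,\ldots,G_r$ be finite simple graphs, each having at least one edge, such that \[ |(V(G_1)\cup\cdots\cup V(G_{i-1}))\cap V(G_i)|\leq 1\quad\text{for all } i=2,\ldots,r, \] and let $G=G_1\cup\cdots\cup G_r$. Then: \begin{enumerate} \item[(a)] If $S/I(G)$ is Cohen--Macaulay, then $r=1$. \item[(b)] $I(G)$ has a linear resolution if and only if each $I(G_i)$, $i=1,\dots,r$, has a linear resolution. \end{enumerate}
   Context: For a finite simple graph $G$ with edge set $E(G)=\{e_1,\dots,e_m\}$, $m\geq 1$, let $S=K[s_1,\dots,s_m,t_1,\dots,t_m]$ be the standard graded polynomial ring over a field $K$ with one pair of variables $s_i,t_i$ for each edge $e_i$. For $A\subseteq V(G)$ the cut monomial of $A$ is $u_A=\alpha_1\cdots\alpha_m$, where $\alpha_i=s_i$ if exactly one of the two vertices of $e_i$ belongs to $A$, and $\alpha_i=t_i$ otherwise. The monomial cut ideal of $G$ is $I(G)=\langle u_A: A\subseteq V(G)\rangle\subseteq S$. For a subgraph $G_j$ of $G$, the ideal $I(G_j)$ is formed using only the edges of $G_j$ and the variables belonging to these edges, and is regarded (extended) as an ideal of $S$. The union $G_1\cup\cdots\cup G_r$ is the graph with vertex set $\bigcup_i V(G_i)$ and edge set $\bigcup_i E(G_i)$. For a nonzero finitely generated graded $S$-module $M$, let $\beta_{ij}(M)=\dim_K\operatorname{Tor}_i^S(M,K)_j$. A graded ideal $I\subset S$ has a linear resolution if there is an integer $d\geq 1$ such that $\beta_{ij}(I)=0$ whenever $j\neq i+d$.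 *)

theory Defs
  imports
    "HOL-Algebra.QuotRing"
    "HOL-Algebra.Algebraic_Closure_Type"
    "HOL-Library.Poly_Mapping"
    "HOL-Library.Extended_Nat"
    "HOL-Library.Function_Algebras"
begin

section \<open>Finite simple graphs\<close>

record 'v graph =
  verts :: "'v set"
  edges :: "'v set set"

definition finite_simple_graph :: "'v graph \<Rightarrow> bool" where
  "finite_simple_graph G \<longleftrightarrow>
     finite (verts G) \<and> edges G \<subseteq> {{u, v} | u v. u \<in> verts G \<and> v \<in> verts G \<and> u \<noteq> v}"

definition graph_Union :: "nat set \<Rightarrow> (nat \<Rightarrow> 'v graph) \<Rightarrow> 'v graph" where
  "graph_Union J H = \<lparr>verts = (\<Union>j\<in>J. verts (H j)), edges = (\<Union>j\<in>J. edges (H j))\<rparr>"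


section \<open>Polynomial rings\<close>

text \<open>The polynomial ring over \<open>'k\<close> whose set of variables is the whole type \<open>'x\<close>: a monomial is
  its finitely supported exponent vector, and multiplication of polynomials is convolution.\<close>

type_synonym ('x, 'k) mpoly = "('x \<Rightarrow>\<^sub>0 nat) \<Rightarrow>\<^sub>0 'k"

definition var :: "'x \<Rightarrow> ('x, 'k::field) mpoly" where
  "var x = Poly_Mapping.single (Poly_Mapping.single x 1) 1"

definition total_degree :: "('x \<Rightarrow>\<^sub>0 nat) \<Rightarrow> nat" where
  "total_degree u = (\<Sum>x\<in>Poly_Mapping.keys u. Poly_Mapping.lookup u x)"

text \<open>The zero polynomial is homogeneous of every degree, and the only one of negative degree.\<close>

definition homogeneous :: "int \<Rightarrow> ('x, 'k::field) mpoly \<Rightarrow> bool" where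
  "homogeneous d f \<longleftrightarrow> (\<forall>u\<in>Poly_Mapping.keys f. int (total_degree u) = d)"

abbreviation poly_ring :: "('x, 'k::field) mpoly ring" where
  "poly_ring \<equiv> ring_of_type_algebra"

definition graded_maximal_ideal :: "('x, 'k::field) mpoly set" where
  "graded_maximal_ideal = Idl\<^bsub>poly_ring\<^esub> (range var)"


section \<open>The Cohen-Macaulay property\<close>

definition krull_dim :: "('a, 'b) ring_scheme \<Rightarrow> enat" where
  "krull_dim R = Sup {enat n | n. \<exists>P :: nat \<Rightarrow> 'a set.
     (\<forall>i\<le>n. primeideal (P i) R) \<and> (\<forall>i<n. P i \<subset> P (Suc i))}"

definition regular_sequence :: "('a, 'b) ring_scheme \<Rightarrow> 'a list \<Rightarrow> bool" where
  "regular_sequence R fs \<longleftrightarrow>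
     set fs \<subseteq> carrier R \<and>
     Idl\<^bsub>R\<^esub> (set fs) \<noteq> carrier R \<and>
     (\<forall>i<length fs. \<forall>g\<in>carrier R.
        fs ! i \<otimes>\<^bsub>R\<^esub> g \<in> Idl\<^bsub>R\<^esub> (set (take i fs)) \<longrightarrow> g \<in> Idl\<^bsub>R\<^esub> (set (take i fs)))"

definition depth :: "('a, 'b) ring_scheme \<Rightarrow> 'a set \<Rightarrow> enat" where
  "depth R \<mm> = Sup {enat (length fs) | fs. regular_sequence R fs \<and> set fs \<subseteq> \<mm>}"

text \<open>For a standard graded algebra \<open>R\<close> over a field with graded maximal ideal \<open>\<mm>\<close>.
  The elements of a regular sequence in \<open>\<mm>\<close> are not required to be homogeneous; this does not
  change the depth.\<close>

definition cohen_macaulay :: "('a, 'b) ring_scheme \<Rightarrow> 'a set \<Rightarrow> bool" where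
  "cohen_macaulay R \<mm> \<longleftrightarrow> depth R \<mm> = krull_dim R"

definition quotient_cohen_macaulay :: "('x, 'k::field) mpoly set \<Rightarrow> bool" where
  "quotient_cohen_macaulay I \<longleftrightarrow>
     cohen_macaulay (poly_ring Quot I) ((\<lambda>f. I +>\<^bsub>poly_ring\<^esub> f) ` graded_maximal_ideal)"


section \<open>Graded Betti numbers and linear resolutions\<close>

text \<open>Vectors with coordinates indexed by a finite set \<open>B\<close> of naturals are functions vanishing
  outside \<open>B\<close>; \<open>mat_apply A B D\<close> is multiplication by the matrix \<open>D\<close> with rows in \<open>A\<close> and columns
  in \<open>B\<close>.\<close>

definition vectors_on :: "nat set \<Rightarrow> (nat \<Rightarrow> 'a::zero) set" where
  "vectors_on B = {v. \<forall>b. b \<notin> B \<longrightarrow> v b = 0}"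

definition mat_apply ::
    "nat set \<Rightarrow> nat set \<Rightarrow> (nat \<Rightarrow> nat \<Rightarrow> 'a::comm_ring_1) \<Rightarrow> (nat \<Rightarrow> 'a) \<Rightarrow> (nat \<Rightarrow> 'a)" where
  "mat_apply A B D v = (\<lambda>a. if a \<in> A then \<Sum>b\<in>B. D a b * v b else 0)"

text \<open>A complex \<open>\<dots> \<rightarrow> F\<^sub>1 \<rightarrow> F\<^sub>0 \<rightarrow> S\<close> of graded free modules of finite rank over
  \<open>S = ('x, 'k) mpoly\<close>. The module \<open>F\<^sub>p\<close> has basis \<open>basis F p\<close>, where \<open>b\<close> has degree \<open>twist F p b\<close>;
  \<open>diff_mat F p\<close> is the matrix of the map from \<open>F\<^sub>p\<^sub>+\<^sub>1\<close> to \<open>F\<^sub>p\<close>, and \<open>aug F\<close> is the one-row matrix of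
  the map from \<open>F\<^sub>0\<close> to \<open>S\<close>.\<close>

record (overloaded) ('x, 'k) free_complex =
  basis :: "nat \<Rightarrow> nat set"
  twist :: "nat \<Rightarrow> nat \<Rightarrow> int"
  diff_mat :: "nat \<Rightarrow> nat \<Rightarrow> nat \<Rightarrow> ('x, 'k) mpoly"
  aug :: "nat \<Rightarrow> ('x, 'k) mpoly"

definition boundary_map ::
    "('x, 'k::field) free_complex \<Rightarrow> nat \<Rightarrow> (nat \<Rightarrow> ('x, 'k) mpoly) \<Rightarrow> (nat \<Rightarrow> ('x, 'k) mpoly)" where
  "boundary_map F p = mat_apply (basis F p) (basis F (Suc p)) (diff_mat F p)"

definition augmentation ::
    "('x, 'k::field) free_complex \<Rightarrow> (nat \<Rightarrow> ('x, 'k) mpoly) \<Rightarrow> ('x, 'k) mpoly" where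
  "augmentation F v = (\<Sum>b\<in>basis F 0. aug F b * v b)"

text \<open>All maps have degree 0, and \<open>\<dots> \<rightarrow> F\<^sub>1 \<rightarrow> F\<^sub>0 \<rightarrow> I \<rightarrow> 0\<close> is exact.\<close>

definition graded_free_resolution ::
    "('x, 'k::field) free_complex \<Rightarrow> ('x, 'k) mpoly set \<Rightarrow> bool" where
  "graded_free_resolution F I \<longleftrightarrow>
     (\<forall>p. finite (basis F p)) \<and>
     (\<forall>b\<in>basis F 0. homogeneous (twist F 0 b) (aug F b)) \<and>
     (\<forall>p. \<forall>a\<in>basis F p. \<forall>b\<in>basis F (Suc p).
        homogeneous (twist F (Suc p) b - twist F p a) (diff_mat F p a b)) \<and>
     augmentation F ` vectors_on (basis F 0) = I \<and>
     {v \<in> vectors_on (basis F 0). augmentation F v = 0} =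
       boundary_map F 0 ` vectors_on (basis F (Suc 0)) \<and>
     (\<forall>p. {v \<in> vectors_on (basis F (Suc p)). boundary_map F p v = 0} =
       boundary_map F (Suc p) ` vectors_on (basis F (Suc (Suc p))))"

text \<open>The complex \<open>F \<otimes>\<^sub>S K\<close> with \<open>K = S / \<mm>\<close>: its \<open>p\<close>-th term is the \<open>K\<close>-vector space with basis
  \<open>basis F p\<close>, its degree \<open>j\<close> part is spanned by the basis elements of degree \<open>j\<close>, and its
  differentials are the matrices of constant terms.\<close>

definition tensor_part :: "('x, 'k::field) free_complex \<Rightarrow> nat \<Rightarrow> int \<Rightarrow> (nat \<Rightarrow> 'k) set" where
  "tensor_part F p j = vectors_on {b \<in> basis F p. twist F p b = j}"

definition tensor_boundary_map ::
    "('x, 'k::field) free_complex \<Rightarrow> nat \<Rightarrow> (nat \<Rightarrow> 'k) \<Rightarrow> (nat \<Rightarrow> 'k)" where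
  "tensor_boundary_map F p =
     mat_apply (basis F p) (basis F (Suc p)) (\<lambda>a b. Poly_Mapping.lookup (diff_mat F p a b) 0)"

fun tensor_cycles :: "('x, 'k::field) free_complex \<Rightarrow> nat \<Rightarrow> int \<Rightarrow> (nat \<Rightarrow> 'k) set" where
  "tensor_cycles F 0 j = tensor_part F 0 j"
| "tensor_cycles F (Suc p) j = {v \<in> tensor_part F (Suc p) j. tensor_boundary_map F p v = 0}"

definition tensor_boundaries ::
    "('x, 'k::field) free_complex \<Rightarrow> nat \<Rightarrow> int \<Rightarrow> (nat \<Rightarrow> 'k) set" where
  "tensor_boundaries F p j = tensor_boundary_map F p ` tensor_part F (Suc p) j"

definition fun_scale :: "'k::field \<Rightarrow> (nat \<Rightarrow> 'k) \<Rightarrow> (nat \<Rightarrow> 'k)" where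
  "fun_scale c v = (\<lambda>b. c * v b)"

global_interpretation fun_space: vector_space "fun_scale :: 'k::field \<Rightarrow> _"
  by unfold_locales (auto simp: fun_scale_def fun_eq_iff algebra_simps)

text \<open>The dimension of the degree \<open>j\<close> part of the homology of \<open>F \<otimes>\<^sub>S K\<close> in position \<open>i\<close>; the
  boundaries are a subspace of the cycles, so the subtraction does not truncate.\<close>

definition tensor_homology_dim :: "('x, 'k::field) free_complex \<Rightarrow> nat \<Rightarrow> int \<Rightarrow> nat" where
  "tensor_homology_dim F i j =
     fun_space.dim (tensor_cycles F i j) - fun_space.dim (tensor_boundaries F i j)"

text \<open>The dimension of the degree \<open>j\<close> part of \<open>Tor\<^sub>i(I, K)\<close>, computed from an arbitrarily chosen
  graded free resolution of \<open>I\<close>; meaningful for graded ideals of polynomial rings in finitely many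
  variables, which have such a resolution.\<close>

definition graded_betti :: "('x, 'k::field) mpoly set \<Rightarrow> nat \<Rightarrow> int \<Rightarrow> nat" where
  "graded_betti I i j = tensor_homology_dim (SOME F. graded_free_resolution F I) i j"

definition has_linear_resolution :: "('x, 'k::field) mpoly set \<Rightarrow> bool" where
  "has_linear_resolution I \<longleftrightarrow>
     (\<exists>d::nat. d \<ge> 1 \<and> (\<forall>i j. j \<noteq> int i + int d \<longrightarrow> graded_betti I i j = 0))"


section \<open>Monomial cut ideals\<close>

datatype 'e cut_var = S_var 'e | T_var 'e

text \<open>The edges of the ambient graph \<open>G\<close> are enumerated by a bijection \<open>e\<close> from a type \<open>'e\<close> onto
  \<open>edges G\<close>. For a subgraph \<open>H\<close> of \<open>G\<close> only the variables of edges of \<open>H\<close> occur in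
  \<open>cut_monomial e H A\<close>, and \<open>cut_ideal e H\<close> is the extension of the cut ideal of \<open>H\<close> to the polynomial
  ring of \<open>G\<close>.\<close>

definition cut_monomial ::
    "('e \<Rightarrow> 'v set) \<Rightarrow> 'v graph \<Rightarrow> 'v set \<Rightarrow> ('e cut_var, 'k::field) mpoly" where
  "cut_monomial e H A =
     (\<Prod>i | e i \<in> edges H. if card (e i \<inter> A) = 1 then var (S_var i) else var (T_var i))"

definition cut_ideal ::
    "('e \<Rightarrow> 'v set) \<Rightarrow> 'v graph \<Rightarrow> ('e cut_var, 'k::field) mpoly set" where
  "cut_ideal e H = Idl\<^bsub>poly_ring\<^esub> {cut_monomial e H A | A. A \<subseteq> verts H}"

end

theory Submission
  imports Defs
begin

text \<open>
  Everything reduces to gluing two graphs \<open>H1\<close> and \<open>H2\<close> that share at most one vertex.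
  Complementing a cut does not change its monomial, so any two cuts of the pieces can be glued,
  and the pieces share no edge. Hence the cut ideal of the union is the intersection (and also the
  product) of two monomial ideals in disjoint sets of variables (\<open>cut_monomials_glue\<close>), and the
  theorem follows from general facts on such intersections.

  Linear resolutions. The Betti numbers are defined by an arbitrarily chosen graded free
  resolution. Resolutions exist by the Taylor complex, and for any of them dimension shifting
  along the syzygies identifies the vanishing of Betti numbers with the vanishing of Koszul
  homology. For a monomial ideal the latter splits by multidegrees into the homology of the upper
  Koszul simplicial complexes, whose faces are the squarefree monomials \<open>\<sigma>\<close> such that \<open>b / \<sigma>\<close> is
  in the ideal (\<open>tensor_homology_dim_eq_0_iff\<close>). For an intersection in disjoint variables these
  complexes are joins. An ideal generated in degree \<open>d\<close> has a linear resolution exactly if all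
  these complexes have homology only in the largest possible position. By the Kuenneth formula
  this property passes to joins (\<open>exact_at_join\<close>), and it passes back to a factor by choosing a
  minimal generator as the multidegree in the other factor, where the complex is just the empty
  face (\<open>linear_at_factor\<close>).

  Cohen-Macaulayness. Let there be \<open>m\<close> edges, hence \<open>2 m\<close> variables. The two variables of an edge
  generate a prime containing the cut ideal, so the Krull dimension is at least \<open>2 m - 2\<close>. On the
  other hand each regular element moves a nonzero Koszul homology class of the residue ring up by
  one position, so a class in position 3 bounds the depth by \<open>2 m - 3\<close>
  (\<open>regular_sequence_length_le\<close>). Such a class exists for an intersection of two cut ideals. In
  the multidegree of the least common multiple of two cut monomials that are as similar as
  possible, the upper Koszul complex of each factor is a disjoint union of two simplices
  (\<open>cut_monomials_two_simplices\<close>), and the join of two disconnected complexes contains a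
  four-cycle that does not bound (\<open>koszul_nonzero_3\<close>).
\<close>


section \<open>Signed boundary operators\<close>

text \<open>
  The vertices are ordered by \<open>enc\<close>; this is the sign with which \<open>\<tau>\<close> occurs in the boundary of
  \<open>insert x \<tau>\<close>.
\<close>

definition sgn_at :: "('i \<Rightarrow> nat) \<Rightarrow> 'i \<Rightarrow> 'i set \<Rightarrow> 'a::comm_ring_1" where
  "sgn_at enc x \<tau> = (-1) ^ card {y\<in>\<tau>. enc y < enc x}"

lemma sgn_at_insert:
  assumes "finite \<tau>" "x \<notin> \<tau>"
  shows "sgn_at enc y (insert x \<tau>) = (if enc x < enc y then - sgn_at enc y \<tau> else sgn_at enc y \<tau>)"
proof -
  have "{z \<in> insert x \<tau>. enc z < enc y} =
      (if enc x < enc y then insert x {z\<in>\<tau>. enc z < enc y} else {z\<in>\<tau>. enc z < enc y})"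
    by auto
  then show ?thesis
    using assms by (simp add: sgn_at_def)
qed

lemma sgn_at_square [simp]: "sgn_at enc x \<tau> * sgn_at enc x \<tau> = 1"
  by (simp add: sgn_at_def flip: power_mult_distrib)

lemma sgn_at_square_assoc [simp]: "sgn_at enc x \<tau> * (sgn_at enc x \<tau> * a) = a"
  by (simp flip: mult.assoc)

lemma sgn_at_swap:
  assumes "finite \<tau>" "x \<notin> \<tau>" "y \<notin> \<tau>" "enc x \<noteq> enc y"
  shows "sgn_at enc x \<tau> * sgn_at enc y (insert x \<tau>) = - (sgn_at enc y \<tau> * sgn_at enc x (insert y \<tau>))"
    and "sgn_at enc y (insert x \<tau>) * sgn_at enc x (insert y \<tau>) = - (sgn_at enc y \<tau> * sgn_at enc x \<tau>)"
  using assms by (auto simp: sgn_at_insert mult.commute)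

lemma sgn_at_cases: "sgn_at enc x \<tau> = 1 \<or> sgn_at enc x \<tau> = - 1"
  unfolding sgn_at_def by (metis neg_one_even_power neg_one_odd_power)

text \<open>The terms cancel in pairs, so that characteristic two needs no separate treatment.\<close>

lemma sum_antisymmetric:
  fixes f :: "'i \<Rightarrow> 'i \<Rightarrow> 'a::ab_group_add"
  assumes "finite A" "\<And>x y. x \<in> A \<Longrightarrow> y \<in> A \<Longrightarrow> x \<noteq> y \<Longrightarrow> f x y = - f y x"
  shows "(\<Sum>x\<in>A. \<Sum>y\<in>A - {x}. f x y) = 0"
  using assms
proof (induction A)
  case (insert a A)
  have "(\<Sum>y\<in>insert a A - {x}. f x y) = f x a + (\<Sum>y\<in>A - {x}. f x y)" if "x \<in> A" for x
  proof -
    have "insert a A - {x} = insert a (A - {x})"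
      using insert.hyps that by auto
    then show ?thesis
      using insert.hyps by simp
  qed
  then have "(\<Sum>x\<in>insert a A. \<Sum>y\<in>insert a A - {x}. f x y) =
      (\<Sum>y\<in>A. f a y) + ((\<Sum>x\<in>A. f x a) + (\<Sum>x\<in>A. \<Sum>y\<in>A - {x}. f x y))"
    using insert.hyps by (simp add: sum.distrib)
  also have "\<dots> = (\<Sum>y\<in>A. f a y + f y a)"
  proof -
    have "(\<Sum>x\<in>A. \<Sum>y\<in>A - {x}. f x y) = 0"
      by (rule insert.IH) (rule insert.prems; simp)
    then show ?thesis
      by (simp only: sum.distrib add_0_right)
  qed
  also have "\<dots> = 0"
  proof (rule sum.neutral, rule ballI)
    fix y assume "y \<in> A"
    then have "f a y = - f y a"
      using insert.hyps by (intro insert.prems) auto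
    then show "f a y + f y a = 0"
      by simp
  qed
  finally show ?case .
qed simp

text \<open>
  A chain assigns a coefficient to each set of vertices, and a set with \<open>n\<close> elements sits in
  position \<open>n\<close>, the empty set included. Weights equal to 1 give the augmented simplicial chain
  complex, the variables as weights give the Koszul complex, and quotients of least common
  multiples give the Taylor complex.
\<close>

definition boundary :: "('i \<Rightarrow> nat) \<Rightarrow> 'i set \<Rightarrow> ('i \<Rightarrow> 'i set \<Rightarrow> 'a) \<Rightarrow> ('i set \<Rightarrow> 'a) \<Rightarrow> 'i set \<Rightarrow> 'a::comm_ring_1"
  where "boundary enc V m z \<tau> = (\<Sum>x\<in>V - \<tau>. sgn_at enc x \<tau> * m x \<tau> * z (insert x \<tau>))"

lemma boundary_boundary:
  fixes z :: "'i set \<Rightarrow> 'a::comm_ring_1"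
  assumes V: "finite V" "inj_on enc V" and \<tau>: "\<tau> \<subseteq> V"
    and m: "\<And>x y. x \<in> V - \<tau> \<Longrightarrow> y \<in> V - \<tau> \<Longrightarrow> x \<noteq> y \<Longrightarrow> m x \<tau> * m y (insert x \<tau>) = m y \<tau> * m x (insert y \<tau>)"
  shows "boundary enc V m (boundary enc V m z) \<tau> = 0"
proof -
  have fin: "finite \<tau>"
    using V \<tau> finite_subset by blast
  have V_diff: "V - insert x \<tau> = (V - \<tau>) - {x}" for x by auto
  let ?f = "\<lambda>x y. sgn_at enc x \<tau> * m x \<tau> * (sgn_at enc y (insert x \<tau>) * m y (insert x \<tau>) * z (insert y (insert x \<tau>)))"
  have "(\<Sum>x\<in>V - \<tau>. \<Sum>y\<in>(V - \<tau>) - {x}. ?f x y) = 0"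
  proof (rule sum_antisymmetric)
    fix x y assume xy: "x \<in> V - \<tau>" "y \<in> V - \<tau>" "x \<noteq> y"
    then have enc: "enc x \<noteq> enc y"
      using V by (auto dest: inj_onD)
    then have sw: "sgn_at enc x \<tau> * sgn_at enc y (insert x \<tau>) = - (sgn_at enc y \<tau> * sgn_at enc x (insert y \<tau>) :: 'a)"
      using sgn_at_swap(1)[of \<tau> x y enc] fin xy by blast
    have "?f x y = (sgn_at enc x \<tau> * sgn_at enc y (insert x \<tau>)) * ((m x \<tau> * m y (insert x \<tau>)) * z (insert y (insert x \<tau>)))"
      by (simp add: mult_ac)
    also have "\<dots> = - (sgn_at enc y \<tau> * sgn_at enc x (insert y \<tau>)) * ((m y \<tau> * m x (insert y \<tau>)) * z (insert x (insert y \<tau>)))"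
      using m[OF xy] by (simp add: sw insert_commute)
    also have "\<dots> = - ?f y x"
      by (simp add: mult_ac)
    finally show "?f x y = - ?f y x" .
  qed (use V in auto)
  then show ?thesis
    by (simp add: boundary_def sum_distrib_left V_diff)
qed

definition cone :: "('i \<Rightarrow> nat) \<Rightarrow> 'i \<Rightarrow> ('i set \<Rightarrow> 'a) \<Rightarrow> 'i set \<Rightarrow> 'a::comm_ring_1" where
  "cone enc x z \<sigma> = (if x \<in> \<sigma> then sgn_at enc x (\<sigma> - {x}) * z (\<sigma> - {x}) else 0)"

text \<open>
  Adding the vertex \<open>x\<close> is a homotopy between multiplication by the weight of \<open>x\<close> and zero. For
  weights 1 this contracts a cone onto its apex; for the Koszul complex it shows that variables
  annihilate Koszul homology.
\<close>

lemma boundary_cone: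
  fixes z :: "'i set \<Rightarrow> 'a::comm_ring_1"
  assumes V: "finite V" "inj_on enc V" and \<tau>: "\<tau> \<subseteq> V" and x: "x \<in> V"
  shows "boundary enc V (\<lambda>y _. m y) (cone enc x z) \<tau> + cone enc x (boundary enc V (\<lambda>y _. m y) z) \<tau> = m x * z \<tau>"
proof (cases "x \<in> \<tau>")
  case False
  have "boundary enc V (\<lambda>y _. m y) (cone enc x z) \<tau> =
      (\<Sum>y\<in>V - \<tau>. if y = x then m x * z \<tau> else 0)"
    unfolding boundary_def
  proof (rule sum.cong)
    fix y assume "y \<in> V - \<tau>"
    then show "sgn_at enc y \<tau> * m y * cone enc x z (insert y \<tau>) = (if y = x then m x * z \<tau> else 0)"
      using False by (auto simp: cone_def mult_ac)
  qed simp
  also have "\<dots> = m x * z \<tau>"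
    using V x False by simp
  finally show ?thesis
    using False by (simp add: cone_def)
next
  case True
  define \<rho> where "\<rho> = \<tau> - {x}"
  have \<rho>: "\<tau> = insert x \<rho>" "x \<notin> \<rho>" "finite \<rho>"
    using True \<tau> V finite_subset by (auto simp: \<rho>_def)
  have split: "V - \<rho> = insert x (V - \<tau>)" "x \<notin> V - \<tau>" "finite (V - \<tau>)"
    using \<rho> x V by auto
  have "cone enc x (boundary enc V (\<lambda>y _. m y) z) \<tau> =
      sgn_at enc x \<rho> * (\<Sum>y\<in>V - \<rho>. sgn_at enc y \<rho> * m y * z (insert y \<rho>))"
    using True by (simp add: cone_def boundary_def \<rho>_def)
  also have "\<dots> = sgn_at enc x \<rho> * (sgn_at enc x \<rho> * m x * z (insert x \<rho>)) +
      sgn_at enc x \<rho> * (\<Sum>y\<in>V - \<tau>. sgn_at enc y \<rho> * m y * z (insert y \<rho>))"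
    by (simp only: split(1) sum.insert[OF split(3,2)] distrib_left)
  also have "\<dots> = m x * z \<tau> + (\<Sum>y\<in>V - \<tau>. sgn_at enc x \<rho> * (sgn_at enc y \<rho> * m y * z (insert y \<rho>)))"
    by (simp only: \<rho>(1)[symmetric] mult.assoc sgn_at_square_assoc sum_distrib_left)
  finally have 1: "cone enc x (boundary enc V (\<lambda>y _. m y) z) \<tau> =
      m x * z \<tau> + (\<Sum>y\<in>V - \<tau>. sgn_at enc x \<rho> * (sgn_at enc y \<rho> * m y * z (insert y \<rho>)))" .
  have "boundary enc V (\<lambda>y _. m y) (cone enc x z) \<tau> =
      (\<Sum>y\<in>V - \<tau>. - (sgn_at enc x \<rho> * (sgn_at enc y \<rho> * m y * z (insert y \<rho>))))"
    unfolding boundary_def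
  proof (rule sum.cong)
    fix y assume y: "y \<in> V - \<tau>"
    then have enc: "enc x \<noteq> enc y"
      using V x True by (auto dest: inj_onD)
    have *: "insert y \<tau> - {x} = insert y \<rho>"
      using \<rho> y by auto
    have sw: "sgn_at enc y (insert x \<rho>) * sgn_at enc x (insert y \<rho>) = - (sgn_at enc y \<rho> * sgn_at enc x \<rho> :: 'a)"
      using sgn_at_swap(2)[of \<rho> x y enc] \<rho> y enc by simp
    have "sgn_at enc y \<tau> * m y * cone enc x z (insert y \<tau>) =
        (sgn_at enc y (insert x \<rho>) * sgn_at enc x (insert y \<rho>)) * (m y * z (insert y \<rho>))"
      using True * by (simp add: cone_def \<rho>(1)[symmetric] mult_ac)
    also have "\<dots> = - (sgn_at enc x \<rho> * (sgn_at enc y \<rho> * m y * z (insert y \<rho>)))"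
      unfolding sw by (simp add: mult_ac)
    finally show "sgn_at enc y \<tau> * m y * cone enc x z (insert y \<tau>) =
        - (sgn_at enc x \<rho> * (sgn_at enc y \<rho> * m y * z (insert y \<rho>)))" .
  qed simp
  then show ?thesis
    using 1 by (simp add: sum_negf)
qed

lemma boundary_supp:
  assumes "\<And>\<sigma>. z \<sigma> \<noteq> 0 \<Longrightarrow> \<sigma> \<subseteq> V" "\<not> \<tau> \<subseteq> V"
  shows "boundary enc V m z \<tau> = 0"
  unfolding boundary_def
proof (rule sum.neutral, rule ballI)
  fix x assume "x \<in> V - \<tau>"
  have "z (insert x \<tau>) = 0"
    using assms(1)[of "insert x \<tau>"] assms(2) by blast
  then show "sgn_at enc x \<tau> * m x \<tau> * z (insert x \<tau>) = 0"
    by simp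
qed

abbreviation "sboundary enc V \<equiv> boundary enc V (\<lambda>_ _. 1)"

text \<open>
  Divisibility of the monomials with these exponent vectors, as opposed to the lexicographic order
  \<open>\<le>\<close> of their type.
\<close>

definition mono_dvd :: "('x \<Rightarrow>\<^sub>0 nat) \<Rightarrow> ('x \<Rightarrow>\<^sub>0 nat) \<Rightarrow> bool" (infix \<open>\<preceq>\<close> 50) where
  "u \<preceq> v \<longleftrightarrow> (\<forall>x. Poly_Mapping.lookup u x \<le> Poly_Mapping.lookup v x)"

lemma mono_dvd_refl [simp]: "u \<preceq> u" and mono_dvd_zero [simp]: "0 \<preceq> u"
  and mono_dvd_add [simp]: "u \<preceq> v + u" "u \<preceq> u + v"
  by (simp_all add: mono_dvd_def lookup_add)

lemma mono_dvd_trans: "u \<preceq> v \<Longrightarrow> v \<preceq> w \<Longrightarrow> u \<preceq> w"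
  unfolding mono_dvd_def using order_trans by blast

lemma mono_diff_add: "u \<preceq> v \<Longrightarrow> v - u + u = v"
  by (rule poly_mapping_eqI) (simp add: mono_dvd_def lookup_add lookup_minus)

lemma mono_add_diff [simp]: "(u :: 'x \<Rightarrow>\<^sub>0 nat) + v - v = u"
  by (rule poly_mapping_eqI) (simp add: lookup_add lookup_minus)

lemma mono_add_diff' [simp]: "(v :: 'x \<Rightarrow>\<^sub>0 nat) + u - v = u"
  by (rule poly_mapping_eqI) (simp add: lookup_add lookup_minus)

lemma total_degree_UNIV: "total_degree (u :: 'x::finite \<Rightarrow>\<^sub>0 nat) = (\<Sum>x\<in>UNIV. Poly_Mapping.lookup u x)"
  unfolding total_degree_def by (rule sum.mono_neutral_left) (auto simp: in_keys_iff)

lemma total_degree_add [simp]: "total_degree (u + v :: 'x::finite \<Rightarrow>\<^sub>0 nat) = total_degree u + total_degree v"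
  by (simp add: total_degree_UNIV lookup_add sum.distrib)

lemma total_degree_zero [simp]: "total_degree 0 = 0"
  by (simp add: total_degree_def)

lemma total_degree_single [simp]: "total_degree (Poly_Mapping.single x n) = n"
  by (simp add: total_degree_def)

lemma lookup_single_mult:
  fixes f :: "('x \<Rightarrow>\<^sub>0 nat) \<Rightarrow>\<^sub>0 'k::comm_ring_1"
  shows "Poly_Mapping.lookup (Poly_Mapping.single d a * f) u =
      (if d \<preceq> u then a * Poly_Mapping.lookup f (u - d) else 0)"
proof -
  have "Poly_Mapping.lookup (Poly_Mapping.single d a * f) u =
      (\<Sum>l. (a when d = l) * (\<Sum>q. Poly_Mapping.lookup f q when u = l + q))"
    by (simp add: lookup_mult lookup_single)
  also have "\<dots> = (\<Sum>l. (a * (\<Sum>q. Poly_Mapping.lookup f q when u = l + q)) when d = l)"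
    by (simp add: when_mult)
  also have "\<dots> = a * (\<Sum>q. Poly_Mapping.lookup f q when u = d + q)"
    by simp
  also have "\<dots> = (if d \<preceq> u then a * Poly_Mapping.lookup f (u - d) else 0)"
  proof (cases "d \<preceq> u")
    case True
    then have "u = d + q \<longleftrightarrow> u - d = q" for q
      by (metis add.commute mono_add_diff' mono_diff_add)
    then show ?thesis
      using True by simp
  next
    case False
    then have "u \<noteq> d + q" for q by auto
    then show ?thesis
      using False by simp
  qed
  finally show ?thesis .
qed

lemma lookup_sgn_mult [simp]:
  "Poly_Mapping.lookup (sgn_at enc x \<tau> * f) u = sgn_at enc x \<tau> * Poly_Mapping.lookup f u"
proof -
  have "Poly_Mapping.lookup ((-1) ^ n * f) u = (-1) ^ n * Poly_Mapping.lookup f u" for n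
    by (cases "even n") auto
  then show ?thesis
    by (simp add: sgn_at_def)
qed

text \<open>
  The labels behave like least common multiples of the labels of the vertices. The resulting
  complex of free modules is the Taylor complex of the vertex labels; the Koszul complex is the
  case where these are the variables.
\<close>

locale labelled_simplex =
  fixes enc :: "'i \<Rightarrow> nat" and V :: "'i set" and lab :: "'i set \<Rightarrow> 'x::finite \<Rightarrow>\<^sub>0 nat"
  assumes V: "finite V" "inj_on enc V"
    and label_dvd: "\<sigma> \<subseteq> V \<Longrightarrow> lab \<sigma> \<preceq> b \<longleftrightarrow> (\<forall>i\<in>\<sigma>. lab {i} \<preceq> b)"
begin

lemma label_mono: "\<sigma> \<subseteq> V \<Longrightarrow> \<tau> \<subseteq> \<sigma> \<Longrightarrow> lab \<tau> \<preceq> lab \<sigma>"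
  using label_dvd[of \<sigma> "lab \<sigma>"] label_dvd[of \<tau> "lab \<sigma>"] by (meson mono_dvd_refl order_trans subsetD)

abbreviation weight :: "'i \<Rightarrow> 'i set \<Rightarrow> ('x, 'k::field) mpoly" where
  "weight x \<tau> \<equiv> Poly_Mapping.single (lab (insert x \<tau>) - lab \<tau>) 1"

text \<open>
  The component of multidegree \<open>b\<close>. A face contributes only if its label divides \<open>b\<close>, and then
  with a single scalar; in this way a complex of free modules splits into complexes of vector
  spaces.
\<close>

definition part :: "('x \<Rightarrow>\<^sub>0 nat) \<Rightarrow> ('i set \<Rightarrow> ('x, 'k::field) mpoly) \<Rightarrow> 'i set \<Rightarrow> 'k" where
  "part b z \<tau> = (if \<tau> \<subseteq> V \<and> lab \<tau> \<preceq> b then Poly_Mapping.lookup (z \<tau>) (b - lab \<tau>) else 0)"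

text \<open>Within one multidegree the monomial weights disappear, which leaves the simplicial boundary.\<close>

lemma part_boundary:
  "part b (boundary enc V weight z) \<tau> = sboundary enc V (part b z) \<tau>"
proof (cases "\<tau> \<subseteq> V")
  case \<tau>: True
  show ?thesis
  proof (cases "lab \<tau> \<preceq> b")
    case True
    have "Poly_Mapping.lookup (weight x \<tau> * z (insert x \<tau>)) (b - lab \<tau>) = part b z (insert x \<tau>)"
      if x: "x \<in> V - \<tau>" for x
    proof -
      have le: "lab \<tau> \<preceq> lab (insert x \<tau>)"
        using label_mono[of "insert x \<tau>" \<tau>] \<tau> x by blast
      have "(lab (insert x \<tau>) - lab \<tau> \<preceq> b - lab \<tau>) \<longleftrightarrow> lab (insert x \<tau>) \<preceq> b"
        using le True unfolding mono_dvd_def by (simp add: lookup_minus le_diff_conv)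
      moreover have "b - lab \<tau> - (lab (insert x \<tau>) - lab \<tau>) = b - lab (insert x \<tau>)"
        using le by (intro poly_mapping_eqI) (simp add: lookup_minus mono_dvd_def)
      ultimately show ?thesis
        using \<tau> x by (simp add: part_def lookup_single_mult)
    qed
    then show ?thesis
      using \<tau> True by (simp add: part_def boundary_def lookup_sum mult.assoc)
  next
    case False
    then have "part b z (insert x \<tau>) = 0" for x
      using label_mono[of "insert x \<tau>" \<tau>] mono_dvd_trans by (auto simp: part_def)
    then have "sboundary enc V (part b z) \<tau> = 0"
      by (simp add: boundary_def)
    then show ?thesis
      using False by (simp add: part_def)
  qed
next
  case False
  then show ?thesis
    by (auto simp: part_def boundary_def)
qed

lemma part_eqD:
  assumes "\<And>b. part b z \<tau> = part b z' \<tau>" "\<tau> \<subseteq> V"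
  shows "z \<tau> = z' \<tau>"
proof (rule poly_mapping_eqI)
  fix u
  show "Poly_Mapping.lookup (z \<tau>) u = Poly_Mapping.lookup (z' \<tau>) u"
    using assms(1)[of "u + lab \<tau>"] assms(2) by (simp add: part_def)
qed

text \<open>The chain with prescribed multigraded components.\<close>

definition assemble :: "('x \<Rightarrow>\<^sub>0 nat) set \<Rightarrow> (('x \<Rightarrow>\<^sub>0 nat) \<Rightarrow> 'i set \<Rightarrow> 'k) \<Rightarrow> 'i set \<Rightarrow> ('x, 'k::field) mpoly" where
  "assemble B h \<sigma> = (\<Sum>b\<in>B. Poly_Mapping.single (b - lab \<sigma>) (h b \<sigma>))"

lemma part_assemble:
  assumes "finite B" and h: "\<And>b \<sigma>. b \<in> B \<Longrightarrow> h b \<sigma> \<noteq> 0 \<Longrightarrow> \<sigma> \<subseteq> V \<and> lab \<sigma> \<preceq> b"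
  shows "part b (assemble B h) \<sigma> = (if b \<in> B then h b \<sigma> else 0)"
proof (cases "\<sigma> \<subseteq> V \<and> lab \<sigma> \<preceq> b")
  case True
  have "(h b' \<sigma> when b' - lab \<sigma> = b - lab \<sigma>) = (if b' = b then h b \<sigma> else 0)" if "b' \<in> B" for b'
  proof (cases "h b' \<sigma> = 0")
    case False
    then have "b' - lab \<sigma> = b - lab \<sigma> \<longleftrightarrow> b' = b"
      using h[OF that] True by (metis mono_diff_add)
    then show ?thesis by auto
  qed auto
  then have "(\<Sum>b'\<in>B. h b' \<sigma> when b' - lab \<sigma> = b - lab \<sigma>) = (\<Sum>b'\<in>B. if b' = b then h b \<sigma> else 0)"
    by (rule sum.cong[OF refl])
  then show ?thesis
    using True assms(1) by (simp add: part_def assemble_def lookup_sum lookup_single)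
next
  case False
  then show ?thesis
    using h by (auto simp: part_def)
qed

lemma keys_assemble: "finite B \<Longrightarrow> u \<in> Poly_Mapping.keys (assemble B h \<sigma>) \<Longrightarrow> \<exists>b\<in>B. u = b - lab \<sigma> \<and> h b \<sigma> \<noteq> 0"
  unfolding assemble_def using keys_sum[of "\<lambda>b. Poly_Mapping.single (b - lab \<sigma>) (h b \<sigma>)" B]
  by (force split: if_splits)

lemma assemble_eq_0: "(\<And>b. b \<in> B \<Longrightarrow> h b \<sigma> = 0) \<Longrightarrow> assemble B h \<sigma> = 0"
  by (simp add: assemble_def)

lemma boundary_assemble:
  assumes B: "finite B" and h: "\<And>b \<sigma>. b \<in> B \<Longrightarrow> h b \<sigma> \<noteq> 0 \<Longrightarrow> \<sigma> \<subseteq> V \<and> lab \<sigma> \<preceq> b"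
    and z: "\<And>\<sigma>. z \<sigma> \<noteq> 0 \<Longrightarrow> \<sigma> \<subseteq> V"
    and bd: "\<And>b. b \<in> B \<Longrightarrow> sboundary enc V (h b) = part b z"
    and B_all: "\<And>\<sigma> u. u \<in> Poly_Mapping.keys (z \<sigma>) \<Longrightarrow> u + lab \<sigma> \<in> B"
  shows "boundary enc V weight (assemble B h) = z"
proof
  fix \<tau>
  show "boundary enc V weight (assemble B h) \<tau> = z \<tau>"
  proof (cases "\<tau> \<subseteq> V")
    case True
    show ?thesis
    proof (rule part_eqD[OF _ True])
      fix b
      have eq: "part b (assemble B h) = (\<lambda>\<sigma>. if b \<in> B then h b \<sigma> else 0)"
        using part_assemble[OF B h] by blast
      show "part b (boundary enc V weight (assemble B h)) \<tau> = part b z \<tau>"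
      proof (cases "b \<in> B")
        case True
        then have "part b (assemble B h) = h b"
          using eq by simp
        then show ?thesis
          by (simp only: part_boundary bd[OF True])
      next
        case False
        have "part b z \<tau> = 0"
        proof (rule ccontr)
          assume "part b z \<tau> \<noteq> 0"
          then have "lab \<tau> \<preceq> b" "b - lab \<tau> \<in> Poly_Mapping.keys (z \<tau>)"
            by (auto simp: part_def in_keys_iff split: if_splits)
          then show False
            using B_all[of "b - lab \<tau>" \<tau>] False by (simp add: mono_diff_add)
        qed
        then show ?thesis
          using eq False by (simp add: part_boundary boundary_def)
      qed
    qed
  next
    case False
    have "\<sigma> \<subseteq> V" if "assemble B h \<sigma> \<noteq> 0" for \<sigma>
    proof (rule ccontr)
      assume "\<not> \<sigma> \<subseteq> V"
      then have "h b \<sigma> = 0" if "b \<in> B" for b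
        using h[OF that] by auto
      then show False
        using that assemble_eq_0[of B h \<sigma>] by simp
    qed
    from boundary_supp[OF this False] have "boundary enc V weight (assemble B h) \<tau> = 0" .
    then show ?thesis
      using z False by auto
  qed
qed

text \<open>
  In multidegree \<open>b\<close> the faces whose labels divide \<open>b\<close> form the full simplex on the vertices whose
  labels divide \<open>b\<close>. If there is such a vertex, the simplex is contracted onto it. The last
  conclusion records that no new multidegrees occur, so that homogeneous cycles bound homogeneous
  chains.
\<close>

theorem exact:
  assumes z: "\<And>\<sigma>. z \<sigma> \<noteq> 0 \<Longrightarrow> \<sigma> \<subseteq> V \<and> card \<sigma> = q"
    and cycle: "boundary enc V weight z = 0"
    and pos: "\<And>\<sigma> u. u \<in> Poly_Mapping.keys (z \<sigma>) \<Longrightarrow> \<exists>i\<in>V. lab {i} \<preceq> u + lab \<sigma>"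
  obtains w :: "'i set \<Rightarrow> ('x, 'k::field) mpoly"
  where "\<And>\<sigma>. w \<sigma> \<noteq> 0 \<Longrightarrow> \<sigma> \<subseteq> V \<and> card \<sigma> = Suc q" and "boundary enc V weight w = z"
    and "\<And>\<sigma> u. u \<in> Poly_Mapping.keys (w \<sigma>) \<Longrightarrow>
      \<exists>\<tau>. \<exists>v\<in>Poly_Mapping.keys (z \<tau>). u + lab \<sigma> = v + lab \<tau>"
proof -
  define B where "B = (\<Union>\<tau>\<in>Pow V. (\<lambda>v. v + lab \<tau>) ` Poly_Mapping.keys (z \<tau>))"
  have B: "finite B"
    using V by (simp add: B_def)
  have B_all: "u + lab \<sigma> \<in> B" if "u \<in> Poly_Mapping.keys (z \<sigma>)" for u \<sigma>
  proof -
    have "\<sigma> \<in> Pow V"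
      using that z[of \<sigma>] by (cases "z \<sigma> = 0") auto
    then show ?thesis
      using that unfolding B_def by blast
  qed
  have "\<exists>i\<in>V. lab {i} \<preceq> b" if b: "b \<in> B" for b
  proof -
    obtain \<sigma> v where "v \<in> Poly_Mapping.keys (z \<sigma>)" "b = v + lab \<sigma>"
      using b by (auto simp: B_def)
    then show ?thesis
      using pos by simp
  qed
  then have "\<forall>b\<in>B. \<exists>i. i \<in> V \<and> lab {i} \<preceq> b"
    by blast
  from bchoice[OF this] obtain i where "\<forall>b\<in>B. i b \<in> V \<and> lab {i b} \<preceq> b" ..
  then have i: "\<And>b. b \<in> B \<Longrightarrow> i b \<in> V" "\<And>b. b \<in> B \<Longrightarrow> lab {i b} \<preceq> b"
    by blast+
  define h where "h b = cone enc (i b) (part b z)" for b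
  have h: "\<sigma> \<subseteq> V \<and> lab \<sigma> \<preceq> b \<and> card \<sigma> = Suc q" if "b \<in> B" "h b \<sigma> \<noteq> 0" for b \<sigma>
  proof -
    have *: "i b \<in> \<sigma>" "part b z (\<sigma> - {i b}) \<noteq> 0"
      using that(2) by (auto simp: h_def cone_def split: if_splits)
    then have **: "\<sigma> - {i b} \<subseteq> V" "lab (\<sigma> - {i b}) \<preceq> b" "z (\<sigma> - {i b}) \<noteq> 0"
      by (auto simp only: part_def lookup_zero split: if_splits)
    then have "\<sigma> \<subseteq> V"
      using i(1)[OF that(1)] by blast
    moreover have "card \<sigma> = Suc q"
      using z[OF **(3), THEN conjunct2] card.remove[OF finite_subset[OF \<open>\<sigma> \<subseteq> V\<close> V(1)] *(1)] by (simp only:)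
    moreover have "lab \<sigma> \<preceq> b"
    proof -
      have "\<forall>j\<in>\<sigma> - {i b}. lab {j} \<preceq> b"
        using label_dvd[OF **(1)] **(2) by blast
      then show ?thesis
        unfolding label_dvd[OF \<open>\<sigma> \<subseteq> V\<close>] using i(2)[OF that(1)] by blast
    qed
    ultimately show ?thesis by blast
  qed
  have bd: "sboundary enc V (h b) = part b z" if "b \<in> B" for b
  proof
    fix \<tau>
    have c0: "sboundary enc V (part b z) = (\<lambda>_. 0)"
      by (rule ext, subst part_boundary[symmetric], subst cycle) (simp add: part_def)
    show "sboundary enc V (h b) \<tau> = part b z \<tau>"
    proof (cases "\<tau> \<subseteq> V")
      case True
      have "cone enc (i b) (sboundary enc V (part b z)) \<tau> = 0"
        unfolding c0 by (simp add: cone_def)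
      then show ?thesis
        using boundary_cone[OF V True i(1)[OF that], of "\<lambda>_. 1" "part b z"] unfolding h_def
        by (simp only: mult_1 add_0_right)
    next
      case False
      have "\<sigma> \<subseteq> V" if "h b \<sigma> \<noteq> 0" for \<sigma>
        using h[OF \<open>b \<in> B\<close> that] by simp
      from boundary_supp[OF this False] have "sboundary enc V (h b) \<tau> = 0" .
      then show ?thesis
        using False by (simp add: part_def)
    qed
  qed
  show ?thesis
  proof
    show "boundary enc V weight (assemble B h) = z"
    proof (rule boundary_assemble[OF B _ _ bd B_all])
      show "\<sigma> \<subseteq> V \<and> lab \<sigma> \<preceq> b" if "b \<in> B" "h b \<sigma> \<noteq> 0" for b \<sigma>
        using h[OF that] by simp
      show "\<sigma> \<subseteq> V" if "z \<sigma> \<noteq> 0" for \<sigma>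
        using z[OF that] by simp
    qed
    show "\<sigma> \<subseteq> V \<and> card \<sigma> = Suc q" if "assemble B h \<sigma> \<noteq> 0" for \<sigma>
    proof -
      obtain b where "b \<in> B" "h b \<sigma> \<noteq> 0"
        using \<open>assemble B h \<sigma> \<noteq> 0\<close> assemble_eq_0[of B h \<sigma>] by auto
      from h[OF this] show ?thesis
        by simp
    qed
    show "\<exists>\<tau>. \<exists>v\<in>Poly_Mapping.keys (z \<tau>). u + lab \<sigma> = v + lab \<tau>"
      if u: "u \<in> Poly_Mapping.keys (assemble B h \<sigma>)" for u \<sigma>
    proof -
      obtain b where b: "b \<in> B" "u = b - lab \<sigma>" "h b \<sigma> \<noteq> 0"
        using keys_assemble[OF B u] by (elim bexE conjE)
      from h[OF b(1,3)] have "lab \<sigma> \<preceq> b"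
        by simp
      then have "u + lab \<sigma> = b"
        by (simp only: b(2) mono_diff_add)
      moreover have "\<exists>\<tau>. \<exists>v\<in>Poly_Mapping.keys (z \<tau>). b = v + lab \<tau>"
        using b(1) unfolding B_def by blast
      ultimately show ?thesis
        by simp
    qed
  qed
qed

end


section \<open>Homogeneous polynomials and the Koszul complex\<close>

lemma homogeneous_zero [simp]: "homogeneous d 0"
  by (simp add: homogeneous_def)

lemma homogeneous_add: "homogeneous d f \<Longrightarrow> homogeneous d g \<Longrightarrow> homogeneous d (f + g)"
  unfolding homogeneous_def using keys_add[of f g] by fast

lemma homogeneous_uminus [simp]: "homogeneous d (- f) \<longleftrightarrow> homogeneous d f"
  by (simp add: homogeneous_def in_keys_iff)

lemma homogeneous_diff: "homogeneous d f \<Longrightarrow> homogeneous d g \<Longrightarrow> homogeneous d (f - g)"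
  using homogeneous_add[of d f "- g"] by simp

lemma homogeneous_sum: "(\<And>x. x \<in> A \<Longrightarrow> homogeneous d (f x)) \<Longrightarrow> homogeneous d (\<Sum>x\<in>A. f x)"
  by (induction A rule: infinite_finite_induct) (simp_all add: homogeneous_add)

lemma homogeneous_mult:
  fixes f g :: "('x::finite, 'k::field) mpoly"
  assumes "homogeneous d f" "homogeneous e g"
  shows "homogeneous (d + e) (f * g)"
  unfolding homogeneous_def
proof
  fix u assume "u \<in> Poly_Mapping.keys (f * g)"
  then obtain a b where "u = a + b" "a \<in> Poly_Mapping.keys f" "b \<in> Poly_Mapping.keys g"
    using keys_mult[of f g] by auto
  then show "int (total_degree u) = d + e"
    using assms by (simp add: homogeneous_def)
qed

lemma homogeneous_single: "(c \<noteq> 0 \<Longrightarrow> int (total_degree u) = d) \<Longrightarrow> homogeneous d (Poly_Mapping.single u c)"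
  by (simp add: homogeneous_def)

lemma homogeneous_var: "homogeneous 1 (var x)"
  by (simp add: var_def homogeneous_single)

lemma homogeneous_sgn_mult:
  fixes f :: "('x, 'k::field) mpoly"
  assumes "homogeneous d f"
  shows "homogeneous d (sgn_at enc x \<tau> * f)"
proof -
  have "sgn_at enc x \<tau> * f = f \<or> sgn_at enc x \<tau> * f = - f"
  proof -
    have "(sgn_at enc x \<tau> :: ('x, 'k) mpoly) = 1 \<or> (sgn_at enc x \<tau> :: ('x, 'k) mpoly) = - 1"
      by (rule sgn_at_cases)
    then show ?thesis
      by auto
  qed
  then show ?thesis
    using assms by auto
qed

definition component :: "int \<Rightarrow> ('x, 'k::field) mpoly \<Rightarrow> ('x, 'k) mpoly" where
  "component d = Poly_Mapping.mapp (\<lambda>u c. c when int (total_degree u) = d)"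

lemma lookup_component: "Poly_Mapping.lookup (component d f) u = (Poly_Mapping.lookup f u when int (total_degree u) = d)"
  by (auto simp: component_def lookup_mapp in_keys_iff when_def)

lemma homogeneous_component: "homogeneous d (component d f)"
  by (auto simp: homogeneous_def in_keys_iff lookup_component when_def split: if_splits)

lemma component_homogeneous: "homogeneous d f \<Longrightarrow> component d f = f"
  by (rule poly_mapping_eqI) (auto simp: lookup_component homogeneous_def in_keys_iff when_def)

lemma component_zero [simp]: "component d 0 = 0"
  by (rule poly_mapping_eqI) (simp add: lookup_component)

lemma component_add: "component d (f + g) = component d f + component d g"
  by (rule poly_mapping_eqI) (simp add: lookup_component lookup_add when_def)

lemma component_sum: "component d (\<Sum>x\<in>A. f x) = (\<Sum>x\<in>A. component d (f x))"
  by (induction A rule: infinite_finite_induct) (simp_all add: component_add)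

text \<open>Multiplication by a homogeneous element shifts homogeneous components.\<close>

lemma component_mult:
  fixes f g :: "('x::finite, 'k::field) mpoly"
  assumes "homogeneous e f"
  shows "component d (f * g) = f * component (d - e) g"
proof (rule poly_mapping_eqI)
  fix u
  have "Poly_Mapping.lookup (f * component (d - e) g) u =
      (\<Sum>l. Poly_Mapping.lookup f l * (\<Sum>q. Poly_Mapping.lookup (component (d - e) g) q when u = l + q))"
    by (simp add: lookup_mult)
  also have "\<dots> = (\<Sum>l. Poly_Mapping.lookup f l * (\<Sum>q. Poly_Mapping.lookup g q when u = l + q) when int (total_degree u) = d)"
  proof (rule Sum_any.cong)
    fix l
    show "Poly_Mapping.lookup f l * (\<Sum>q. Poly_Mapping.lookup (component (d - e) g) q when u = l + q) =
        (Poly_Mapping.lookup f l * (\<Sum>q. Poly_Mapping.lookup g q when u = l + q) when int (total_degree u) = d)"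
    proof (cases "Poly_Mapping.lookup f l = 0")
      case False
      then have l: "int (total_degree l) = e"
        using assms by (simp add: homogeneous_def in_keys_iff)
      have "(Poly_Mapping.lookup (component (d - e) g) q when u = l + q) =
          ((Poly_Mapping.lookup g q when u = l + q) when int (total_degree u) = d)" for q
        using l by (auto simp: lookup_component when_def)
      then show ?thesis
        by (cases "int (total_degree u) = d") simp_all
    qed simp
  qed
  also have "\<dots> = Poly_Mapping.lookup (component d (f * g)) u"
    by (cases "int (total_degree u) = d") (simp_all add: lookup_component lookup_mult)
  finally show "Poly_Mapping.lookup (component d (f * g)) u = Poly_Mapping.lookup (f * component (d - e) g) u"
    by simp
qed

lemma mono_add_eq_0: "u + v = 0 \<longleftrightarrow> u = 0 \<and> v = (0 :: 'x \<Rightarrow>\<^sub>0 nat)"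
  by (auto simp: poly_mapping_eq_iff fun_eq_iff lookup_add)

lemma lookup_mult_0:
  fixes f g :: "('x, 'k::field) mpoly"
  shows "Poly_Mapping.lookup (f * g) 0 = Poly_Mapping.lookup f 0 * Poly_Mapping.lookup g 0"
proof -
  have eq: "((0 :: 'x \<Rightarrow>\<^sub>0 nat) = l + q) = (l = 0 \<and> 0 = q)" for l q
    using mono_add_eq_0[of l q] by (metis add_0_left)
  have "Poly_Mapping.lookup (f * g) 0 =
      (\<Sum>l. Poly_Mapping.lookup f l * (\<Sum>q. (Poly_Mapping.lookup g q when 0 = q) when l = 0))"
    by (simp add: lookup_mult eq when_when conj_commute)
  also have "\<dots> = (\<Sum>l. Poly_Mapping.lookup f l * Poly_Mapping.lookup g 0 when l = 0)"
    by (intro Sum_any.cong) (simp add: when_def)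
  finally show ?thesis
    by simp
qed

text \<open>The squarefree monomial of a set of variables: the label of a face of the Koszul complex.\<close>

definition indicator_mono :: "'x set \<Rightarrow> 'x::finite \<Rightarrow>\<^sub>0 nat" where
  "indicator_mono \<sigma> = Abs_poly_mapping (\<lambda>x. if x \<in> \<sigma> then 1 else 0)"

lemma lookup_indicator_mono [simp]: "Poly_Mapping.lookup (indicator_mono \<sigma>) x = (if x \<in> \<sigma> then 1 else 0)"
  by (simp add: indicator_mono_def)

lemma indicator_mono_empty [simp]: "indicator_mono {} = 0"
  by (rule poly_mapping_eqI) simp

lemma total_degree_indicator_mono [simp]: "total_degree (indicator_mono \<sigma>) = card \<sigma>"
  by (simp add: total_degree_UNIV sum.If_cases)

lemma indicator_mono_dvd: "indicator_mono \<sigma> \<preceq> b \<longleftrightarrow> (\<forall>x\<in>\<sigma>. 1 \<le> Poly_Mapping.lookup b x)"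
  by (auto simp: mono_dvd_def)

lemma indicator_mono_eq_0 [simp]: "indicator_mono \<sigma> = 0 \<longleftrightarrow> \<sigma> = {}"
  by (auto simp: poly_mapping_eq_iff fun_eq_iff)

locale koszul =
  fixes enc :: "'x::finite \<Rightarrow> nat"
  assumes inj_enc: "inj enc"
begin

sublocale labelled_simplex enc UNIV indicator_mono
  using inj_enc by unfold_locales (auto simp: indicator_mono_dvd)

abbreviation koszul_d :: "('x set \<Rightarrow> ('x, 'k::field) mpoly) \<Rightarrow> 'x set \<Rightarrow> ('x, 'k) mpoly" where
  "koszul_d \<equiv> boundary enc UNIV (\<lambda>x _. var x)"

text \<open>The Koszul complex is the Taylor complex of the variables.\<close>

lemma kd_weight:
  fixes z :: "'x set \<Rightarrow> ('x, 'k::field) mpoly"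
  shows "koszul_d z = boundary enc UNIV weight z"
proof
  fix \<tau>
  have "(var x :: ('x, 'k) mpoly) = weight x \<tau>" if "x \<notin> \<tau>" for x
  proof -
    have "indicator_mono (insert x \<tau>) - indicator_mono \<tau> = Poly_Mapping.single x 1"
      using that by (intro poly_mapping_eqI) (auto simp: lookup_minus lookup_single when_def)
    then show ?thesis
      by (simp add: var_def)
  qed
  then show "koszul_d z \<tau> = boundary enc UNIV weight z \<tau>"
    unfolding boundary_def by (intro sum.cong) auto
qed

lemma kd_kd: "koszul_d (koszul_d z) \<tau> = 0"
  by (rule boundary_boundary) (use inj_enc in \<open>auto simp: mult.commute\<close>)

text \<open>
  The Koszul differential with coefficients in a free module, whose elements are vectors of
  polynomials.
\<close>

definition koszul_dv :: "('x set \<Rightarrow> nat \<Rightarrow> ('x, 'k::field) mpoly) \<Rightarrow> 'x set \<Rightarrow> nat \<Rightarrow> ('x, 'k) mpoly" where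
  "koszul_dv z \<tau> = (\<lambda>n. koszul_d (\<lambda>\<sigma>. z \<sigma> n) \<tau>)"

lemma kdv_kdv: "koszul_dv (koszul_dv z) \<tau> = 0"
  by (simp add: koszul_dv_def kd_kd zero_fun_def)

lemma kdv_diff: "koszul_dv (\<lambda>\<sigma>. z \<sigma> - w \<sigma>) \<tau> = koszul_dv z \<tau> - koszul_dv w \<tau>"
  by (simp add: koszul_dv_def boundary_def fun_eq_iff right_diff_distrib sum_subtractf)

lemma kdv_zero: "(\<And>x. x \<notin> \<tau> \<Longrightarrow> z (insert x \<tau>) = 0) \<Longrightarrow> koszul_dv z \<tau> = 0"
  by (simp add: koszul_dv_def boundary_def fun_eq_iff)

lemma mat_apply_zero [simp]: "mat_apply A B D 0 = 0"
  by (simp add: mat_apply_def fun_eq_iff)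

lemma mat_apply_diff: "mat_apply A B D (v - w) = mat_apply A B D v - mat_apply A B D w"
  by (simp add: mat_apply_def fun_eq_iff right_diff_distrib sum_subtractf)

lemma kdv_mat_apply: "mat_apply A B D (koszul_dv z \<tau>) = koszul_dv (\<lambda>\<sigma>. mat_apply A B D (z \<sigma>)) \<tau>"
proof
  fix a
  show "mat_apply A B D (koszul_dv z \<tau>) a = koszul_dv (\<lambda>\<sigma>. mat_apply A B D (z \<sigma>)) \<tau> a"
  proof (cases "a \<in> A")
    case True
    have "mat_apply A B D (koszul_dv z \<tau>) a = (\<Sum>b\<in>B. \<Sum>x\<in>UNIV - \<tau>. D a b * (sgn_at enc x \<tau> * var x * z (insert x \<tau>) b))"
      using True by (simp add: mat_apply_def koszul_dv_def boundary_def sum_distrib_left)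
    also have "\<dots> = (\<Sum>x\<in>UNIV - \<tau>. \<Sum>b\<in>B. D a b * (sgn_at enc x \<tau> * var x * z (insert x \<tau>) b))"
      by (rule sum.swap)
    also have "\<dots> = koszul_dv (\<lambda>\<sigma>. mat_apply A B D (z \<sigma>)) \<tau> a"
      using True by (simp add: mat_apply_def koszul_dv_def boundary_def sum_distrib_left mult_ac)
    finally show ?thesis .
  qed (simp add: mat_apply_def koszul_dv_def boundary_def)
qed

text \<open>Homogeneity of degree \<open>j\<close> for a vector whose \<open>n\<close>-th basis element has degree \<open>t n\<close>.\<close>

definition homogeneous_vec :: "(nat \<Rightarrow> int) \<Rightarrow> int \<Rightarrow> (nat \<Rightarrow> ('x, 'k::field) mpoly) \<Rightarrow> bool" where
  "homogeneous_vec t j v \<longleftrightarrow> (\<forall>n. homogeneous (j - t n) (v n))"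

lemma hv_zero [simp]: "homogeneous_vec t j 0"
  by (simp add: homogeneous_vec_def)

lemma hv_diff: "homogeneous_vec t j v \<Longrightarrow> homogeneous_vec t j w \<Longrightarrow> homogeneous_vec t j (v - w)"
  by (simp add: homogeneous_vec_def homogeneous_diff)

text \<open>
  Homogeneous Koszul chains of total degree \<open>j\<close> in position \<open>q\<close> with coefficients in \<open>N\<close>; a basis
  element of the exterior algebra contributes one degree for each variable in it.
\<close>

definition kchains :: "nat \<Rightarrow> (nat \<Rightarrow> ('x, 'k::field) mpoly) set \<Rightarrow> (nat \<Rightarrow> int) \<Rightarrow> int
    \<Rightarrow> ('x set \<Rightarrow> nat \<Rightarrow> ('x, 'k) mpoly) set" where
  "kchains q N t j = {z. (\<forall>\<sigma>. z \<sigma> \<in> N \<and> homogeneous_vec t (j - int (card \<sigma>)) (z \<sigma>) \<and> (card \<sigma> \<noteq> q \<longrightarrow> z \<sigma> = 0))}"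

lemma kchains_diff:
  assumes "z \<in> kchains q N t j" "w \<in> kchains q N t j" "\<And>v u. v \<in> N \<Longrightarrow> u \<in> N \<Longrightarrow> v - u \<in> N"
  shows "(\<lambda>\<sigma>. z \<sigma> - w \<sigma>) \<in> kchains q N t j"
  using assms by (auto simp: kchains_def intro: hv_diff)

lemma hv_kdv:
  assumes "\<And>\<sigma>. homogeneous_vec t (j - int (card \<sigma>)) (z \<sigma>)"
  shows "homogeneous_vec t (j - int (card \<tau>)) (koszul_dv z \<tau>)"
  unfolding homogeneous_vec_def koszul_dv_def boundary_def
proof (intro allI homogeneous_sum)
  fix n x assume x: "x \<in> UNIV - \<tau>"
  have "homogeneous (j - int (card (insert x \<tau>)) - t n) (z (insert x \<tau>) n)"
    using assms[of "insert x \<tau>"] unfolding homogeneous_vec_def by blast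
  then have "homogeneous (1 + (j - int (card (insert x \<tau>)) - t n)) (var x * z (insert x \<tau>) n)"
    by (intro homogeneous_mult homogeneous_var)
  moreover have "1 + (j - int (card (insert x \<tau>)) - t n) = j - int (card \<tau>) - t n"
    using x by simp
  ultimately show "homogeneous (j - int (card \<tau>) - t n) (sgn_at enc x \<tau> * var x * z (insert x \<tau>) n)"
    by (simp add: homogeneous_sgn_mult mult.assoc)
qed

lemma kdv_card:
  assumes "z \<in> kchains (Suc q) N t j" "card \<tau> \<noteq> q"
  shows "koszul_dv z \<tau> = 0"
proof (rule kdv_zero)
  fix x assume "x \<notin> \<tau>"
  then have "card (insert x \<tau>) \<noteq> Suc q"
    using assms(2) by simp
  then show "z (insert x \<tau>) = 0"
    using assms(1) by (simp add: kchains_def)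
qed

lemma kdv_vectors_on: "(\<And>\<sigma>. z \<sigma> \<in> vectors_on B) \<Longrightarrow> koszul_dv z \<tau> \<in> vectors_on B"
  by (auto simp: vectors_on_def koszul_dv_def boundary_def)

lemma kdv_kchains:
  assumes "z \<in> kchains (Suc q) (vectors_on B) t j"
  shows "koszul_dv z \<in> kchains q (vectors_on B) t j"
  unfolding kchains_def mem_Collect_eq
proof (intro allI conjI impI)
  fix \<tau>
  show "koszul_dv z \<tau> \<in> vectors_on B"
    by (rule kdv_vectors_on) (use assms in \<open>simp add: kchains_def\<close>)
  show "homogeneous_vec t (j - int (card \<tau>)) (koszul_dv z \<tau>)"
    by (rule hv_kdv) (use assms in \<open>simp add: kchains_def\<close>)
  show "koszul_dv z \<tau> = 0" if "card \<tau> \<noteq> q"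
    using kdv_card[OF assms that] .
qed

lemma kchains_mono: "N \<subseteq> N' \<Longrightarrow> kchains q N t j \<subseteq> kchains q N' t j"
  by (auto simp: kchains_def)

text \<open>
  The Koszul complex of a free module is exact except in position 0, where the homology consists
  of the constants. The last hypothesis excludes these and holds automatically in positive
  positions.
\<close>

lemma koszul_exact:
  fixes z :: "'x set \<Rightarrow> nat \<Rightarrow> ('x, 'k::field) mpoly"
  assumes z: "z \<in> kchains q (vectors_on B) t j" and cycle: "\<And>\<tau>. koszul_dv z \<tau> = 0"
    and pos: "\<And>n. Poly_Mapping.lookup (z {} n) 0 = 0"
  obtains w where "w \<in> kchains (Suc q) (vectors_on B) t j" "koszul_dv w = z"
proof -
  have "\<exists>w :: 'x set \<Rightarrow> ('x, 'k) mpoly. (\<forall>\<sigma>. w \<sigma> \<noteq> 0 \<longrightarrow> card \<sigma> = Suc q) \<and> koszul_d w = (\<lambda>\<sigma>. z \<sigma> n) \<and>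
      (\<forall>\<sigma>. \<forall>u\<in>Poly_Mapping.keys (w \<sigma>).
        \<exists>\<tau>. \<exists>v\<in>Poly_Mapping.keys (z \<tau> n). u + indicator_mono \<sigma> = v + indicator_mono \<tau>)" for n
  proof -
    let ?z = "\<lambda>\<sigma>. z \<sigma> n"
    show ?thesis
    proof (rule exact[of ?z q])
      show "\<sigma> \<subseteq> UNIV \<and> card \<sigma> = q" if "z \<sigma> n \<noteq> 0" for \<sigma>
      proof (rule ccontr)
        assume "\<not> ?thesis"
        then have "z \<sigma> = 0"
          using z by (simp add: kchains_def)
        then show False
          using that by simp
      qed
      show "boundary enc UNIV weight ?z = 0"
      proof
        fix \<tau>
        show "boundary enc UNIV weight ?z \<tau> = 0 \<tau>"
          using arg_cong[OF cycle[of \<tau>], of "\<lambda>v. v n"] by (simp add: kd_weight koszul_dv_def)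
      qed
      show "\<exists>i\<in>UNIV. indicator_mono {i} \<preceq> u + indicator_mono \<sigma>" if u: "u \<in> Poly_Mapping.keys (z \<sigma> n)" for \<sigma> u
      proof (rule ccontr)
        assume neg: "\<not> (\<exists>i\<in>UNIV. indicator_mono {i} \<preceq> u + indicator_mono \<sigma>)"
        have "Poly_Mapping.lookup (u + indicator_mono \<sigma>) i = 0" for i
          using neg by (auto simp: indicator_mono_dvd not_le)
        then have "u + indicator_mono \<sigma> = 0"
          by (intro poly_mapping_eqI) simp
        then have "u = 0" "\<sigma> = {}"
          by (simp_all add: mono_add_eq_0)
        then show False
          using u pos[of n] by (simp add: in_keys_iff)
      qed
    next
      fix w :: "'x set \<Rightarrow> ('x, 'k) mpoly"
      assume w: "\<And>\<sigma>. w \<sigma> \<noteq> 0 \<Longrightarrow> \<sigma> \<subseteq> UNIV \<and> card \<sigma> = Suc q" "boundary enc UNIV weight w = ?z"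
        "\<And>\<sigma> u. u \<in> Poly_Mapping.keys (w \<sigma>) \<Longrightarrow>
          \<exists>\<tau>. \<exists>v\<in>Poly_Mapping.keys (z \<tau> n). u + indicator_mono \<sigma> = v + indicator_mono \<tau>"
      show ?thesis
        by (rule exI[of _ w]) (use w in \<open>auto simp: kd_weight\<close>)
    qed
  qed
  from choice[OF allI[OF this]] obtain w where w: "\<forall>n. (\<forall>\<sigma>. w n \<sigma> \<noteq> 0 \<longrightarrow> card \<sigma> = Suc q) \<and> koszul_d (w n) = (\<lambda>\<sigma>. z \<sigma> n) \<and>
      (\<forall>\<sigma>. \<forall>u\<in>Poly_Mapping.keys (w n \<sigma>).
        \<exists>\<tau>. \<exists>v\<in>Poly_Mapping.keys (z \<tau> n). u + indicator_mono \<sigma> = v + indicator_mono \<tau>)" ..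
  then have w1: "card \<sigma> \<noteq> Suc q \<Longrightarrow> w n \<sigma> = 0" and w2: "koszul_d (w n) = (\<lambda>\<sigma>. z \<sigma> n)"
    and w3: "u \<in> Poly_Mapping.keys (w n \<sigma>) \<Longrightarrow>
      \<exists>\<tau>. \<exists>v\<in>Poly_Mapping.keys (z \<tau> n). u + indicator_mono \<sigma> = v + indicator_mono \<tau>" for n \<sigma> u
    by blast+
  show ?thesis
  proof
    have "w n \<sigma> = 0" if "n \<notin> B" for n \<sigma>
    proof -
      have "z \<tau> n = 0" for \<tau>
        using z that by (simp add: kchains_def vectors_on_def)
      then have "Poly_Mapping.keys (w n \<sigma>) = {}"
        using w3 by (intro equals0I) fastforce
      then show ?thesis
        by simp
    qed
    moreover have "homogeneous (j - int (card \<sigma>) - t n) (w n \<sigma>)" for n \<sigma>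
      unfolding homogeneous_def
    proof
      fix u assume "u \<in> Poly_Mapping.keys (w n \<sigma>)"
      then obtain \<tau> v where v: "v \<in> Poly_Mapping.keys (z \<tau> n)" and eq: "u + indicator_mono \<sigma> = v + indicator_mono \<tau>"
        using w3 by blast
      have "homogeneous (j - int (card \<tau>) - t n) (z \<tau> n)"
        using z by (simp add: kchains_def homogeneous_vec_def)
      then have "int (total_degree v) = j - int (card \<tau>) - t n"
        using v by (simp add: homogeneous_def)
      moreover have "total_degree u + card \<sigma> = total_degree v + card \<tau>"
        using arg_cong[OF eq, of total_degree] by simp
      ultimately show "int (total_degree u) = j - int (card \<sigma>) - t n"
        by linarith
    qed
    ultimately show "(\<lambda>\<sigma> n. w n \<sigma>) \<in> kchains (Suc q) (vectors_on B) t j"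
      using w1 by (simp add: kchains_def vectors_on_def homogeneous_vec_def fun_eq_iff)
    show "koszul_dv (\<lambda>\<sigma> n. w n \<sigma>) = z"
      by (rule ext) (simp add: koszul_dv_def w2)
  qed
qed

end


section \<open>Koszul homology along a resolution\<close>

text \<open>
  A graded free resolution together with its augmentation, so that position 0 is the polynomial
  ring and the resolution itself starts in position 1. Exactness is required in all positions
  except 0.
\<close>

locale graded_exact_sequence = koszul enc for enc :: "'x::finite \<Rightarrow> nat" +
  fixes B :: "nat \<Rightarrow> nat set" and t :: "nat \<Rightarrow> nat \<Rightarrow> int"
    and D :: "nat \<Rightarrow> nat \<Rightarrow> nat \<Rightarrow> ('x, 'k::field) mpoly"
  assumes hom: "a \<in> B p \<Longrightarrow> b \<in> B (Suc p) \<Longrightarrow> homogeneous (t (Suc p) b - t p a) (D p a b)"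
    and exact_seq: "{v \<in> vectors_on (B (Suc p)). mat_apply (B p) (B (Suc p)) (D p) v = 0} =
      mat_apply (B (Suc p)) (B (Suc (Suc p))) (D (Suc p)) ` vectors_on (B (Suc (Suc p)))"
begin

abbreviation F :: "nat \<Rightarrow> (nat \<Rightarrow> ('x, 'k) mpoly) set" where "F p \<equiv> vectors_on (B p)"

abbreviation M :: "nat \<Rightarrow> (nat \<Rightarrow> ('x, 'k) mpoly) \<Rightarrow> nat \<Rightarrow> ('x, 'k) mpoly" where
  "M p \<equiv> mat_apply (B p) (B (Suc p)) (D p)"

text \<open>The image of each map: the ideal for \<open>p = 0\<close>, and the syzygy modules after that.\<close>

definition N :: "nat \<Rightarrow> (nat \<Rightarrow> ('x, 'k) mpoly) set" where
  "N p = M p ` F (Suc p)"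

lemma F_diff: "v \<in> F p \<Longrightarrow> w \<in> F p \<Longrightarrow> v - w \<in> F p"
  by (simp add: vectors_on_def)

lemma zero_F [simp]: "0 \<in> F p"
  by (simp add: vectors_on_def)

lemma M_F [simp]: "M p v \<in> F p"
  by (simp add: vectors_on_def mat_apply_def)

lemma N_subset: "N p \<subseteq> F p"
  by (auto simp: N_def simp del: M_F intro: M_F)

lemma N_Suc: "v \<in> N (Suc p) \<longleftrightarrow> v \<in> F (Suc p) \<and> M p v = 0"
  using exact_seq[of p] by (auto simp: N_def)

lemma M_M: "v \<in> F (Suc (Suc p)) \<Longrightarrow> M p (M (Suc p) v) = 0"
  using N_Suc[of "M (Suc p) v" p] by (auto simp: N_def)

lemma zero_N [simp]: "0 \<in> N p"
  unfolding N_def using zero_F by (metis image_eqI mat_apply_zero)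

lemma hv_M:
  assumes "homogeneous_vec (t (Suc p)) j v"
  shows "homogeneous_vec (t p) j (M p v)"
  unfolding homogeneous_vec_def
proof
  fix a
  have "homogeneous (j - t p a) (\<Sum>b\<in>B (Suc p). D p a b * v b)" if "a \<in> B p"
  proof (rule homogeneous_sum)
    fix b assume "b \<in> B (Suc p)"
    then have "homogeneous ((t (Suc p) b - t p a) + (j - t (Suc p) b)) (D p a b * v b)"
      using assms hom[OF that] by (intro homogeneous_mult) (auto simp: homogeneous_vec_def)
    then show "homogeneous (j - t p a) (D p a b * v b)"
      by simp
  qed
  then show "homogeneous (j - t p a) (M p v a)"
    by (simp add: mat_apply_def)
qed

text \<open>The maps have degree 0, so the homogeneous component of any preimage is again a preimage.\<close>

lemma homogeneous_lift:
  assumes "v \<in> N p" "homogeneous_vec (t p) j v"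
  obtains u where "u \<in> F (Suc p)" "homogeneous_vec (t (Suc p)) j u" "M p u = v"
proof -
  obtain u where u: "u \<in> F (Suc p)" "M p u = v"
    using assms(1) by (auto simp: N_def)
  \<comment> \<open>The coordinate \<open>b\<close> of a vector of degree \<open>j\<close> has degree \<open>j\<close> minus that of the basis element.\<close>
  define u' where "u' = (\<lambda>b. component (j - t (Suc p) b) (u b))"
  have "M p u' a = v a" for a
  proof (cases "a \<in> B p")
    case True
    have "D p a b * u' b = component (j - t p a) (D p a b * u b)" if "b \<in> B (Suc p)" for b
      using component_mult[OF hom[OF True that], of "j - t p a" "u b"] by (simp add: u'_def)
    then have "M p u' a = component (j - t p a) (M p u a)"
      using True by (simp add: mat_apply_def component_sum)
    also have "\<dots> = v a"
      using assms(2) u(2) by (simp add: homogeneous_vec_def component_homogeneous)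
    finally show ?thesis .
  next
    case False
    then have "v a = 0"
      using u(2) by (auto simp: mat_apply_def)
    then show ?thesis
      using False by (simp add: mat_apply_def)
  qed
  then have "M p u' = v" ..
  moreover have "u' \<in> F (Suc p)" "homogeneous_vec (t (Suc p)) j u'"
    using u(1) by (simp_all add: u'_def vectors_on_def homogeneous_vec_def homogeneous_component)
  ultimately show ?thesis
    using that by blast
qed

lemma kchains_lift:
  assumes z: "z \<in> kchains q (N p) (t p) j"
  obtains y where "y \<in> kchains q (F (Suc p)) (t (Suc p)) j" "(\<lambda>\<sigma>. M p (y \<sigma>)) = z"
proof -
  have "\<exists>y. y \<in> F (Suc p) \<and> homogeneous_vec (t (Suc p)) (j - int (card \<sigma>)) y \<and> M p y = z \<sigma> \<and> (card \<sigma> \<noteq> q \<longrightarrow> y = 0)" for \<sigma>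
  proof (cases "card \<sigma> = q")
    case True
    have "z \<sigma> \<in> N p" "homogeneous_vec (t p) (j - int (card \<sigma>)) (z \<sigma>)"
      using z by (simp_all add: kchains_def)
    then show ?thesis
      by (rule homogeneous_lift) (use True in auto)
  next
    case False
    then have "z \<sigma> = 0"
      using z by (simp add: kchains_def)
    then show ?thesis
      by (intro exI[of _ 0]) simp
  qed
  from choice[OF allI[OF this]] obtain y where "\<forall>\<sigma>. y \<sigma> \<in> F (Suc p) \<and> homogeneous_vec (t (Suc p)) (j - int (card \<sigma>)) (y \<sigma>) \<and>
      M p (y \<sigma>) = z \<sigma> \<and> (card \<sigma> \<noteq> q \<longrightarrow> y \<sigma> = 0)" ..
  then show ?thesis
    by (intro that[of y]) (simp_all add: kchains_def)
qed

lemma kchains_M: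
  assumes "y \<in> kchains q (F (Suc p)) (t (Suc p)) j"
  shows "(\<lambda>\<sigma>. M p (y \<sigma>)) \<in> kchains q (N p) (t p) j"
  using assms by (auto simp: kchains_def N_def hv_M)

lemma kchains_F: "z \<in> kchains q (N p) (t p) j \<Longrightarrow> z \<in> kchains q (F p) (t p) j"
  using kchains_mono[OF N_subset] by blast

lemma kdv_M: "koszul_dv (\<lambda>\<sigma>. M p (y \<sigma>)) \<tau> = M p (koszul_dv y \<tau>)"
  by (simp add: kdv_mat_apply)

lemma kchains_kernel:
  assumes "y \<in> kchains q (F (Suc p)) (t (Suc p)) j" "\<And>\<sigma>. M p (y \<sigma>) = 0"
  shows "y \<in> kchains q (N (Suc p)) (t (Suc p)) j"
  using assms by (simp add: kchains_def N_Suc)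

lemma koszul_exact_Suc:
  assumes "z \<in> kchains (Suc q) (F p) (t p) j" "\<And>\<tau>. koszul_dv z \<tau> = 0"
  obtains w where "w \<in> kchains (Suc (Suc q)) (F p) (t p) j" "koszul_dv w = z"
proof (rule koszul_exact[OF assms])
  have "z {} = 0"
    using assms(1) by (simp add: kchains_def)
  then show "Poly_Mapping.lookup (z {} n) 0 = 0" for n
    by simp
qed

lemma kchains_0:
  assumes "z \<in> kchains 0 N' t' j"
  shows "z {} \<in> N'" "homogeneous_vec t' j (z {})" "\<sigma> \<noteq> {} \<Longrightarrow> z \<sigma> = 0"
proof -
  have *: "\<forall>\<sigma>. z \<sigma> \<in> N' \<and> homogeneous_vec t' (j - int (card \<sigma>)) (z \<sigma>) \<and> (card \<sigma> \<noteq> 0 \<longrightarrow> z \<sigma> = 0)"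
    using assms unfolding kchains_def mem_Collect_eq .
  from spec[OF *, of "{}"] show "z {} \<in> N'" "homogeneous_vec t' j (z {})"
    by simp_all
  show "z \<sigma> = 0" if "\<sigma> \<noteq> {}"
    using spec[OF *, of \<sigma>] that by simp
qed

text \<open>
  The map from the Koszul homology of \<open>N p\<close> to that of the free module \<open>F p\<close> is injective in
  position \<open>q\<close> and degree \<open>j\<close>. For positive \<open>q\<close> the target vanishes, and this says that the Koszul
  homology of \<open>N p\<close> vanishes. Demanding that cycles bound in \<open>F p\<close> makes the following shift valid
  for \<open>q = 0\<close> as well.
\<close>

definition koszul_vanish :: "nat \<Rightarrow> nat \<Rightarrow> int \<Rightarrow> bool" where
  "koszul_vanish q p j \<longleftrightarrow> (\<forall>z\<in>kchains q (N p) (t p) j. \<forall>y\<in>kchains (Suc q) (F p) (t p) j.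
      koszul_dv y = z \<longrightarrow> (\<exists>w\<in>kchains (Suc q) (N p) (t p) j. koszul_dv w = z))"

text \<open>
  This is the long exact sequence of Koszul homology of the short exact sequence formed by
  \<open>N (Suc p)\<close>, \<open>F (Suc p)\<close> and \<open>N p\<close>: the Koszul complexes of the free modules are exact in
  positive positions, so the connecting map identifies the two homology groups. Both directions
  are a diagram chase.
\<close>

lemma koszul_vanish_shift: "koszul_vanish (Suc q) p j \<longleftrightarrow> koszul_vanish q (Suc p) j"
proof
  assume *: "koszul_vanish q (Suc p) j"
  show "koszul_vanish (Suc q) p j"
    unfolding koszul_vanish_def
  proof (intro ballI impI)
    fix z y0 assume z: "z \<in> kchains (Suc q) (N p) (t p) j" and y0: "koszul_dv y0 = z"
    obtain y where y: "y \<in> kchains (Suc q) (F (Suc p)) (t (Suc p)) j" "(\<lambda>\<sigma>. M p (y \<sigma>)) = z"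
      by (rule kchains_lift[OF z])
    note My = y(2)
    have "M p (koszul_dv y \<tau>) = 0" for \<tau>
      using kdv_M[of p y \<tau>] kdv_kdv[of y0 \<tau>] by (simp only: My y0)
    then have "koszul_dv y \<in> kchains q (N (Suc p)) (t (Suc p)) j"
      by (rule kchains_kernel[OF kdv_kchains[OF y(1)]])
    then obtain w' where w': "w' \<in> kchains (Suc q) (N (Suc p)) (t (Suc p)) j" "koszul_dv w' = koszul_dv y"
      using * y(1) unfolding koszul_vanish_def by blast
    have d: "(\<lambda>\<sigma>. y \<sigma> - w' \<sigma>) \<in> kchains (Suc q) (F (Suc p)) (t (Suc p)) j"
      by (rule kchains_diff[OF y(1) kchains_F[OF w'(1)] F_diff])
    have cyc: "koszul_dv (\<lambda>\<sigma>. y \<sigma> - w' \<sigma>) \<tau> = 0" for \<tau>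
      by (simp add: kdv_diff w'(2))
    obtain u where u: "u \<in> kchains (Suc (Suc q)) (F (Suc p)) (t (Suc p)) j" "koszul_dv u = (\<lambda>\<sigma>. y \<sigma> - w' \<sigma>)"
      by (rule koszul_exact_Suc[OF d cyc])
    have "koszul_dv (\<lambda>\<sigma>. M p (u \<sigma>)) \<tau> = z \<tau>" for \<tau>
    proof -
      have "M p (w' \<tau>) = 0"
        using w'(1) by (simp add: kchains_def N_Suc)
      then show ?thesis
        using fun_cong[OF My, of \<tau>] unfolding kdv_M u(2) mat_apply_diff by simp
    qed
    then show "\<exists>w\<in>kchains (Suc (Suc q)) (N p) (t p) j. koszul_dv w = z"
      using kchains_M[OF u(1)] by blast
  qed
next
  assume *: "koszul_vanish (Suc q) p j"
  show "koszul_vanish q (Suc p) j"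
    unfolding koszul_vanish_def
  proof (intro ballI impI)
    fix z y assume z: "z \<in> kchains q (N (Suc p)) (t (Suc p)) j"
      and y: "y \<in> kchains (Suc q) (F (Suc p)) (t (Suc p)) j" and zy: "koszul_dv y = z"
    let ?x = "\<lambda>\<sigma>. M p (y \<sigma>)"
    have x: "?x \<in> kchains (Suc q) (N p) (t p) j"
      by (rule kchains_M[OF y])
    have cyc: "koszul_dv ?x \<tau> = 0" for \<tau>
      using z unfolding kdv_M zy by (simp add: kchains_def N_Suc)
    obtain y0 where y0: "y0 \<in> kchains (Suc (Suc q)) (F p) (t p) j" "koszul_dv y0 = ?x"
      by (rule koszul_exact_Suc[OF kchains_F[OF x] cyc])
    then obtain w where w: "w \<in> kchains (Suc (Suc q)) (N p) (t p) j" "koszul_dv w = ?x"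
      using * x unfolding koszul_vanish_def by blast
    obtain u where u: "u \<in> kchains (Suc (Suc q)) (F (Suc p)) (t (Suc p)) j" "(\<lambda>\<sigma>. M p (u \<sigma>)) = w"
      by (rule kchains_lift[OF w(1)])
    note Mu = u(2)
    have Mku: "M p (koszul_dv u \<tau>) = M p (y \<tau>)" for \<tau>
      using kdv_M[of p u \<tau>] by (simp only: Mu w(2))
    have "(\<lambda>\<sigma>. y \<sigma> - koszul_dv u \<sigma>) \<in> kchains (Suc q) (F (Suc p)) (t (Suc p)) j"
      by (rule kchains_diff[OF y kdv_kchains[OF u(1)] F_diff])
    then have "(\<lambda>\<sigma>. y \<sigma> - koszul_dv u \<sigma>) \<in> kchains (Suc q) (N (Suc p)) (t (Suc p)) j"
      by (rule kchains_kernel) (simp add: mat_apply_diff Mku)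
    moreover have "koszul_dv (\<lambda>\<sigma>. y \<sigma> - koszul_dv u \<sigma>) \<tau> = z \<tau>" for \<tau>
      by (simp add: kdv_diff kdv_kdv zy)
    then have "koszul_dv (\<lambda>\<sigma>. y \<sigma> - koszul_dv u \<sigma>) = z" ..
    ultimately show "\<exists>w\<in>kchains (Suc q) (N (Suc p)) (t (Suc p)) j. koszul_dv w = z"
      by blast
  qed
qed

lemma koszul_vanish_shift_all: "koszul_vanish q p j \<longleftrightarrow> koszul_vanish 0 (p + q) j"
  by (induction q arbitrary: p) (simp_all add: koszul_vanish_shift)

definition const_part :: "(nat \<Rightarrow> ('x, 'k) mpoly) \<Rightarrow> nat \<Rightarrow> 'k" where
  "const_part v = (\<lambda>n. Poly_Mapping.lookup (v n) 0)"

text \<open>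
  The matrices of constant terms and the vector spaces they act on: the resolution tensored with
  the field.
\<close>

definition const_map :: "nat \<Rightarrow> (nat \<Rightarrow> 'k) \<Rightarrow> nat \<Rightarrow> 'k" where
  "const_map p = mat_apply (B p) (B (Suc p)) (\<lambda>a b. Poly_Mapping.lookup (D p a b) 0)"

definition const_vectors :: "nat \<Rightarrow> int \<Rightarrow> (nat \<Rightarrow> 'k) set" where
  "const_vectors p j = vectors_on {b \<in> B p. t p b = j}"

definition of_const :: "(nat \<Rightarrow> 'k) \<Rightarrow> nat \<Rightarrow> ('x, 'k) mpoly" where
  "of_const v = (\<lambda>n. Poly_Mapping.single 0 (v n))"

lemma const_part_M: "const_part (M p v) = const_map p (const_part v)"
  by (auto simp: const_part_def const_map_def mat_apply_def fun_eq_iff lookup_sum lookup_mult_0)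

lemma const_part_diff: "const_part (v - w) = const_part v - const_part w"
  by (simp add: const_part_def fun_eq_iff lookup_minus)

lemma const_of_const [simp]: "const_part (of_const v) = v"
  by (simp add: const_part_def of_const_def)

lemma of_const_F: "v \<in> const_vectors p j \<Longrightarrow> of_const v \<in> F p \<and> homogeneous_vec (t p) j (of_const v)"
  unfolding const_vectors_def vectors_on_def of_const_def homogeneous_vec_def
  by (auto intro!: homogeneous_single)

lemma const_part_TF:
  assumes "v \<in> F p" "homogeneous_vec (t p) j v"
  shows "const_part v \<in> const_vectors p j"
  unfolding const_vectors_def vectors_on_def mem_Collect_eq
proof (intro allI impI)
  fix b assume b: "\<not> (b \<in> B p \<and> t p b = j)"
  show "const_part v b = 0"
  proof (rule ccontr)
    assume nz: "const_part v b \<noteq> 0"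
    then have "b \<in> B p"
      using assms(1) by (auto simp: const_part_def vectors_on_def)
    moreover have "0 \<in> Poly_Mapping.keys (v b)" "homogeneous (j - t p b) (v b)"
      using nz assms(2) by (simp_all add: const_part_def in_keys_iff homogeneous_vec_def)
    then have "j = t p b"
      unfolding homogeneous_def by force
    ultimately show False
      using b by simp
  qed
qed

lemma const_part_kdv: "const_part (koszul_dv z \<tau>) = 0"
  by (simp add: const_part_def koszul_dv_def boundary_def fun_eq_iff lookup_sum mult.assoc lookup_mult_0 var_def lookup_single)
    (simp add: when_def poly_mapping_eq_iff fun_eq_iff lookup_single)

lemma const_part_zero_koszul:
  assumes "u \<in> F p" "homogeneous_vec (t p) j u" "const_part u = 0"
  obtains y where "y \<in> kchains 1 (F p) (t p) j" "koszul_dv y = (\<lambda>\<sigma>. if \<sigma> = {} then u else 0)"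
proof (rule koszul_exact)
  let ?z = "\<lambda>\<sigma>. if \<sigma> = {} then u else 0"
  show "?z \<in> kchains 0 (F p) (t p) j"
    using assms by (auto simp: kchains_def vectors_on_def)
  show "koszul_dv ?z \<tau> = 0" for \<tau>
    by (rule kdv_zero) simp
  show "Poly_Mapping.lookup ((if {} = {} then u else 0) n) 0 = 0" for n
    using assms(3) by (simp add: const_part_def fun_eq_iff)
qed (use that in simp)

text \<open>
  A vector lies in the product of the maximal ideal and \<open>F p\<close> exactly if its constant terms
  vanish. Hence a relation among the constant terms of the generators of \<open>N p\<close> that is not itself
  a constant term of a relation is the same as an element of \<open>N p\<close> that lies in the maximal ideal
  times \<open>F p\<close> but not in the maximal ideal times \<open>N p\<close>.
\<close>

lemma koszul_vanish_iff_homology: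
  "koszul_vanish 0 p j \<longleftrightarrow> (\<forall>v\<in>const_vectors (Suc p) j. const_map p v = 0 \<longrightarrow> v \<in> const_map (Suc p) ` const_vectors (Suc (Suc p)) j)"
proof
  assume *: "koszul_vanish 0 p j"
  show "\<forall>v\<in>const_vectors (Suc p) j. const_map p v = 0 \<longrightarrow> v \<in> const_map (Suc p) ` const_vectors (Suc (Suc p)) j"
  proof (intro ballI impI)
    fix v assume v: "v \<in> const_vectors (Suc p) j" "const_map p v = 0"
    let ?u = "M p (of_const v)"
    let ?z = "\<lambda>\<sigma>. if \<sigma> = {} then ?u else 0"
    have cv: "of_const v \<in> F (Suc p)" "homogeneous_vec (t (Suc p)) j (of_const v)"
      using of_const_F[OF v(1)] by auto
    have cu: "const_part ?u = 0"
      by (simp add: const_part_M v(2))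
    obtain y where y: "y \<in> kchains 1 (F p) (t p) j" "koszul_dv y = ?z"
      by (rule const_part_zero_koszul[OF M_F hv_M[OF cv(2)] cu])
    have "?u \<in> N p"
      using cv(1) by (simp add: N_def)
    then have "?z \<in> kchains 0 (N p) (t p) j"
      using hv_M[OF cv(2)] by (simp add: kchains_def)
    then obtain w where w: "w \<in> kchains 1 (N p) (t p) j" "koszul_dv w = ?z"
      using * y unfolding koszul_vanish_def One_nat_def by blast
    obtain Y where Y: "Y \<in> kchains 1 (F (Suc p)) (t (Suc p)) j" "(\<lambda>\<sigma>. M p (Y \<sigma>)) = w"
      by (rule kchains_lift[OF w(1)])
    note MY = Y(2)
    have kY: "koszul_dv Y {} \<in> F (Suc p)" "homogeneous_vec (t (Suc p)) j (koszul_dv Y {})"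
      using kchains_0(1,2)[OF kdv_kchains[OF Y(1)[unfolded One_nat_def]]] by blast+
    have "M p (koszul_dv Y {}) = ?u"
      using kdv_M[of p Y "{}"] by (simp add: MY w(2))
    then have "of_const v - koszul_dv Y {} \<in> N (Suc p)"
      using cv(1) kY(1) by (simp add: N_Suc mat_apply_diff F_diff)
    then obtain x where x: "x \<in> F (Suc (Suc p))" "homogeneous_vec (t (Suc (Suc p))) j x" "M (Suc p) x = of_const v - koszul_dv Y {}"
      by (rule homogeneous_lift) (rule hv_diff[OF cv(2) kY(2)])
    have "const_map (Suc p) (const_part x) = v"
      using arg_cong[OF x(3), of const_part] by (simp add: const_part_M const_part_diff const_part_kdv)
    then show "v \<in> const_map (Suc p) ` const_vectors (Suc (Suc p)) j"
      using const_part_TF[OF x(1,2)] by blast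
  qed
next
  assume *: "\<forall>v\<in>const_vectors (Suc p) j. const_map p v = 0 \<longrightarrow> v \<in> const_map (Suc p) ` const_vectors (Suc (Suc p)) j"
  show "koszul_vanish 0 p j"
    unfolding koszul_vanish_def
  proof (intro ballI impI)
    fix z y0 assume z: "z \<in> kchains 0 (N p) (t p) j" and y0: "koszul_dv y0 = z"
    have zN: "z {} \<in> N p" "homogeneous_vec (t p) j (z {})" and z0: "\<sigma> \<noteq> {} \<Longrightarrow> z \<sigma> = 0" for \<sigma>
      using kchains_0[OF z] by blast+
    obtain y where y: "y \<in> F (Suc p)" "homogeneous_vec (t (Suc p)) j y" "M p y = z {}"
      by (rule homogeneous_lift[OF zN])
    have "const_map p (const_part y) = 0"
      using const_part_kdv[of y0 "{}"] by (simp add: const_part_M[symmetric] y(3) y0)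
    then obtain w where w: "w \<in> const_vectors (Suc (Suc p)) j" "const_part y = const_map (Suc p) w"
      using * const_part_TF[OF y(1,2)] by blast
    let ?y = "y - M (Suc p) (of_const w)"
    have cw: "of_const w \<in> F (Suc (Suc p))" "homogeneous_vec (t (Suc (Suc p))) j (of_const w)"
      using of_const_F[OF w(1)] by auto
    have "?y \<in> F (Suc p)" "homogeneous_vec (t (Suc p)) j ?y" "const_part ?y = 0"
      using F_diff[OF y(1) M_F] hv_diff[OF y(2) hv_M[OF cw(2)]]
      by (simp_all add: const_part_diff const_part_M w(2))
    then obtain Y where Y: "Y \<in> kchains 1 (F (Suc p)) (t (Suc p)) j" "koszul_dv Y = (\<lambda>\<sigma>. if \<sigma> = {} then ?y else 0)"
      by (rule const_part_zero_koszul)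
    have "M p ?y = z {}"
      by (simp add: mat_apply_diff y(3) M_M[OF cw(1)])
    then have "koszul_dv (\<lambda>\<sigma>. M p (Y \<sigma>)) \<tau> = z \<tau>" for \<tau>
      by (simp add: kdv_M Y(2) z0)
    then have "koszul_dv (\<lambda>\<sigma>. M p (Y \<sigma>)) = z" ..
    then show "\<exists>w\<in>kchains (Suc 0) (N p) (t p) j. koszul_dv w = z"
      using kchains_M[OF Y(1)] by auto
  qed
qed

end


section \<open>Tensor homology and upper Koszul simplicial complexes\<close>

text \<open>
  Only the vanishing of homology matters below, and this can be read off from an inclusion instead
  of dimensions.
\<close>

lemma dim_diff_eq_0_iff:
  assumes "fun_space.subspace (W :: (nat \<Rightarrow> 'k::field) set)" "W \<subseteq> Z" "Z \<subseteq> vectors_on A" "finite A"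
  shows "fun_space.dim Z - fun_space.dim W = 0 \<longleftrightarrow> Z \<subseteq> W"
proof
  assume dim: "fun_space.dim Z - fun_space.dim W = 0"
  let ?e = "\<lambda>a. (\<lambda>b. if b = a then 1 else 0) :: nat \<Rightarrow> 'k"
  have fin: "finite S" if "S \<subseteq> Z" "fun_space.independent S" for S
  proof -
    have "v \<in> fun_space.span (?e ` A)" if "v \<in> vectors_on A" for v
    proof -
      have "v = (\<Sum>a\<in>A. fun_scale (v a) (?e a))"
      proof
        fix b
        have "(\<Sum>a\<in>A. fun_scale (v a) (?e a)) b = (\<Sum>a\<in>A. fun_scale (v a) (?e a) b)"
          using \<open>finite A\<close> by (induction A) simp_all
        also have "\<dots> = (\<Sum>a\<in>A. if b = a then v b else 0)"
          by (intro sum.cong) (auto simp: fun_scale_def)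
        also have "\<dots> = v b"
          using that \<open>finite A\<close> by (simp add: vectors_on_def)
        finally show "v b = (\<Sum>a\<in>A. fun_scale (v a) (?e a)) b" ..
      qed
      then show ?thesis
        by (metis (no_types, lifting) fun_space.span_base fun_space.span_scale fun_space.span_sum imageI)
    qed
    then have "S \<subseteq> fun_space.span (?e ` A)"
      using that assms(3) by blast
    then show ?thesis
      using fun_space.independent_span_bound[of "?e ` A" S] that \<open>finite A\<close> by blast
  qed
  obtain b where b: "b \<subseteq> W" "fun_space.independent b" "W \<subseteq> fun_space.span b" "card b = fun_space.dim W"
    using fun_space.basis_exists[of W] by metis
  obtain c where c: "c \<subseteq> Z" "fun_space.independent c" "Z \<subseteq> fun_space.span c" "card c = fun_space.dim Z"
    using fun_space.basis_exists[of Z] by metis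
  have fb: "finite b"
    using fin b(1,2) assms(2) by blast
  have fc: "finite c"
    using fin c(1,2) by blast
  show "Z \<subseteq> W"
  proof (rule ccontr)
    assume "\<not> Z \<subseteq> W"
    then obtain v where v: "v \<in> Z" "v \<notin> W"
      by blast
    have "v \<notin> fun_space.span b"
      using v fun_space.span_minimal[OF b(1) assms(1)] by blast
    then have "fun_space.independent (insert v b)"
      using b(2) by (rule fun_space.independent_insertI)
    moreover have "v \<notin> b"
      using v(2) b(1) by blast
    moreover have "insert v b \<subseteq> fun_space.span c"
      using v(1) b(1) assms(2) c(3) by blast
    ultimately have "card (insert v b) \<le> card c"
      using fun_space.independent_span_bound[OF fc] by blast
    then show False
      using fb \<open>v \<notin> b\<close> b(4) c(4) dim by simp
  qed
next
  assume "Z \<subseteq> W"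
  then have "Z = W"
    using assms(2) by blast
  then show "fun_space.dim Z - fun_space.dim W = 0"
    by simp
qed

text \<open>The upper Koszul simplicial complex of a monomial ideal in multidegree \<open>b\<close>, where \<open>U\<close> is the set of
  monomials in the ideal. Its reduced homology computes the multigraded Betti numbers.\<close>

definition koszul_complex :: "('x::finite \<Rightarrow>\<^sub>0 nat) set \<Rightarrow> ('x \<Rightarrow>\<^sub>0 nat) \<Rightarrow> 'x set set" where
  "koszul_complex U b = {\<sigma>. indicator_mono \<sigma> \<preceq> b \<and> b - indicator_mono \<sigma> \<in> U}"

definition simplicial_chain :: "'x set set \<Rightarrow> nat \<Rightarrow> ('x set \<Rightarrow> 'k::zero) \<Rightarrow> bool" where
  "simplicial_chain \<Delta> n c \<longleftrightarrow> (\<forall>\<sigma>. c \<sigma> \<noteq> 0 \<longrightarrow> \<sigma> \<in> \<Delta> \<and> card \<sigma> = n)"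

text \<open>
  Vanishing of the homology in position \<open>n\<close>, which is reduced homology in dimension \<open>n - 1\<close>. The
  first argument only selects the field of coefficients.
\<close>

definition exact_at :: "'k::field itself \<Rightarrow> ('x \<Rightarrow> nat) \<Rightarrow> 'x set set \<Rightarrow> nat \<Rightarrow> bool" where
  "exact_at _ enc \<Delta> n \<longleftrightarrow> (\<forall>c :: 'x set \<Rightarrow> 'k. simplicial_chain \<Delta> n c \<and> sboundary enc UNIV c = (\<lambda>_. 0) \<longrightarrow>
     (\<exists>h. simplicial_chain \<Delta> (Suc n) h \<and> sboundary enc UNIV h = c))"

context graded_exact_sequence
begin

text \<open>
  A Koszul chain with coefficients in a monomial ideal splits into its multigraded components, and
  the component of multidegree \<open>b\<close> is a simplicial chain on the upper Koszul complex of \<open>b\<close>.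
\<close>

lemma koszul_vanish_simplicial:
  assumes B0: "B 0 = {0}" "t 0 = (\<lambda>_. 0)"
    and N0: "N 0 = {v. Poly_Mapping.keys (v 0) \<subseteq> U \<and> (\<forall>n. n \<noteq> 0 \<longrightarrow> v n = 0)}" and U: "0 \<notin> U"
  shows "koszul_vanish n 0 j \<longleftrightarrow>
    (\<forall>b. int (total_degree b) = j \<longrightarrow> exact_at TYPE('k) enc (koszul_complex U b) n)"
proof
  assume *: "koszul_vanish n 0 j"
  show "\<forall>b. int (total_degree b) = j \<longrightarrow> exact_at TYPE('k) enc (koszul_complex U b) n"
    unfolding exact_at_def
  proof (intro allI impI, elim conjE)
    fix b and c :: "'x set \<Rightarrow> 'k"
    assume b: "int (total_degree b) = j" and c: "simplicial_chain (koszul_complex U b) n c"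
      and cycle: "sboundary enc UNIV c = (\<lambda>_. 0)"
    have c': "indicator_mono \<sigma> \<preceq> b \<and> b - indicator_mono \<sigma> \<in> U \<and> card \<sigma> = n" if "c \<sigma> \<noteq> 0" for \<sigma>
      using c that by (simp add: simplicial_chain_def koszul_complex_def)
    let ?z0 = "assemble {b} (\<lambda>_. c)"
    have part_z0: "part b' ?z0 = (if b' = b then c else (\<lambda>_. 0))" for b'
      using part_assemble[of "{b}" "\<lambda>_. c" b'] c' by (auto simp: fun_eq_iff)
    define z where "z = (\<lambda>\<sigma> m. if m = (0::nat) then ?z0 \<sigma> else 0)"
    have z0: "?z0 \<sigma> = Poly_Mapping.single (b - indicator_mono \<sigma>) (c \<sigma>)" for \<sigma>
      by (simp add: assemble_def)
    have z: "z \<in> kchains n (N 0) (t 0) j"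
      unfolding kchains_def mem_Collect_eq
    proof (intro allI conjI impI)
      fix \<sigma>
      show "z \<sigma> \<in> N 0"
        unfolding N0 using c'[of \<sigma>] by (simp add: z_def z0)
      have "homogeneous (j - int (card \<sigma>)) (?z0 \<sigma>)"
        unfolding z0
      proof (rule homogeneous_single)
        assume "c \<sigma> \<noteq> 0"
        from c'[OF this] have "total_degree (b - indicator_mono \<sigma>) + card \<sigma> = total_degree b"
          using mono_diff_add[of "indicator_mono \<sigma>" b] total_degree_add[of "b - indicator_mono \<sigma>" "indicator_mono \<sigma>"] by simp
        then show "int (total_degree (b - indicator_mono \<sigma>)) = j - int (card \<sigma>)"
          using b by linarith
      qed
      then show "homogeneous_vec (t 0) (j - int (card \<sigma>)) (z \<sigma>)"
        by (simp add: homogeneous_vec_def z_def B0)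
      show "z \<sigma> = 0" if "card \<sigma> \<noteq> n"
      proof -
        have "c \<sigma> = 0"
          using c'[of \<sigma>] that by blast
        then show ?thesis
          by (simp add: z_def z0 fun_eq_iff)
      qed
    qed
    have kd_z0: "koszul_d ?z0 \<tau> = 0" for \<tau>
    proof -
      have "koszul_d ?z0 \<tau> = (\<lambda>_. 0) \<tau>"
      proof (rule part_eqD)
        fix b'
        have "sboundary enc UNIV (part b' ?z0) \<tau> = 0"
          using cycle unfolding part_z0 by (cases "b' = b") (simp_all add: boundary_def fun_eq_iff)
        then show "part b' (koszul_d ?z0) \<tau> = part b' (\<lambda>_. 0) \<tau>"
          by (simp add: kd_weight part_boundary) (simp add: part_def)
      qed simp
      then show ?thesis .
    qed
    have kdz: "koszul_dv z \<tau> = 0" for \<tau>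
    proof
      fix m
      show "koszul_dv z \<tau> m = 0 m"
        using kd_z0[of \<tau>] by (cases "m = 0") (simp_all add: koszul_dv_def z_def, simp add: boundary_def)
    qed
    have pos: "Poly_Mapping.lookup (z {} m) 0 = 0" for m
    proof (cases "m = 0 \<and> c {} \<noteq> 0")
      case True
      then have "b \<noteq> 0"
        using c'[of "{}"] U by auto
      then show ?thesis
        using True by (simp add: z_def z0 lookup_single)
    qed (auto simp: z_def z0)
    obtain y where "y \<in> kchains (Suc n) (F 0) (t 0) j" "koszul_dv y = z"
      by (rule koszul_exact[OF kchains_F[OF z] kdz pos])
    then obtain w where w: "w \<in> kchains (Suc n) (N 0) (t 0) j" "koszul_dv w = z"
      using * z unfolding koszul_vanish_def by blast
    let ?w = "\<lambda>\<sigma>. w \<sigma> 0"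
    have wN: "Poly_Mapping.keys (w \<sigma> 0) \<subseteq> U" "card \<sigma> \<noteq> Suc n \<Longrightarrow> w \<sigma> 0 = 0" for \<sigma>
      using w(1) by (auto simp: kchains_def N0)
    have kw: "koszul_d ?w = ?z0"
    proof
      fix \<tau>
      show "koszul_d ?w \<tau> = ?z0 \<tau>"
        using fun_cong[OF fun_cong[OF w(2), of \<tau>], of 0] by (simp add: koszul_dv_def z_def)
    qed
    have "simplicial_chain (koszul_complex U b) (Suc n) (part b ?w)"
      unfolding simplicial_chain_def koszul_complex_def
    proof (intro allI impI)
      fix \<sigma> assume "part b ?w \<sigma> \<noteq> 0"
      then have "indicator_mono \<sigma> \<preceq> b" "b - indicator_mono \<sigma> \<in> Poly_Mapping.keys (w \<sigma> 0)" "w \<sigma> 0 \<noteq> 0"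
        by (auto simp: part_def in_keys_iff split: if_splits)
      then show "\<sigma> \<in> {\<sigma>. indicator_mono \<sigma> \<preceq> b \<and> b - indicator_mono \<sigma> \<in> U} \<and> card \<sigma> = Suc n"
        using wN[of \<sigma>] by auto
    qed
    moreover have "sboundary enc UNIV (part b ?w) = c"
    proof
      fix \<tau>
      show "sboundary enc UNIV (part b ?w) \<tau> = c \<tau>"
        using part_z0[of b] by (simp add: part_boundary[symmetric] kd_weight[symmetric] kw)
    qed
    ultimately show "\<exists>h. simplicial_chain (koszul_complex U b) (Suc n) h \<and> sboundary enc UNIV h = c"
      by blast
  qed
next
  assume *: "\<forall>b. int (total_degree b) = j \<longrightarrow> exact_at TYPE('k) enc (koszul_complex U b) n"
  show "koszul_vanish n 0 j"
    unfolding koszul_vanish_def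
  proof (intro ballI impI)
    fix z y assume z: "z \<in> kchains n (N 0) (t 0) j" and y: "koszul_dv y = z"
    let ?z0 = "\<lambda>\<sigma>. z \<sigma> 0"
    have zs: "Poly_Mapping.keys (z \<sigma> 0) \<subseteq> U" "m \<noteq> 0 \<Longrightarrow> z \<sigma> m = 0" "card \<sigma> \<noteq> n \<Longrightarrow> z \<sigma> 0 = 0"
      "homogeneous (j - int (card \<sigma>)) (z \<sigma> 0)" for \<sigma> m
      using z by (auto simp: kchains_def N0 homogeneous_vec_def B0)
    have kz: "koszul_d ?z0 = (\<lambda>_. 0)"
    proof
      fix \<tau>
      have "koszul_dv z \<tau> 0 = 0"
        using kdv_kdv[of y \<tau>] by (simp add: y)
      then show "koszul_d ?z0 \<tau> = 0"
        by (simp add: koszul_dv_def)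
    qed
    define Bs where "Bs = (\<Union>\<sigma>. (\<lambda>u. u + indicator_mono \<sigma>) ` Poly_Mapping.keys (z \<sigma> 0))"
    have fin: "finite Bs"
      by (simp add: Bs_def)
    have deg: "int (total_degree b) = j" if b: "b \<in> Bs" for b
    proof -
      obtain \<sigma> u where u: "b = u + indicator_mono \<sigma>" "u \<in> Poly_Mapping.keys (z \<sigma> 0)"
        using b by (auto simp: Bs_def)
      then have "int (total_degree u) = j - int (card \<sigma>)"
        using zs(4)[of \<sigma>] by (simp add: homogeneous_def)
      then show ?thesis
        using u(1) by simp
    qed
    have "\<exists>h :: 'x set \<Rightarrow> 'k. simplicial_chain (koszul_complex U b) (Suc n) h \<and> sboundary enc UNIV h = part b ?z0"
      if b: "b \<in> Bs" for b
    proof -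
      have "simplicial_chain (koszul_complex U b) n (part b ?z0)"
        unfolding simplicial_chain_def koszul_complex_def
      proof (intro allI impI)
        fix \<sigma> assume "part b ?z0 \<sigma> \<noteq> 0"
        then have "indicator_mono \<sigma> \<preceq> b" "b - indicator_mono \<sigma> \<in> Poly_Mapping.keys (z \<sigma> 0)" "z \<sigma> 0 \<noteq> 0"
          by (auto simp: part_def in_keys_iff split: if_splits)
        then show "\<sigma> \<in> {\<sigma>. indicator_mono \<sigma> \<preceq> b \<and> b - indicator_mono \<sigma> \<in> U} \<and> card \<sigma> = n"
          using zs(1,3)[of \<sigma>] by auto
      qed
      moreover have "sboundary enc UNIV (part b ?z0) = (\<lambda>_. 0)"
      proof
        fix \<tau>
        show "sboundary enc UNIV (part b ?z0) \<tau> = 0"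
          unfolding part_boundary[symmetric] kd_weight[symmetric] kz by (simp add: part_def)
      qed
      ultimately show ?thesis
        using * deg[OF b] unfolding exact_at_def by blast
    qed
    then have "\<forall>b\<in>Bs. \<exists>h :: 'x set \<Rightarrow> 'k. simplicial_chain (koszul_complex U b) (Suc n) h \<and>
        sboundary enc UNIV h = part b ?z0"
      by blast
    from bchoice[OF this] obtain h :: "('x \<Rightarrow>\<^sub>0 nat) \<Rightarrow> 'x set \<Rightarrow> 'k" where h: "\<forall>b\<in>Bs. simplicial_chain (koszul_complex U b) (Suc n) (h b) \<and>
        sboundary enc UNIV (h b) = part b ?z0" ..
    have h1: "indicator_mono \<sigma> \<preceq> b \<and> b - indicator_mono \<sigma> \<in> U \<and> card \<sigma> = Suc n"
      if "b \<in> Bs" "h b \<sigma> \<noteq> 0" for b \<sigma>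
      using bspec[OF h that(1)] that(2) by (auto simp: simplicial_chain_def koszul_complex_def)
    let ?w0 = "assemble Bs h"
    have kw: "koszul_d ?w0 = ?z0"
      unfolding kd_weight
    proof (rule boundary_assemble[OF fin])
      show "\<sigma> \<subseteq> UNIV \<and> indicator_mono \<sigma> \<preceq> b" if "b \<in> Bs" "h b \<sigma> \<noteq> 0" for b \<sigma>
        using h1[OF that] by simp
      show "sboundary enc UNIV (h b) = part b ?z0" if "b \<in> Bs" for b
        using bspec[OF h that] by simp
      show "u + indicator_mono \<sigma> \<in> Bs" if "u \<in> Poly_Mapping.keys (z \<sigma> 0)" for \<sigma> u
        using that unfolding Bs_def by blast
    qed simp
    have kw0: "u \<in> U \<and> int (total_degree u) = j - int (card \<sigma>) \<and> card \<sigma> = Suc n"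
      if u: "u \<in> Poly_Mapping.keys (?w0 \<sigma>)" for u \<sigma>
    proof -
      obtain b where b: "b \<in> Bs" "u = b - indicator_mono \<sigma>" "h b \<sigma> \<noteq> 0"
        using keys_assemble[OF fin u] by (elim bexE conjE)
      have *: "u + indicator_mono \<sigma> = b"
        using h1[OF b(1,3)] by (simp add: b(2) mono_diff_add)
      have "int (total_degree u) + int (card \<sigma>) = j"
        using deg[OF b(1)] by (simp add: *[symmetric])
      then show ?thesis
        using h1[OF b(1,3)] b(2) by simp
    qed
    define w where "w = (\<lambda>\<sigma> m. if m = (0::nat) then ?w0 \<sigma> else 0)"
    have "w \<in> kchains (Suc n) (N 0) (t 0) j"
      unfolding kchains_def mem_Collect_eq
    proof (intro allI conjI impI)
      fix \<sigma>
      show "w \<sigma> \<in> N 0"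
        unfolding N0 using kw0 by (auto simp: w_def)
      show "homogeneous_vec (t 0) (j - int (card \<sigma>)) (w \<sigma>)"
        using kw0[of _ \<sigma>] by (auto simp: homogeneous_vec_def w_def B0 homogeneous_def)
      show "w \<sigma> = 0" if "card \<sigma> \<noteq> Suc n"
      proof -
        have "Poly_Mapping.keys (?w0 \<sigma>) = {}"
          using kw0[of _ \<sigma>] that by blast
        then show ?thesis
          by (simp add: w_def fun_eq_iff)
      qed
    qed
    moreover have "koszul_dv w = z"
    proof (intro ext)
      fix \<tau> m
      show "koszul_dv w \<tau> m = z \<tau> m"
      proof (cases "m = 0")
        case True
        then show ?thesis
          using fun_cong[OF kw, of \<tau>] by (simp add: koszul_dv_def w_def)
      next
        case False
        then show ?thesis
          using zs(2)[of m \<tau>] by (simp add: koszul_dv_def w_def boundary_def)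
      qed
    qed
    ultimately show "\<exists>w\<in>kchains (Suc n) (N 0) (t 0) j. koszul_dv w = z"
      by blast
  qed
qed

end

text \<open>The resolution extended by its augmentation; everything moves up by one position.\<close>

definition aug_basis :: "('x, 'k::field) free_complex \<Rightarrow> nat \<Rightarrow> nat set" where
  "aug_basis F p = (case p of 0 \<Rightarrow> {0} | Suc q \<Rightarrow> basis F q)"

definition aug_twist :: "('x, 'k::field) free_complex \<Rightarrow> nat \<Rightarrow> nat \<Rightarrow> int" where
  "aug_twist F p = (case p of 0 \<Rightarrow> (\<lambda>_. 0) | Suc q \<Rightarrow> twist F q)"

definition aug_mat :: "('x, 'k::field) free_complex \<Rightarrow> nat \<Rightarrow> nat \<Rightarrow> nat \<Rightarrow> ('x, 'k) mpoly" where
  "aug_mat F p = (case p of 0 \<Rightarrow> (\<lambda>_. aug F) | Suc q \<Rightarrow> diff_mat F q)"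

text \<open>
  For an arbitrary resolution, dimension shifting along the syzygies leads from the homology of
  the tensored resolution to the Koszul homology of the ideal, which does not depend on the
  resolution any more.
\<close>

theorem tensor_homology_dim_eq_0_iff:
  fixes F :: "('x::finite, 'k::field) free_complex"
  assumes F: "graded_free_resolution F {f. Poly_Mapping.keys f \<subseteq> U}" and U: "0 \<notin> U" and enc: "inj enc"
  shows "tensor_homology_dim F n j = 0 \<longleftrightarrow>
    (\<forall>b. int (total_degree b) = j \<longrightarrow> exact_at TYPE('k) enc (koszul_complex U b) n)"
proof -
  have aug: "mat_apply (aug_basis F 0) (aug_basis F (Suc 0)) (aug_mat F 0) v =
      (\<lambda>a. if a = 0 then augmentation F v else 0)" for v
    by (rule ext) (simp add: mat_apply_def aug_basis_def aug_mat_def augmentation_def)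
  have bm: "mat_apply (aug_basis F (Suc p)) (aug_basis F (Suc (Suc p))) (aug_mat F (Suc p)) = boundary_map F p" for p
    by (simp add: aug_basis_def aug_mat_def boundary_map_def)
  interpret graded_exact_sequence enc "aug_basis F" "aug_twist F" "aug_mat F"
  proof
    show "inj enc"
      by (rule enc)
    show "homogeneous (aug_twist F (Suc p) b - aug_twist F p a) (aug_mat F p a b)"
      if "a \<in> aug_basis F p" "b \<in> aug_basis F (Suc p)" for a p b
      using F that unfolding graded_free_resolution_def
      by (cases p) (auto simp: aug_twist_def aug_basis_def aug_mat_def)
    show "{v \<in> vectors_on (aug_basis F (Suc p)). mat_apply (aug_basis F p) (aug_basis F (Suc p)) (aug_mat F p) v = 0} =
        mat_apply (aug_basis F (Suc p)) (aug_basis F (Suc (Suc p))) (aug_mat F (Suc p)) ` vectors_on (aug_basis F (Suc (Suc p)))" for p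
    proof (cases p)
      case 0
      have "((\<lambda>a. if a = 0 then augmentation F v else 0) = (0 :: nat \<Rightarrow> _)) \<longleftrightarrow> augmentation F v = 0" for v
        by (auto simp: fun_eq_iff)
      then show ?thesis
        using F unfolding graded_free_resolution_def 0 aug bm by (simp add: aug_basis_def)
    next
      case (Suc q)
      then show ?thesis
        using F unfolding graded_free_resolution_def Suc bm by (simp add: aug_basis_def)
    qed
  qed
  have TM_bm: "const_map (Suc p) = tensor_boundary_map F p" for p
    by (simp add: const_map_def tensor_boundary_map_def aug_basis_def aug_mat_def)
  have TF_part: "const_vectors (Suc p) j = tensor_part F p j" for p
    by (simp add: const_vectors_def tensor_part_def aug_basis_def aug_twist_def)
  have im: "augmentation F ` vectors_on (basis F 0) = {f. Poly_Mapping.keys f \<subseteq> U}" and fin: "finite (basis F p)" for p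
    using F by (simp_all add: graded_free_resolution_def)
  have "Poly_Mapping.lookup (aug F b) 0 = 0" if b: "b \<in> basis F 0" for b
  proof -
    let ?v = "\<lambda>a. if a = b then 1 else 0 :: ('x, 'k) mpoly"
    have "?v \<in> vectors_on (basis F 0)"
      using b by (auto simp: vectors_on_def)
    then have "augmentation F ?v \<in> {f. Poly_Mapping.keys f \<subseteq> U}"
      using im by blast
    moreover have "augmentation F ?v = aug F b"
      using b fin by (simp add: augmentation_def if_distrib cong: if_cong)
    ultimately show ?thesis
      using U by (auto simp: in_keys_iff)
  qed
  then have "const_map 0 v = 0" for v
    by (auto simp: const_map_def mat_apply_def aug_basis_def aug_mat_def fun_eq_iff)
  then have cycles: "tensor_cycles F n j = {v \<in> const_vectors (Suc n) j. const_map n v = 0}"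
    by (cases n) (simp_all add: TF_part TM_bm)
  have bnd: "tensor_boundaries F n j = const_map (Suc n) ` const_vectors (Suc (Suc n)) j"
    by (simp add: tensor_boundaries_def TF_part TM_bm)
  have sub: "tensor_boundaries F n j \<subseteq> tensor_cycles F n j"
  proof
    fix v assume "v \<in> tensor_boundaries F n j"
    then obtain w where w: "w \<in> const_vectors (Suc (Suc n)) j" "v = const_map (Suc n) w"
      unfolding bnd by blast
    let ?x = "mat_apply (aug_basis F (Suc n)) (aug_basis F (Suc (Suc n))) (aug_mat F (Suc n)) (of_const w)"
    have cw: "of_const w \<in> vectors_on (aug_basis F (Suc (Suc n)))" "homogeneous_vec (aug_twist F (Suc (Suc n))) j (of_const w)"
      using of_const_F[OF w(1)] by auto
    have v: "v = const_part ?x"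
      by (simp add: const_part_M w(2))
    have "const_map n v = const_part (0 :: nat \<Rightarrow> ('x, 'k) mpoly)"
      unfolding v const_part_M[symmetric] M_M[OF cw(1)] ..
    then have "const_map n v = 0"
      by (simp add: const_part_def fun_eq_iff)
    moreover have "v \<in> const_vectors (Suc n) j"
      unfolding v by (rule const_part_TF[OF M_F hv_M[OF cw(2)]])
    ultimately show "v \<in> tensor_cycles F n j"
      by (simp add: cycles)
  qed
  have "fun_space.subspace (tensor_boundaries F n j)"
    unfolding bnd fun_space.subspace_def
  proof (intro conjI ballI allI)
    have zero: "0 \<in> const_vectors (Suc (Suc n)) j"
      by (simp add: const_vectors_def vectors_on_def)
    have "const_map (Suc n) 0 = 0"
      by (simp add: const_map_def mat_apply_def fun_eq_iff)
    then show "0 \<in> const_map (Suc n) ` const_vectors (Suc (Suc n)) j"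
      using zero by (metis image_eqI)
    fix x assume "x \<in> const_map (Suc n) ` const_vectors (Suc (Suc n)) j"
    then obtain x' where x': "x' \<in> const_vectors (Suc (Suc n)) j" "x = const_map (Suc n) x'"
      by blast
    show "fun_scale c x \<in> const_map (Suc n) ` const_vectors (Suc (Suc n)) j" for c
    proof (rule image_eqI)
      show "fun_scale c x = const_map (Suc n) (fun_scale c x')"
        by (auto simp: x'(2) const_map_def mat_apply_def fun_scale_def fun_eq_iff sum_distrib_left mult_ac)
      show "fun_scale c x' \<in> const_vectors (Suc (Suc n)) j"
        using x'(1) by (auto simp: const_vectors_def vectors_on_def fun_scale_def)
    qed
    fix y assume "y \<in> const_map (Suc n) ` const_vectors (Suc (Suc n)) j"
    then obtain y' where y': "y' \<in> const_vectors (Suc (Suc n)) j" "y = const_map (Suc n) y'"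
      by blast
    show "x + y \<in> const_map (Suc n) ` const_vectors (Suc (Suc n)) j"
    proof (rule image_eqI)
      show "x + y = const_map (Suc n) (x' + y')"
        by (auto simp: x'(2) y'(2) const_map_def mat_apply_def fun_eq_iff sum.distrib distrib_left)
      show "x' + y' \<in> const_vectors (Suc (Suc n)) j"
        using x'(1) y'(1) by (auto simp: const_vectors_def vectors_on_def)
    qed
  qed
  moreover have "tensor_cycles F n j \<subseteq> vectors_on (basis F n)"
    by (auto simp: cycles TF_part tensor_part_def vectors_on_def)
  ultimately have "tensor_homology_dim F n j = 0 \<longleftrightarrow> tensor_cycles F n j \<subseteq> tensor_boundaries F n j"
    unfolding tensor_homology_dim_def using sub fin by (intro dim_diff_eq_0_iff) auto
  also have "\<dots> \<longleftrightarrow> koszul_vanish 0 n j"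
    unfolding koszul_vanish_iff_homology cycles bnd by blast
  also have "\<dots> \<longleftrightarrow> koszul_vanish n 0 j"
    using koszul_vanish_shift_all[of n 0 j] by simp
  also have "\<dots> \<longleftrightarrow> (\<forall>b. int (total_degree b) = j \<longrightarrow> exact_at TYPE('k) enc (koszul_complex U b) n)"
  proof (rule koszul_vanish_simplicial)
    have v: "v \<in> N 0 \<longleftrightarrow> (\<exists>f\<in>{f. Poly_Mapping.keys f \<subseteq> U}. v = (\<lambda>a. if a = 0 then f else 0))" for v
      unfolding N_def aug im[symmetric] by (auto simp: aug_basis_def)
    show "N 0 = {v. Poly_Mapping.keys (v 0) \<subseteq> U \<and> (\<forall>n. n \<noteq> 0 \<longrightarrow> v n = 0)}"
    proof (intro equalityI subsetI)
      fix w :: "nat \<Rightarrow> ('x, 'k) mpoly"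
      assume "w \<in> {v. Poly_Mapping.keys (v 0) \<subseteq> U \<and> (\<forall>n. n \<noteq> 0 \<longrightarrow> v n = 0)}"
      then show "w \<in> N 0"
        unfolding v by (intro bexI[of _ "w 0"]) auto
    qed (auto simp: v)
  qed (use U in \<open>simp_all add: aug_basis_def aug_twist_def\<close>)
  finally show ?thesis .
qed


section \<open>The Taylor resolution\<close>

context labelled_simplex
begin

text \<open>It suffices to look at each multidegree, where the weights are 1.\<close>

lemma boundary_boundary_weight:
  fixes z :: "'i set \<Rightarrow> ('x, 'k::field) mpoly"
  assumes "\<And>\<sigma>. z \<sigma> \<noteq> 0 \<Longrightarrow> \<sigma> \<subseteq> V"
  shows "boundary enc V weight (boundary enc V weight z) = (\<lambda>_. 0)"
proof
  fix \<tau>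
  show "boundary enc V weight (boundary enc V weight z) \<tau> = 0"
  proof (cases "\<tau> \<subseteq> V")
    case True
    have "boundary enc V weight (boundary enc V weight z) \<tau> = (\<lambda>_. 0 :: ('x, 'k) mpoly) \<tau>"
    proof (rule part_eqD[OF _ True])
      fix b
      have "part b (boundary enc V weight z) = sboundary enc V (part b z)"
        using part_boundary by blast
      then have "part b (boundary enc V weight (boundary enc V weight z)) \<tau> = 0"
        unfolding part_boundary using boundary_boundary[OF V True, of "\<lambda>_ _. 1" "part b z"] by simp
      then show "part b (boundary enc V weight (boundary enc V weight z)) \<tau> = part b (\<lambda>_. 0) \<tau>"
        by (simp add: part_def)
    qed
    then show ?thesis .
  next
    case False
    have "\<sigma> \<subseteq> V" if "boundary enc V weight z \<sigma> \<noteq> 0" for \<sigma>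
      using boundary_supp[OF assms] that by blast
    from boundary_supp[OF this False] show ?thesis .
  qed
qed

end

definition lcm_mono :: "('i \<Rightarrow> 'x::finite \<Rightarrow>\<^sub>0 nat) \<Rightarrow> 'i set \<Rightarrow> 'x \<Rightarrow>\<^sub>0 nat" where
  "lcm_mono g \<sigma> = Abs_poly_mapping (\<lambda>x. Max (insert 0 ((\<lambda>i. Poly_Mapping.lookup (g i) x) ` \<sigma>)))"

lemma lookup_lcm_mono: "Poly_Mapping.lookup (lcm_mono g \<sigma>) x = Max (insert 0 ((\<lambda>i. Poly_Mapping.lookup (g i) x) ` \<sigma>))"
  by (simp add: lcm_mono_def)

lemma lcm_mono_dvd: "finite \<sigma> \<Longrightarrow> lcm_mono g \<sigma> \<preceq> b \<longleftrightarrow> (\<forall>i\<in>\<sigma>. g i \<preceq> b)"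
  by (auto simp: mono_dvd_def lookup_lcm_mono)

lemma lcm_mono_singleton [simp]: "lcm_mono g {i} = g i"
  by (rule poly_mapping_eqI) (simp add: lookup_lcm_mono)

lemma lcm_mono_empty [simp]: "lcm_mono g {} = 0"
  by (rule poly_mapping_eqI) (simp add: lookup_lcm_mono)

text \<open>
  Faces are coded as numbers by \<open>set_encode\<close>, as the bases of a resolution have to be sets of
  naturals. The last parameter only selects the field.
\<close>

locale taylor =
  fixes g :: "nat \<Rightarrow> 'x::finite \<Rightarrow>\<^sub>0 nat" and m :: nat and ty :: "'k::field itself"
begin

sublocale labelled_simplex id "{..<m}" "lcm_mono g"
  by unfold_locales (simp_all add: lcm_mono_dvd finite_subset)

abbreviation bd :: "(nat set \<Rightarrow> ('x, 'k) mpoly) \<Rightarrow> nat set \<Rightarrow> ('x, 'k) mpoly" where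
  "bd \<equiv> boundary id {..<m} weight"

definition simplices :: "nat \<Rightarrow> nat set set" where
  "simplices q = {\<sigma>. \<sigma> \<subseteq> {..<m} \<and> card \<sigma> = q}"

definition codes :: "nat \<Rightarrow> nat set" where
  "codes q = set_encode ` simplices q"

text \<open>
  The empty face has code 0, so that row 0 of this matrix describes the augmentation and one
  formula serves for all maps of the resolution.
\<close>

definition entry :: "nat \<Rightarrow> nat \<Rightarrow> ('x, 'k) mpoly" where
  "entry a b = (\<Sum>x\<in>{..<m} - set_decode a.
     if set_decode b = insert x (set_decode a) then sgn_at id x (set_decode a) * weight x (set_decode a) else 0)"

definition complex :: "('x, 'k) free_complex" where
  "complex = \<lparr>basis = (\<lambda>p. codes (Suc p)),
     twist = (\<lambda>p b. int (total_degree (lcm_mono g (set_decode b)))),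
     diff_mat = (\<lambda>p. entry), aug = entry 0\<rparr>"

definition to_chain :: "nat \<Rightarrow> (nat \<Rightarrow> ('x, 'k) mpoly) \<Rightarrow> nat set \<Rightarrow> ('x, 'k) mpoly" where
  "to_chain q v \<sigma> = (if \<sigma> \<in> simplices q then v (set_encode \<sigma>) else 0)"

definition to_vec :: "nat \<Rightarrow> (nat set \<Rightarrow> ('x, 'k) mpoly) \<Rightarrow> nat \<Rightarrow> ('x, 'k) mpoly" where
  "to_vec q z b = (if b \<in> codes q then z (set_decode b) else 0)"

definition chain :: "nat \<Rightarrow> (nat set \<Rightarrow> ('x, 'k) mpoly) \<Rightarrow> bool" where
  "chain q z \<longleftrightarrow> (\<forall>\<sigma>. z \<sigma> \<noteq> 0 \<longrightarrow> \<sigma> \<in> simplices q)"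

lemma chain_outside: "chain q z \<Longrightarrow> \<sigma> \<notin> simplices q \<Longrightarrow> z \<sigma> = 0"
  unfolding chain_def by blast

lemma finite_simplices: "finite (simplices q)"
  by (simp add: simplices_def)

lemma finite_simplex: "\<sigma> \<in> simplices q \<Longrightarrow> finite \<sigma>"
  unfolding simplices_def using finite_subset by blast

lemma decode_encode: "\<sigma> \<in> simplices q \<Longrightarrow> set_decode (set_encode \<sigma>) = \<sigma>"
  using finite_simplex by simp

lemma encode_inj: "inj_on set_encode (simplices q)"
  using decode_encode by (rule inj_on_inverseI)

lemma codes_iff: "b \<in> codes q \<longleftrightarrow> set_decode b \<in> simplices q"
  unfolding codes_def using decode_encode by (metis image_iff set_decode_inverse)

lemma encode_codes: "\<sigma> \<in> simplices q \<Longrightarrow> set_encode \<sigma> \<in> codes q"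
  by (simp add: codes_def)

lemma to_vec_vectors_on: "to_vec q z \<in> vectors_on (codes q)"
  by (simp add: to_vec_def vectors_on_def)

lemma to_chain_chain: "chain q (to_chain q v)"
  by (simp add: chain_def to_chain_def)

lemma to_chain_to_vec: "chain q z \<Longrightarrow> to_chain q (to_vec q z) = z"
  by (auto simp: to_chain_def to_vec_def chain_def fun_eq_iff encode_codes decode_encode)

lemma to_vec_to_chain: "v \<in> vectors_on (codes q) \<Longrightarrow> to_vec q (to_chain q v) = v"
  by (auto simp: to_chain_def to_vec_def vectors_on_def fun_eq_iff codes_iff)

lemma to_vec_eq_0_iff: "chain q z \<Longrightarrow> to_vec q z = 0 \<longleftrightarrow> z = (\<lambda>_. 0)"
  by (auto simp: to_vec_def chain_def fun_eq_iff codes_iff) (metis decode_encode)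

lemma row_sum:
  assumes "\<tau> \<in> simplices q" "v \<in> vectors_on (codes (Suc q))"
  shows "(\<Sum>b\<in>codes (Suc q). entry (set_encode \<tau>) b * v b) = bd (to_chain (Suc q) v) \<tau>"
proof -
  have \<tau>: "finite \<tau>" "set_decode (set_encode \<tau>) = \<tau>"
    using assms(1) decode_encode finite_simplex by auto
  let ?s = "\<lambda>x. sgn_at id x \<tau> * weight x \<tau> :: ('x, 'k) mpoly"
  have "(\<Sum>b\<in>codes (Suc q). entry (set_encode \<tau>) b * v b) =
      (\<Sum>\<sigma>\<in>simplices (Suc q). entry (set_encode \<tau>) (set_encode \<sigma>) * v (set_encode \<sigma>))"
    unfolding codes_def by (rule sum.reindex_cong[OF encode_inj]) simp_all
  also have "\<dots> = (\<Sum>\<sigma>\<in>simplices (Suc q). \<Sum>x\<in>{..<m} - \<tau>. if \<sigma> = insert x \<tau> then ?s x * v (set_encode \<sigma>) else 0)"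
  proof (rule sum.cong[OF refl])
    fix \<sigma> assume "\<sigma> \<in> simplices (Suc q)"
    then show "entry (set_encode \<tau>) (set_encode \<sigma>) * v (set_encode \<sigma>) =
        (\<Sum>x\<in>{..<m} - \<tau>. if \<sigma> = insert x \<tau> then ?s x * v (set_encode \<sigma>) else 0)"
      unfolding entry_def \<tau>(2) by (simp add: decode_encode sum_distrib_right if_distrib[of "\<lambda>a. a * _"] cong: if_cong)
  qed
  also have "\<dots> = (\<Sum>x\<in>{..<m} - \<tau>. \<Sum>\<sigma>\<in>simplices (Suc q). if \<sigma> = insert x \<tau> then ?s x * v (set_encode \<sigma>) else 0)"
    by (rule sum.swap)
  also have "\<dots> = (\<Sum>x\<in>{..<m} - \<tau>. ?s x * to_chain (Suc q) v (insert x \<tau>))"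
  proof (rule sum.cong[OF refl])
    fix x assume "x \<in> {..<m} - \<tau>"
    then have "insert x \<tau> \<in> simplices (Suc q)"
      using assms(1) \<tau>(1) by (auto simp: simplices_def)
    then show "(\<Sum>\<sigma>\<in>simplices (Suc q). if \<sigma> = insert x \<tau> then ?s x * v (set_encode \<sigma>) else 0) =
        ?s x * to_chain (Suc q) v (insert x \<tau>)"
      using finite_simplices by (simp add: to_chain_def)
  qed
  also have "\<dots> = bd (to_chain (Suc q) v) \<tau>"
    by (simp add: boundary_def)
  finally show ?thesis .
qed

lemma chain_bd:
  assumes "chain (Suc q) z"
  shows "chain q (bd z)"
  unfolding chain_def
proof (intro allI impI)
  fix \<tau> assume nz: "bd z \<tau> \<noteq> 0"
  have sub: "\<sigma> \<subseteq> {..<m}" if "z \<sigma> \<noteq> 0" for \<sigma>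
    using assms that by (auto simp: chain_def simplices_def)
  have \<tau>: "\<tau> \<subseteq> {..<m}"
    using boundary_supp[OF sub] nz by blast
  obtain x where x: "x \<in> {..<m} - \<tau>" "sgn_at id x \<tau> * weight x \<tau> * z (insert x \<tau>) \<noteq> 0"
    using nz unfolding boundary_def by (rule sum.not_neutral_contains_not_neutral)
  then have "z (insert x \<tau>) \<noteq> 0"
    by (cases "z (insert x \<tau>) = 0") simp_all
  then have "card (insert x \<tau>) = Suc q" "x \<notin> \<tau>"
    using assms x(1) by (auto simp: chain_def simplices_def)
  then show "\<tau> \<in> simplices q"
    using \<tau> finite_subset[OF \<tau>] by (simp add: simplices_def)
qed

lemma boundary_map_complex:
  assumes "v \<in> vectors_on (codes (Suc (Suc p)))"
  shows "boundary_map complex p v = to_vec (Suc p) (bd (to_chain (Suc (Suc p)) v))"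
proof
  fix a
  show "boundary_map complex p v a = to_vec (Suc p) (bd (to_chain (Suc (Suc p)) v)) a"
  proof (cases "a \<in> codes (Suc p)")
    case True
    then have "set_decode a \<in> simplices (Suc p)" "set_encode (set_decode a) = a"
      by (simp_all add: codes_iff)
    then show ?thesis
      using True row_sum[OF _ assms, of "set_decode a"]
      by (simp add: boundary_map_def mat_apply_def complex_def to_vec_def)
  qed (simp add: boundary_map_def mat_apply_def complex_def to_vec_def)
qed

lemma augmentation_complex:
  assumes "v \<in> vectors_on (codes (Suc 0))"
  shows "augmentation complex v = bd (to_chain (Suc 0) v) {}"
  using row_sum[of "{}" 0 v] assms by (simp add: augmentation_def complex_def simplices_def)

lemma bd_bd:
  assumes "chain q z"
  shows "bd (bd z) = (\<lambda>_. 0)"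
  by (rule boundary_boundary_weight) (use assms in \<open>auto simp: chain_def simplices_def\<close>)

lemma bd_exact:
  assumes z: "chain q z" "bd z = (\<lambda>_. 0)"
    and pos: "\<And>u. u \<in> Poly_Mapping.keys (z {}) \<Longrightarrow> \<exists>i<m. g i \<preceq> u"
  obtains w where "chain (Suc q) w" "bd w = z"
proof (rule exact[of z q])
  show "\<sigma> \<subseteq> {..<m} \<and> card \<sigma> = q" if "z \<sigma> \<noteq> 0" for \<sigma>
    using z(1) that by (simp add: chain_def simplices_def)
  show "boundary id {..<m} weight z = 0"
    using z(2) by (simp add: zero_fun_def)
  show "\<exists>i\<in>{..<m}. lcm_mono g {i} \<preceq> u + lcm_mono g \<sigma>" if u: "u \<in> Poly_Mapping.keys (z \<sigma>)" for \<sigma> u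
  proof (cases "\<sigma> = {}")
    case True
    then show ?thesis
      using pos u by auto
  next
    case False
    then obtain i where i: "i \<in> \<sigma>"
      by blast
    have "z \<sigma> \<noteq> 0"
      using u by (cases "z \<sigma> = 0") simp_all
    then have \<sigma>: "\<sigma> \<subseteq> {..<m}"
      using z(1) by (simp add: chain_def simplices_def)
    have "lcm_mono g {i} \<preceq> lcm_mono g \<sigma>"
      using label_mono[OF \<sigma>, of "{i}"] i by simp
    then have "lcm_mono g {i} \<preceq> u + lcm_mono g \<sigma>"
      by (rule mono_dvd_trans) simp
    then show ?thesis
      using i \<sigma> by blast
  qed
next
  fix w :: "nat set \<Rightarrow> ('x, 'k) mpoly"
  assume "\<And>\<sigma>. w \<sigma> \<noteq> 0 \<Longrightarrow> \<sigma> \<subseteq> {..<m} \<and> card \<sigma> = Suc q" "boundary id {..<m} weight w = z"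
  then show thesis
    by (intro that) (simp_all add: chain_def simplices_def)
qed

lemma entry_homogeneous:
  "homogeneous (int (total_degree (lcm_mono g (set_decode b))) - int (total_degree (lcm_mono g (set_decode a)))) (entry a b)"
  if "set_decode a \<subseteq> {..<m}"
  unfolding entry_def
proof (rule homogeneous_sum)
  fix x assume x: "x \<in> {..<m} - set_decode a"
  let ?\<tau> = "set_decode a"
  have le: "lcm_mono g ?\<tau> \<preceq> lcm_mono g (insert x ?\<tau>)"
    using x that by (intro label_mono) auto
  have "total_degree (lcm_mono g (insert x ?\<tau>) - lcm_mono g ?\<tau>) + total_degree (lcm_mono g ?\<tau>) = total_degree (lcm_mono g (insert x ?\<tau>))"
    by (simp only: total_degree_add[symmetric] mono_diff_add[OF le])
  then have "int (total_degree (lcm_mono g (insert x ?\<tau>) - lcm_mono g ?\<tau>)) = int (total_degree (lcm_mono g (insert x ?\<tau>))) - int (total_degree (lcm_mono g ?\<tau>))"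
    by linarith
  then show "homogeneous (int (total_degree (lcm_mono g (set_decode b))) - int (total_degree (lcm_mono g ?\<tau>)))
      (if set_decode b = insert x ?\<tau> then sgn_at id x ?\<tau> * weight x ?\<tau> else 0)"
    by (auto intro!: homogeneous_sgn_mult homogeneous_single)
qed

lemma keys_bd_empty:
  assumes "u \<in> Poly_Mapping.keys (bd z {})"
  shows "\<exists>i<m. g i \<preceq> u"
proof -
  have "Poly_Mapping.lookup (bd z {}) u \<noteq> 0"
    using assms by (simp add: in_keys_iff)
  then have "(\<Sum>x<m. sgn_at id x {} * Poly_Mapping.lookup (weight x {} * z {x}) u) \<noteq> 0"
    by (simp add: boundary_def lookup_sum mult.assoc)
  then obtain x where x: "x \<in> {..<m}" "sgn_at id x {} * Poly_Mapping.lookup (weight x {} * z {x}) u \<noteq> 0"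
    by (rule sum.not_neutral_contains_not_neutral)
  then have "x < m" "Poly_Mapping.lookup (weight x {} * z {x}) u \<noteq> 0"
    by auto
  then show ?thesis
    by (auto simp: lookup_single_mult split: if_splits)
qed

text \<open>
  The Taylor complex on any finite list of generators is exact, because each of its multigraded
  pieces is the complex of a full simplex. It need not be minimal.
\<close>

theorem graded_free_resolution_complex:
  "graded_free_resolution complex {f. Poly_Mapping.keys f \<subseteq> {u. \<exists>i<m. g i \<preceq> u}}"
proof -
  have basis: "basis complex p = codes (Suc p)" for p
    by (simp add: complex_def)
  have hom0: "homogeneous (twist complex 0 b) (aug complex b)" if "b \<in> basis complex 0" for b
    using entry_homogeneous[of 0 b] by (simp add: complex_def)
  have hom: "homogeneous (twist complex (Suc p) b - twist complex p a) (diff_mat complex p a b)"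
    if "a \<in> basis complex p" for p a b
    using entry_homogeneous[of a b] that by (simp add: complex_def codes_iff simplices_def)
  have im: "augmentation complex ` vectors_on (codes (Suc 0)) = {f. Poly_Mapping.keys f \<subseteq> {u. \<exists>i<m. g i \<preceq> u}}"
  proof (intro equalityI subsetI)
    fix f assume "f \<in> augmentation complex ` vectors_on (codes (Suc 0))"
    then show "f \<in> {f. Poly_Mapping.keys f \<subseteq> {u. \<exists>i<m. g i \<preceq> u}}"
      using keys_bd_empty by (auto simp: augmentation_complex)
  next
    fix f :: "('x, 'k) mpoly" assume f: "f \<in> {f. Poly_Mapping.keys f \<subseteq> {u. \<exists>i<m. g i \<preceq> u}}"
    let ?z = "\<lambda>\<sigma>. if \<sigma> = {} then f else 0"
    have c: "chain 0 ?z"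
      by (simp add: chain_def simplices_def)
    have b: "bd ?z = (\<lambda>_. 0)"
      by (simp add: boundary_def fun_eq_iff)
    obtain w where w: "chain (Suc 0) w" "bd w = ?z"
      by (rule bd_exact[OF c b]) (use f in auto)
    have "augmentation complex (to_vec (Suc 0) w) = f"
      by (simp add: augmentation_complex[OF to_vec_vectors_on] to_chain_to_vec[OF w(1)] w(2))
    then show "f \<in> augmentation complex ` vectors_on (codes (Suc 0))"
      using to_vec_vectors_on by blast
  qed
  have exact_step: "\<exists>u\<in>vectors_on (codes (Suc (Suc q))). boundary_map complex q u = v"
    if v: "v \<in> vectors_on (codes (Suc q))" and c: "bd (to_chain (Suc q) v) = (\<lambda>_. 0)" for q v
  proof -
    obtain w where w: "chain (Suc (Suc q)) w" "bd w = to_chain (Suc q) v"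
      by (rule bd_exact[OF to_chain_chain c]) (simp add: to_chain_def simplices_def)
    have "boundary_map complex q (to_vec (Suc (Suc q)) w) = v"
      by (simp add: boundary_map_complex[OF to_vec_vectors_on] to_chain_to_vec[OF w(1)] w(2) to_vec_to_chain[OF v])
    then show ?thesis
      using to_vec_vectors_on by blast
  qed
  have cycle: "bd (to_chain (Suc q) (boundary_map complex q u)) = (\<lambda>_. 0)" if "u \<in> vectors_on (codes (Suc (Suc q)))" for q u
    using bd_bd[OF to_chain_chain] by (simp add: boundary_map_complex[OF that] to_chain_to_vec[OF chain_bd[OF to_chain_chain]])
  have vec: "boundary_map complex q u \<in> vectors_on (codes (Suc q))" for q u
    by (simp add: boundary_map_def mat_apply_def vectors_on_def basis)
  have ex0: "{v \<in> vectors_on (codes (Suc 0)). augmentation complex v = 0} = boundary_map complex 0 ` vectors_on (codes (Suc (Suc 0)))"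
  proof (intro equalityI subsetI)
    fix v assume "v \<in> {v \<in> vectors_on (codes (Suc 0)). augmentation complex v = 0}"
    then have v: "v \<in> vectors_on (codes (Suc 0))" "augmentation complex v = 0"
      by simp_all
    then have v0: "bd (to_chain (Suc 0) v) {} = 0"
      by (simp only: augmentation_complex)
    have "bd (to_chain (Suc 0) v) \<tau> = 0" for \<tau>
    proof (cases "\<tau> = {}")
      case False
      have "\<tau> \<notin> simplices 0"
      proof
        assume \<tau>: "\<tau> \<in> simplices 0"
        then have "card \<tau> = 0"
          by (simp only: simplices_def mem_Collect_eq)
        then show False
          using False card_0_eq[OF finite_simplex[OF \<tau>]] by simp
      qed
      then show ?thesis
        by (rule chain_outside[OF chain_bd[OF to_chain_chain]])
    qed (simp only: v0)
    then have "bd (to_chain (Suc 0) v) = (\<lambda>_. 0)" ..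
    from exact_step[OF v(1) this] obtain u
      where "u \<in> vectors_on (codes (Suc (Suc 0)))" "boundary_map complex 0 u = v" ..
    then show "v \<in> boundary_map complex 0 ` vectors_on (codes (Suc (Suc 0)))"
      by (intro image_eqI[of _ _ u]) simp_all
  next
    fix v assume "v \<in> boundary_map complex 0 ` vectors_on (codes (Suc (Suc 0)))"
    then show "v \<in> {v \<in> vectors_on (codes (Suc 0)). augmentation complex v = 0}"
      using vec cycle by (auto simp: augmentation_complex)
  qed
  have ex: "{v \<in> vectors_on (codes (Suc (Suc p))). boundary_map complex p v = 0} =
      boundary_map complex (Suc p) ` vectors_on (codes (Suc (Suc (Suc p))))" for p
  proof (intro equalityI subsetI)
    fix v assume "v \<in> {v \<in> vectors_on (codes (Suc (Suc p))). boundary_map complex p v = 0}"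
    then have v: "v \<in> vectors_on (codes (Suc (Suc p)))" "boundary_map complex p v = 0"
      by simp_all
    have "bd (to_chain (Suc (Suc p)) v) = (\<lambda>_. 0)"
      using v(2) unfolding boundary_map_complex[OF v(1)] to_vec_eq_0_iff[OF chain_bd[OF to_chain_chain]] .
    from exact_step[OF v(1) this] obtain u
      where "u \<in> vectors_on (codes (Suc (Suc (Suc p))))" "boundary_map complex (Suc p) u = v" ..
    then show "v \<in> boundary_map complex (Suc p) ` vectors_on (codes (Suc (Suc (Suc p))))"
      by (intro image_eqI[of _ _ u]) simp_all
  next
    fix v assume "v \<in> boundary_map complex (Suc p) ` vectors_on (codes (Suc (Suc (Suc p))))"
    then obtain u where u: "u \<in> vectors_on (codes (Suc (Suc (Suc p))))" and v: "v = boundary_map complex (Suc p) u"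
      by blast
    have vv: "v \<in> vectors_on (codes (Suc (Suc p)))"
      unfolding v by (rule vec)
    have "boundary_map complex p v = to_vec (Suc p) (\<lambda>_. 0)"
      unfolding boundary_map_complex[OF vv] by (simp only: v cycle[OF u])
    also have "\<dots> = 0"
      by (simp add: to_vec_def fun_eq_iff)
    finally show "v \<in> {v \<in> vectors_on (codes (Suc (Suc p))). boundary_map complex p v = 0}"
      using vv by simp
  qed
  have fin: "finite (codes q)" for q
    by (simp add: codes_def finite_simplices)
  show ?thesis
    unfolding graded_free_resolution_def basis using hom0 hom im ex0 ex fin
    by (simp add: basis)
qed

end


section \<open>Linear resolutions and joins of simplicial complexes\<close>

definition upset :: "('x \<Rightarrow>\<^sub>0 nat) set \<Rightarrow> ('x \<Rightarrow>\<^sub>0 nat) set" where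
  "upset S = {u. \<exists>s\<in>S. s \<preceq> u}"

definition monomial_ideal :: "('x \<Rightarrow>\<^sub>0 nat) set \<Rightarrow> ('x, 'k::field) mpoly set" where
  "monomial_ideal U = {f. Poly_Mapping.keys f \<subseteq> U}"

text \<open>
  The Taylor resolution makes the choice of a resolution legitimate, and the vanishing criterion
  holds for whichever resolution is chosen.
\<close>

lemma graded_betti_eq_0_iff:
  assumes S: "finite S" and U: "U = upset S" "0 \<notin> U" and enc: "inj (enc :: 'x::finite \<Rightarrow> nat)"
  shows "graded_betti (monomial_ideal U :: ('x, 'k::field) mpoly set) n j = 0 \<longleftrightarrow>
    (\<forall>b. int (total_degree b) = j \<longrightarrow> exact_at TYPE('k) enc (koszul_complex U b) n)"
proof -
  obtain g and m :: nat where g: "S = g ` {i. i < m}"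
    using finite_imp_nat_seg_image_inj_on[OF S] by blast
  have "U = {u. \<exists>i<m. g i \<preceq> u}"
    by (auto simp: U(1) upset_def g)
  then have "graded_free_resolution (taylor.complex g m) (monomial_ideal U :: ('x, 'k) mpoly set)"
    using taylor.graded_free_resolution_complex[of g m] by (simp add: monomial_ideal_def)
  then have "graded_free_resolution (SOME F. graded_free_resolution F (monomial_ideal U)) (monomial_ideal U :: ('x, 'k) mpoly set)"
    by (rule someI)
  then show ?thesis
    unfolding graded_betti_def monomial_ideal_def
    by (rule tensor_homology_dim_eq_0_iff[OF _ U(2) enc])
qed

text \<open>Linearity with generators in degree \<open>d\<close>, expressed by upper Koszul complexes.\<close>

definition linear_at :: "'k::field itself \<Rightarrow> ('x::finite \<Rightarrow> nat) \<Rightarrow> ('x \<Rightarrow>\<^sub>0 nat) set \<Rightarrow> nat \<Rightarrow> bool" where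
  "linear_at ty enc U d \<longleftrightarrow> (\<forall>n b. total_degree b \<noteq> n + d \<longrightarrow> exact_at ty enc (koszul_complex U b) n)"

definition generated_in_degree :: "nat \<Rightarrow> ('x \<Rightarrow>\<^sub>0 nat) set \<Rightarrow> bool" where
  "generated_in_degree d U \<longleftrightarrow> (\<exists>S. finite S \<and> S \<noteq> {} \<and> U = upset S \<and> (\<forall>s\<in>S. total_degree s = d))"

lemma mono_dvd_degree: "u \<preceq> v \<Longrightarrow> total_degree u \<le> total_degree (v :: 'x::finite \<Rightarrow>\<^sub>0 nat)"
  by (simp add: total_degree_UNIV mono_dvd_def sum_mono)

lemma generated_degree_le: "generated_in_degree d U \<Longrightarrow> u \<in> U \<Longrightarrow> d \<le> total_degree (u :: 'x::finite \<Rightarrow>\<^sub>0 nat)"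
  unfolding generated_in_degree_def upset_def using mono_dvd_degree by fastforce

lemma generated_upward: "generated_in_degree d U \<Longrightarrow> u \<in> U \<Longrightarrow> u \<preceq> v \<Longrightarrow> v \<in> U"
  unfolding generated_in_degree_def upset_def using mono_dvd_trans by blast

lemma generated_obtain:
  assumes "generated_in_degree d U"
  obtains u where "u \<in> U" "total_degree u = d"
proof -
  obtain S s where "U = upset S" "\<forall>s\<in>S. total_degree s = d" "s \<in> S"
    using assms unfolding generated_in_degree_def by blast
  moreover from this have "s \<in> U"
    unfolding upset_def using mono_dvd_refl by blast
  ultimately show ?thesis
    by (intro that[of s]) auto
qed

lemma total_degree_koszul:
  assumes "generated_in_degree d U" "\<sigma> \<in> koszul_complex U b"
  shows "card \<sigma> + d \<le> total_degree b"
proof -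
  have "total_degree (b - indicator_mono \<sigma>) + card \<sigma> = total_degree b"
    using assms(2) mono_diff_add[of "indicator_mono \<sigma>" b] total_degree_add[of "b - indicator_mono \<sigma>" "indicator_mono \<sigma>"]
    by (simp add: koszul_complex_def)
  moreover have "d \<le> total_degree (b - indicator_mono \<sigma>)"
    using assms(2) by (intro generated_degree_le[OF assms(1)]) (simp add: koszul_complex_def)
  ultimately show ?thesis
    by simp
qed

lemma koszul_minimal:
  assumes "generated_in_degree d U" "u \<in> U" "total_degree u = d"
  shows "koszul_complex U u = {{}}"
proof
  show "koszul_complex U u \<subseteq> {{}}"
  proof
    fix \<sigma> assume "\<sigma> \<in> koszul_complex U u"
    then have "card \<sigma> + d \<le> d"
      using total_degree_koszul[OF assms(1), of \<sigma> u] assms(3) by simp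
    then show "\<sigma> \<in> {{}}"
      by simp
  qed
  have "u - 0 = u"
    by (rule poly_mapping_eqI) (simp add: lookup_minus)
  then show "{{}} \<subseteq> koszul_complex U u"
    using assms(2) by (simp add: koszul_complex_def)
qed

lemma exact_at_no_chains:
  fixes ty :: "'b::field itself" and \<Delta> :: "'a set set"
  assumes "\<And>\<sigma>. \<sigma> \<in> \<Delta> \<Longrightarrow> card \<sigma> \<noteq> n"
  shows "exact_at ty enc \<Delta> n"
  unfolding exact_at_def
proof (intro allI impI, elim conjE)
  fix c :: "'a set \<Rightarrow> 'b"
  assume "simplicial_chain \<Delta> n c"
  then have "c = (\<lambda>_. 0)"
    using assms by (auto simp: simplicial_chain_def)
  then show "\<exists>h. simplicial_chain \<Delta> (Suc n) h \<and> sboundary enc UNIV h = c"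
    by (intro exI[of _ "\<lambda>_. 0"]) (auto simp: simplicial_chain_def boundary_def)
qed

text \<open>
  In the multidegree of a generator of least degree the upper Koszul complex consists of the empty
  face only, which has homology in position 0. This forces the shift of a linear resolution to be
  the degree of the generators.
\<close>

theorem has_linear_resolution_iff:
  assumes U: "generated_in_degree d U" "d \<ge> 1" and enc: "inj (enc :: 'x::finite \<Rightarrow> nat)"
  shows "has_linear_resolution (monomial_ideal U :: ('x, 'k::field) mpoly set) \<longleftrightarrow> linear_at TYPE('k) enc U d"
proof -
  obtain S where S: "finite S" "U = upset S"
    using U(1) unfolding generated_in_degree_def by blast
  have 0: "0 \<notin> U"
    using generated_degree_le[OF U(1)] U(2) by fastforce
  note betti = graded_betti_eq_0_iff[OF S 0 enc, where 'k = 'k]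
  show ?thesis
  proof
    assume "linear_at TYPE('k) enc U d"
    then have "\<forall>i j. j \<noteq> int i + int d \<longrightarrow> graded_betti (monomial_ideal U :: ('x, 'k) mpoly set) i j = 0"
      unfolding betti linear_at_def by auto
    then show "has_linear_resolution (monomial_ideal U :: ('x, 'k) mpoly set)"
      unfolding has_linear_resolution_def using U(2) by blast
  next
    assume "has_linear_resolution (monomial_ideal U :: ('x, 'k) mpoly set)"
    then obtain d' where "\<forall>i j. j \<noteq> int i + int d' \<longrightarrow> graded_betti (monomial_ideal U :: ('x, 'k) mpoly set) i j = 0"
      unfolding has_linear_resolution_def by blast
    then have d': "exact_at TYPE('k) enc (koszul_complex U b) n" if "total_degree b \<noteq> n + d'" for b n
      using that unfolding betti by (metis of_nat_add of_nat_eq_iff)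
    have "d' = d"
    proof (rule ccontr)
      assume "d' \<noteq> d"
      obtain u where u: "u \<in> U" "total_degree u = d"
        using generated_obtain[OF U(1)] .
      let ?c = "\<lambda>\<sigma>. if \<sigma> = {} then 1 else 0 :: 'k"
      have "exact_at TYPE('k) enc {{}} 0"
        using d'[of u 0] u \<open>d' \<noteq> d\<close> koszul_minimal[OF U(1) u] by simp
      moreover have "simplicial_chain {{}} 0 ?c" "sboundary enc UNIV ?c = (\<lambda>_. 0)"
        by (auto simp: simplicial_chain_def boundary_def fun_eq_iff)
      ultimately obtain h :: "'x set \<Rightarrow> 'k" where h: "simplicial_chain {{}} (Suc 0) h" "sboundary enc UNIV h = ?c"
        unfolding exact_at_def by blast
      have "h {x} = 0" for x
        using h(1) by (force simp: simplicial_chain_def)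
      then show False
        using fun_cong[OF h(2), of "{}"] by (simp add: boundary_def)
    qed
    then show "linear_at TYPE('k) enc U d"
      unfolding linear_at_def using d' by blast
  qed
qed

lemma simplicial_chain_boundary:
  fixes g :: "'x::finite set \<Rightarrow> 'k::field"
  assumes "simplicial_chain \<Delta> (Suc n) g" "\<And>\<sigma> \<tau>. \<sigma> \<in> \<Delta> \<Longrightarrow> \<tau> \<subseteq> \<sigma> \<Longrightarrow> \<tau> \<in> \<Delta>"
  shows "simplicial_chain \<Delta> n (sboundary enc UNIV g)"
  unfolding simplicial_chain_def
proof (intro allI impI)
  fix \<tau> assume nz: "sboundary enc UNIV g \<tau> \<noteq> 0"
  obtain x where x: "x \<in> UNIV - \<tau>" "sgn_at enc x \<tau> * 1 * g (insert x \<tau>) \<noteq> 0"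
    using nz unfolding boundary_def by (rule sum.not_neutral_contains_not_neutral)
  then have "insert x \<tau> \<in> \<Delta>" "card (insert x \<tau>) = Suc n"
    using assms(1) unfolding simplicial_chain_def by (metis mult_zero_right)+
  then show "\<tau> \<in> \<Delta> \<and> card \<tau> = n"
    using assms(2)[of "insert x \<tau>" \<tau>] x(1) by auto
qed

lemma sboundary_diff: "sboundary enc V (\<lambda>\<sigma>. c \<sigma> - g \<sigma>) \<tau> = sboundary enc V c \<tau> - sboundary enc V g \<tau>"
  by (simp add: boundary_def right_diff_distrib sum_subtractf)

lemma sboundary_add: "sboundary enc V (\<lambda>\<sigma>. c \<sigma> + g \<sigma>) \<tau> = sboundary enc V c \<tau> + sboundary enc V g \<tau>"
  by (simp add: boundary_def distrib_left sum.distrib)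

lemma simplicial_chain_diff: "simplicial_chain \<Delta> n c \<Longrightarrow> simplicial_chain \<Delta> n g \<Longrightarrow> simplicial_chain \<Delta> n (\<lambda>\<sigma>. c \<sigma> - (g \<sigma> :: 'k::field))"
  unfolding simplicial_chain_def by (metis diff_zero)

lemma simplicial_chain_add: "simplicial_chain \<Delta> n c \<Longrightarrow> simplicial_chain \<Delta> n g \<Longrightarrow> simplicial_chain \<Delta> n (\<lambda>\<sigma>. c \<sigma> + (g \<sigma> :: 'k::field))"
  unfolding simplicial_chain_def by (metis add_0)

lemma sboundary_sboundary:
  fixes g :: "'x::finite set \<Rightarrow> 'k::field"
  assumes "inj enc"
  shows "sboundary enc UNIV (sboundary enc UNIV g) \<tau> = 0"
  by (rule boundary_boundary) (use assms in auto)

text \<open>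
  Preimages under the boundary can be chosen linearly, hence compatibly with a second differential
  that acts on the coefficients.
\<close>

lemma linear_section:
  fixes \<Delta> :: "'x::finite set set" and enc :: "'x \<Rightarrow> nat"
  obtains L :: "('x set \<Rightarrow> 'k::field) \<Rightarrow> 'x set \<Rightarrow> 'k"
  where "\<forall>v. simplicial_chain \<Delta> n (L v)"
    and "\<forall>h. simplicial_chain \<Delta> n h \<longrightarrow> sboundary enc UNIV (L (sboundary enc UNIV h)) = sboundary enc UNIV h"
    and "\<forall>A (a :: 'x \<Rightarrow> 'k) f \<tau>. finite A \<longrightarrow> L (\<lambda>\<sigma>. \<Sum>x\<in>A. a x * f x \<sigma>) \<tau> = (\<Sum>x\<in>A. a x * L (f x) \<tau>)"
proof -
  let ?s = "\<lambda>a (f :: 'x set \<Rightarrow> 'k) \<sigma>. a * f \<sigma>"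
  interpret vector_space ?s
    by unfold_locales (auto simp: fun_eq_iff algebra_simps)
  interpret vector_space_pair ?s ?s
    by unfold_locales
  let ?V = "{h. simplicial_chain \<Delta> n h} :: ('x set \<Rightarrow> 'k) set"
  have lin: "Vector_Spaces.linear ?s ?s (sboundary enc UNIV)"
    by unfold_locales (auto simp: fun_eq_iff boundary_def algebra_simps sum.distrib sum_distrib_left)
  have sub: "subspace ?V"
    unfolding subspace_def by (auto simp: simplicial_chain_def) (metis add_0)+
  obtain L where L: "Vector_Spaces.linear ?s ?s L" "range L \<subseteq> ?V"
      "\<forall>v\<in>sboundary enc UNIV ` ?V. sboundary enc UNIV (L v) = v"
    using linear_exists_right_inverse_on[OF lin sub] by blast
  have sum: "L (\<lambda>\<sigma>. \<Sum>x\<in>A. a x * f x \<sigma>) \<tau> = (\<Sum>x\<in>A. a x * L (f x) \<tau>)" if "finite A" for A :: "'x set" and a f \<tau>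
  proof -
    have "(\<lambda>\<sigma>. \<Sum>x\<in>A. a x * f x \<sigma>) = (\<Sum>x\<in>A. ?s (a x) (f x))"
      using that by (induction A) (auto simp: fun_eq_iff)
    then have "L (\<lambda>\<sigma>. \<Sum>x\<in>A. a x * f x \<sigma>) = (\<Sum>x\<in>A. ?s (a x) (L (f x)))"
      by (simp only: linear_sum[OF L(1)] linear_scale[OF L(1)])
    moreover have "(\<Sum>x\<in>A. ?s (a x) (L (f x))) \<tau> = (\<Sum>x\<in>A. a x * L (f x) \<tau>)"
      using that by (induction A) simp_all
    ultimately show ?thesis
      by simp
  qed
  show ?thesis
    by (rule that[of L]) (use L sum in auto)
qed

text \<open>
  The join of two complexes on complementary sets of vertices, where all vertices of the first
  factor precede those of the second. With this order the chain complex of the join is the total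
  complex of the tensor product, and \<open>slice1\<close> and \<open>slice2\<close> are its rows and columns.
\<close>

locale join =
  fixes enc :: "'x::finite \<Rightarrow> nat" and W :: "'x set" and \<Delta>1 \<Delta>2 :: "'x set set" and ty :: "'k::field itself"
  assumes enc: "inj enc" "\<And>x y. x \<notin> W \<Longrightarrow> y \<in> W \<Longrightarrow> enc x < enc y"
    and sub1: "\<sigma> \<in> \<Delta>1 \<Longrightarrow> \<sigma> \<subseteq> - W" and sub2: "\<sigma> \<in> \<Delta>2 \<Longrightarrow> \<sigma> \<subseteq> W"
    and down1: "\<sigma> \<in> \<Delta>1 \<Longrightarrow> \<tau> \<subseteq> \<sigma> \<Longrightarrow> \<tau> \<in> \<Delta>1"
    and down2: "\<sigma> \<in> \<Delta>2 \<Longrightarrow> \<tau> \<subseteq> \<sigma> \<Longrightarrow> \<tau> \<in> \<Delta>2"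
begin

abbreviation \<Delta> :: "'x set set" where "\<Delta> \<equiv> {\<sigma>. \<sigma> - W \<in> \<Delta>1 \<and> \<sigma> \<inter> W \<in> \<Delta>2}"

abbreviation bd :: "('x set \<Rightarrow> 'k) \<Rightarrow> 'x set \<Rightarrow> 'k" where "bd \<equiv> sboundary enc UNIV"

lemma down: "\<sigma> \<in> \<Delta> \<Longrightarrow> \<tau> \<subseteq> \<sigma> \<Longrightarrow> \<tau> \<in> \<Delta>"
  using down1[of "\<sigma> - W" "\<tau> - W"] down2[of "\<sigma> \<inter> W" "\<tau> \<inter> W"] by blast

lemma card_split: "card \<sigma> = card (\<sigma> - W) + card (\<sigma> \<inter> W)"
  by (metis Int_Diff_Un Int_Diff_disjoint add.commute card_Un_disjoint finite)

definition slice1 :: "('x set \<Rightarrow> 'k) \<Rightarrow> 'x set \<Rightarrow> 'x set \<Rightarrow> 'k" where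
  "slice1 c \<tau>2 \<sigma> = (if \<sigma> \<subseteq> - W then c (\<sigma> \<union> \<tau>2) else 0)"

definition slice2 :: "('x set \<Rightarrow> 'k) \<Rightarrow> 'x set \<Rightarrow> 'x set \<Rightarrow> 'k" where
  "slice2 c \<tau>1 \<sigma> = (if \<sigma> \<subseteq> W then c (\<tau>1 \<union> \<sigma>) else 0)"

text \<open>The vertices of the second factor have to pass all vertices of \<open>\<tau>1\<close>, whence the sign.\<close>

lemma bd_slices:
  assumes "\<tau>1 \<subseteq> - W" "\<tau>2 \<subseteq> W"
  shows "bd c (\<tau>1 \<union> \<tau>2) = bd (slice1 c \<tau>2) \<tau>1 + (-1) ^ card \<tau>1 * bd (slice2 c \<tau>1) \<tau>2"
proof -
  let ?f = "\<lambda>x. sgn_at enc x (\<tau>1 \<union> \<tau>2) * 1 * c (insert x (\<tau>1 \<union> \<tau>2))"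
  have "UNIV - (\<tau>1 \<union> \<tau>2) = (- W - \<tau>1) \<union> (W - \<tau>2)"
    using assms by blast
  then have "bd c (\<tau>1 \<union> \<tau>2) = sum ?f (- W - \<tau>1) + sum ?f (W - \<tau>2)"
    unfolding boundary_def by (simp only:) (intro sum.union_disjoint; auto)
  moreover have "sum ?f (- W - \<tau>1) = bd (slice1 c \<tau>2) \<tau>1"
  proof -
    have "bd (slice1 c \<tau>2) \<tau>1 = (\<Sum>x\<in>- W - \<tau>1. sgn_at enc x \<tau>1 * 1 * slice1 c \<tau>2 (insert x \<tau>1))"
      unfolding boundary_def by (intro sum.mono_neutral_right) (auto simp: slice1_def)
    also have "\<dots> = sum ?f (- W - \<tau>1)"
    proof (rule sum.cong[OF refl])
      fix x assume x: "x \<in> - W - \<tau>1"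
      have "{y \<in> \<tau>1 \<union> \<tau>2. enc y < enc x} = {y \<in> \<tau>1. enc y < enc x}"
        using enc(2)[of x] x assms(2) by (auto simp: subset_iff dest: less_asym)
      then show "sgn_at enc x \<tau>1 * 1 * slice1 c \<tau>2 (insert x \<tau>1) = ?f x"
        using x assms(1) by (simp add: slice1_def sgn_at_def)
    qed
    finally show ?thesis ..
  qed
  moreover have "sum ?f (W - \<tau>2) = (-1) ^ card \<tau>1 * bd (slice2 c \<tau>1) \<tau>2"
  proof -
    have "bd (slice2 c \<tau>1) \<tau>2 = (\<Sum>x\<in>W - \<tau>2. sgn_at enc x \<tau>2 * 1 * slice2 c \<tau>1 (insert x \<tau>2))"
      unfolding boundary_def by (intro sum.mono_neutral_right) (auto simp: slice2_def)
    then have "(-1) ^ card \<tau>1 * bd (slice2 c \<tau>1) \<tau>2 =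
        (\<Sum>x\<in>W - \<tau>2. (-1) ^ card \<tau>1 * (sgn_at enc x \<tau>2 * 1 * slice2 c \<tau>1 (insert x \<tau>2)))"
      by (simp only: sum_distrib_left)
    also have "\<dots> = sum ?f (W - \<tau>2)"
    proof (rule sum.cong[OF refl])
      fix x assume x: "x \<in> W - \<tau>2"
      have "{y \<in> \<tau>1 \<union> \<tau>2. enc y < enc x} = \<tau>1 \<union> {y \<in> \<tau>2. enc y < enc x}"
        using enc(2) x assms(1) by auto
      moreover have "card (\<tau>1 \<union> {y \<in> \<tau>2. enc y < enc x}) = card \<tau>1 + card {y \<in> \<tau>2. enc y < enc x}"
        using assms by (intro card_Un_disjoint) auto
      ultimately have "sgn_at enc x (\<tau>1 \<union> \<tau>2) = (-1) ^ card \<tau>1 * (sgn_at enc x \<tau>2 :: 'k)"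
        by (simp add: sgn_at_def power_add)
      then show "(-1) ^ card \<tau>1 * (sgn_at enc x \<tau>2 * 1 * slice2 c \<tau>1 (insert x \<tau>2)) = ?f x"
        using x assms(2) by (simp add: slice2_def mult.assoc)
    qed
    finally show ?thesis ..
  qed
  ultimately show ?thesis
    by simp
qed

lemma bd_eqI:
  assumes "\<And>\<tau>1 \<tau>2. \<tau>1 \<subseteq> - W \<Longrightarrow> \<tau>2 \<subseteq> W \<Longrightarrow> f (\<tau>1 \<union> \<tau>2) = g (\<tau>1 \<union> \<tau>2)"
  shows "f = g"
proof
  fix \<sigma>
  have "f ((\<sigma> - W) \<union> (\<sigma> \<inter> W)) = g ((\<sigma> - W) \<union> (\<sigma> \<inter> W))"
    by (rule assms) auto
  moreover have "(\<sigma> - W) \<union> (\<sigma> \<inter> W) = \<sigma>"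
    by blast
  ultimately show "f \<sigma> = g \<sigma>"
    by simp
qed

lemma split_parts:
  assumes "\<tau>1 \<subseteq> - W" "\<tau>2 \<subseteq> W"
  shows "(\<tau>1 \<union> \<tau>2) - W = \<tau>1" "(\<tau>1 \<union> \<tau>2) \<inter> W = \<tau>2"
  using assms by auto

lemma bd_zeroI: "(\<And>x. x \<notin> \<tau> \<Longrightarrow> c (insert x \<tau>) = 0) \<Longrightarrow> bd c \<tau> = 0"
  unfolding boundary_def by (intro sum.neutral) simp

text \<open>
  A cycle whose components start in row \<open>k\<close> of the first factor has a lowest component that is a
  cycle in the first direction. If the first factor is exact there, a boundary can be subtracted
  so that the components start in row \<open>k + 1\<close>.
\<close>

lemma push_up:
  assumes exact1: "exact_at ty enc \<Delta>1 k"
    and c: "simplicial_chain \<Delta> n c" "\<And>\<tau>. bd c \<tau> = 0" and k: "\<And>\<sigma>. c \<sigma> \<noteq> 0 \<Longrightarrow> k \<le> card (\<sigma> - W)"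
  obtains g where "simplicial_chain \<Delta> (Suc n) g" "\<forall>\<sigma>. c \<sigma> - bd g \<sigma> \<noteq> 0 \<longrightarrow> Suc k \<le> card (\<sigma> - W)"
proof -
  define s where "s \<tau>2 \<sigma> = (if \<tau>2 \<subseteq> W \<and> \<sigma> \<subseteq> - W \<and> card \<sigma> = k then c (\<sigma> \<union> \<tau>2) else 0)" for \<tau>2 \<sigma>
  have s_nz: "\<tau>2 \<in> \<Delta>2 \<and> card \<tau>2 + k = n \<and> \<sigma> \<in> \<Delta>1 \<and> card \<sigma> = k" if "s \<tau>2 \<sigma> \<noteq> 0" for \<tau>2 \<sigma>
  proof -
    have *: "\<tau>2 \<subseteq> W" "\<sigma> \<subseteq> - W" "card \<sigma> = k" "c (\<sigma> \<union> \<tau>2) \<noteq> 0"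
      using that by (auto simp: s_def split: if_splits)
    then have "\<sigma> \<union> \<tau>2 \<in> \<Delta>" "card (\<sigma> \<union> \<tau>2) = n"
      using c(1) unfolding simplicial_chain_def by blast+
    then show ?thesis
      using * card_split[of "\<sigma> \<union> \<tau>2"] by (simp add: split_parts)
  qed
  have "\<exists>h. simplicial_chain \<Delta>1 (Suc k) h \<and> bd h = s \<tau>2 \<and> (\<not> (\<tau>2 \<in> \<Delta>2 \<and> card \<tau>2 + k = n) \<longrightarrow> h = (\<lambda>_. 0))" for \<tau>2
  proof (cases "\<tau>2 \<in> \<Delta>2 \<and> card \<tau>2 + k = n")
    case True
    have \<tau>2: "\<tau>2 \<subseteq> W"
      using True sub2 by blast
    have "simplicial_chain \<Delta>1 k (s \<tau>2)"
      using s_nz by (auto simp: simplicial_chain_def)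
    moreover have "bd (s \<tau>2) \<tau>1 = 0" for \<tau>1
    proof (cases "\<tau>1 \<subseteq> - W \<and> Suc (card \<tau>1) = k")
      case True
      have "bd (slice2 c \<tau>1) \<tau>2 = 0"
      proof (rule bd_zeroI)
        fix x
        show "slice2 c \<tau>1 (insert x \<tau>2) = 0"
        proof (rule ccontr)
          assume "slice2 c \<tau>1 (insert x \<tau>2) \<noteq> 0"
          then have *: "insert x \<tau>2 \<subseteq> W" "c (\<tau>1 \<union> insert x \<tau>2) \<noteq> 0"
            unfolding slice2_def by presburger+
          have "k \<le> card \<tau>1"
            using k[OF *(2)] split_parts(1)[OF conjunct1[OF True] *(1)] by simp
          then show False
            using True by simp
        qed
      qed
      then have "bd (slice1 c \<tau>2) \<tau>1 = 0"
        using bd_slices[of \<tau>1 \<tau>2 c] True \<tau>2 c(2) by simp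
      moreover have "bd (slice1 c \<tau>2) \<tau>1 = bd (s \<tau>2) \<tau>1"
        unfolding boundary_def using True \<tau>2 by (intro sum.cong) (auto simp: slice1_def s_def)
      ultimately show ?thesis
        by simp
    next
      case False
      show ?thesis
      proof (rule bd_zeroI)
        fix x assume "x \<notin> \<tau>1"
        then show "s \<tau>2 (insert x \<tau>1) = 0"
          using False by (auto simp: s_def)
      qed
    qed
    then have "bd (s \<tau>2) = (\<lambda>_. 0)" ..
    ultimately show ?thesis
      using exact1 True unfolding exact_at_def by blast
  next
    case False
    then have "s \<tau>2 = (\<lambda>_. 0)"
      using s_nz by blast
    then show ?thesis
      by (intro exI[of _ "\<lambda>_. 0"]) (auto simp: simplicial_chain_def boundary_def)
  qed
  from choice[OF allI[OF this]] obtain h where h: "\<forall>\<tau>2. simplicial_chain \<Delta>1 (Suc k) (h \<tau>2) \<and> bd (h \<tau>2) = s \<tau>2 \<and>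
      (\<not> (\<tau>2 \<in> \<Delta>2 \<and> card \<tau>2 + k = n) \<longrightarrow> h \<tau>2 = (\<lambda>_. 0))" ..
  have h2: "bd (h \<tau>2) = s \<tau>2" for \<tau>2
    using spec[OF h, of \<tau>2] by (elim conjE)
  have h1: "\<sigma> \<in> \<Delta>1 \<and> card \<sigma> = Suc k \<and> \<tau>2 \<in> \<Delta>2 \<and> card \<tau>2 + k = n" if nz: "h \<tau>2 \<sigma> \<noteq> 0" for \<tau>2 \<sigma>
  proof -
    have "simplicial_chain \<Delta>1 (Suc k) (h \<tau>2)"
      using spec[OF h, of \<tau>2] by (elim conjE)
    then have 1: "\<sigma> \<in> \<Delta>1 \<and> card \<sigma> = Suc k"
      using nz unfolding simplicial_chain_def by simp
    have "h \<tau>2 \<noteq> (\<lambda>_. 0)"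
      using nz by (metis (no_types))
    then have "\<tau>2 \<in> \<Delta>2 \<and> card \<tau>2 + k = n"
      using spec[OF h, of \<tau>2] by argo
    then show ?thesis
      using 1 by simp
  qed
  define g where "g \<sigma> = h (\<sigma> \<inter> W) (\<sigma> - W)" for \<sigma>
  show ?thesis
  proof
    show "simplicial_chain \<Delta> (Suc n) g"
      unfolding simplicial_chain_def
    proof (intro allI impI)
      fix \<sigma> assume "g \<sigma> \<noteq> 0"
      from h1[OF this[unfolded g_def]] show "\<sigma> \<in> \<Delta> \<and> card \<sigma> = Suc n"
        using card_split[of \<sigma>] by simp
    qed
    show "\<forall>\<sigma>. c \<sigma> - bd g \<sigma> \<noteq> 0 \<longrightarrow> Suc k \<le> card (\<sigma> - W)"
    proof (intro allI impI, rule ccontr)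
      fix \<sigma> assume nz: "c \<sigma> - bd g \<sigma> \<noteq> 0" and "\<not> Suc k \<le> card (\<sigma> - W)"
      then have small: "card (\<sigma> - W) \<le> k"
        by simp
      let ?\<tau>1 = "\<sigma> - W" and ?\<tau>2 = "\<sigma> \<inter> W"
      have \<sigma>: "\<sigma> = ?\<tau>1 \<union> ?\<tau>2"
        by blast
      have sub: "?\<tau>1 \<subseteq> - W" "?\<tau>2 \<subseteq> W"
        by blast+
      have "bd (slice2 g ?\<tau>1) ?\<tau>2 = 0"
      proof (rule bd_zeroI)
        fix x
        show "slice2 g ?\<tau>1 (insert x ?\<tau>2) = 0"
        proof (cases "insert x ?\<tau>2 \<subseteq> W")
          case True
          have "?\<tau>1 \<subseteq> - W"
            by blast
          from split_parts[OF this True] show ?thesis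
            using h1[of "insert x ?\<tau>2" ?\<tau>1] small True by (auto simp: slice2_def g_def)
        qed (simp add: slice2_def)
      qed
      moreover have "bd (slice1 g ?\<tau>2) ?\<tau>1 = bd (h ?\<tau>2) ?\<tau>1"
        unfolding boundary_def
      proof (rule sum.cong[OF refl])
        fix x assume x: "x \<in> UNIV - ?\<tau>1"
        have "slice1 g ?\<tau>2 (insert x ?\<tau>1) = h ?\<tau>2 (insert x ?\<tau>1)"
        proof (cases "insert x ?\<tau>1 \<subseteq> - W")
          case True
          have "?\<tau>2 \<subseteq> W"
            by blast
          from split_parts[OF True this] show ?thesis
            using True by (simp add: slice1_def g_def)
        next
          case False
          then have "h ?\<tau>2 (insert x ?\<tau>1) = 0"
            using h1[of ?\<tau>2 "insert x ?\<tau>1"] sub1 by blast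
          moreover have "slice1 g ?\<tau>2 (insert x ?\<tau>1) = 0"
            unfolding slice1_def by (rule if_not_P[OF False])
          ultimately show ?thesis
            by simp
        qed
        then show "sgn_at enc x ?\<tau>1 * 1 * slice1 g ?\<tau>2 (insert x ?\<tau>1) = sgn_at enc x ?\<tau>1 * 1 * h ?\<tau>2 (insert x ?\<tau>1)"
          by simp
      qed
      ultimately have "bd g (?\<tau>1 \<union> ?\<tau>2) = s ?\<tau>2 ?\<tau>1"
        using bd_slices[OF sub, of g] h2 by simp
      then have bdg: "bd g \<sigma> = s ?\<tau>2 ?\<tau>1"
        by (simp only: \<sigma>[symmetric])
      show False
      proof (cases "card ?\<tau>1 = k")
        case True
        then have "s ?\<tau>2 ?\<tau>1 = c \<sigma>"
          unfolding s_def using sub \<sigma> by presburger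
        then show False
          using nz bdg by simp
      next
        case False
        then have "s ?\<tau>2 ?\<tau>1 = 0" "c \<sigma> = 0"
          using k[of \<sigma>] small by (auto simp: s_def)
        then show False
          using nz bdg by simp
      qed
    qed
  qed
qed

text \<open>
  In the top row a cycle is a cycle for both differentials. Dividing by the second differential
  with a linear section keeps it a cycle for the first one, so that no new components appear.
\<close>

lemma top_row:
  assumes dim1: "\<And>\<sigma>. \<sigma> \<in> \<Delta>1 \<Longrightarrow> card \<sigma> \<le> p"
    and exact2: "exact_at ty enc \<Delta>2 r"
    and c: "simplicial_chain \<Delta> (p + r) c" "\<And>\<tau>. bd c \<tau> = 0" and k: "\<And>\<sigma>. c \<sigma> \<noteq> 0 \<Longrightarrow> p \<le> card (\<sigma> - W)"
  obtains g where "simplicial_chain \<Delta> (Suc (p + r)) g" "bd g = c"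
proof -
  obtain L :: "('x set \<Rightarrow> 'k) \<Rightarrow> 'x set \<Rightarrow> 'k" where L1: "\<forall>v. simplicial_chain \<Delta>2 (Suc r) (L v)"
    and L2: "\<forall>h. simplicial_chain \<Delta>2 (Suc r) h \<longrightarrow> bd (L (bd h)) = bd h"
    and L3: "\<forall>A (a :: 'x \<Rightarrow> 'k) f \<tau>. finite A \<longrightarrow> L (\<lambda>\<sigma>. \<Sum>x\<in>A. a x * f x \<sigma>) \<tau> = (\<Sum>x\<in>A. a x * L (f x) \<tau>)"
    by (rule linear_section[of \<Delta>2 "Suc r" enc])
  have L0: "L (\<lambda>_. 0) \<tau> = 0" for \<tau>
    using L3[rule_format, of "{}"] by simp
  have c_nz: "\<tau>1 \<in> \<Delta>1 \<and> card \<tau>1 = p \<and> \<tau>2 \<in> \<Delta>2 \<and> card \<tau>2 = r" if "c (\<tau>1 \<union> \<tau>2) \<noteq> 0" "\<tau>1 \<subseteq> - W" "\<tau>2 \<subseteq> W" for \<tau>1 \<tau>2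
  proof -
    have 1: "\<tau>1 \<union> \<tau>2 \<in> \<Delta>" "card (\<tau>1 \<union> \<tau>2) = p + r"
      using c(1) that(1) unfolding simplicial_chain_def by blast+
    have 2: "\<tau>1 \<in> \<Delta>1" "\<tau>2 \<in> \<Delta>2"
      using 1(1) by (simp_all add: split_parts[OF that(2,3)])
    have "p \<le> card \<tau>1"
      using k[OF that(1)] by (simp add: split_parts[OF that(2,3)])
    then show ?thesis
      using 1 2 dim1[of \<tau>1] card_split[of "\<tau>1 \<union> \<tau>2"] by (simp add: split_parts[OF that(2,3)])
  qed
  have slice2_0: "slice2 c \<tau>1 = (\<lambda>_. 0)" if "\<tau>1 \<subseteq> - W" "\<not> (\<tau>1 \<in> \<Delta>1 \<and> card \<tau>1 = p)" for \<tau>1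
    using c_nz[OF _ that(1)] that(2) by (auto simp: slice2_def fun_eq_iff)
  have bd1: "bd (slice1 c \<tau>2) \<tau>1 = 0" if "\<tau>1 \<subseteq> - W" "\<tau>2 \<subseteq> W" for \<tau>1 \<tau>2
  proof (cases "card \<tau>1 = p")
    case True
    show ?thesis
    proof (rule bd_zeroI)
      fix x assume "x \<notin> \<tau>1"
      then have "card (insert x \<tau>1) \<noteq> p"
        using True by simp
      then show "slice1 c \<tau>2 (insert x \<tau>1) = 0"
        using c_nz[of "insert x \<tau>1" \<tau>2] that(2) by (auto simp: slice1_def)
    qed
  next
    case False
    then have "bd (slice2 c \<tau>1) \<tau>2 = 0"
      using slice2_0[OF that(1)] by (simp add: boundary_def)
    then show ?thesis
      using bd_slices[OF that, of c] c(2) by simp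
  qed
  have L_inv: "bd (L (slice2 c \<tau>1)) = slice2 c \<tau>1" if \<tau>1: "\<tau>1 \<subseteq> - W" for \<tau>1
  proof -
    have "simplicial_chain \<Delta>2 r (slice2 c \<tau>1)"
      unfolding simplicial_chain_def
    proof (intro allI impI)
      fix \<sigma> assume "slice2 c \<tau>1 \<sigma> \<noteq> 0"
      then have "\<sigma> \<subseteq> W" "c (\<tau>1 \<union> \<sigma>) \<noteq> 0"
        by (auto simp: slice2_def split: if_splits)
      then show "\<sigma> \<in> \<Delta>2 \<and> card \<sigma> = r"
        using c_nz[OF _ \<tau>1] by blast
    qed
    moreover have "bd (slice2 c \<tau>1) \<tau>2 = 0" for \<tau>2
    proof (cases "\<tau>2 \<subseteq> W")
      case True
      have "(-1) ^ card \<tau>1 * bd (slice2 c \<tau>1) \<tau>2 = 0"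
        using bd_slices[OF \<tau>1 True, of c] bd1[OF \<tau>1 True] c(2) by simp
      then show ?thesis
        by simp
    next
      case False
      then show ?thesis
        by (intro bd_zeroI) (auto simp: slice2_def)
    qed
    then have "bd (slice2 c \<tau>1) = (\<lambda>_. 0)" ..
    ultimately obtain h where "simplicial_chain \<Delta>2 (Suc r) h" "bd h = slice2 c \<tau>1"
      using exact2 unfolding exact_at_def by blast
    then show ?thesis
      using L2 by metis
  qed
  define g where "g \<sigma> = (-1) ^ p * L (slice2 c (\<sigma> - W)) (\<sigma> \<inter> W)" for \<sigma>
  have g_split: "g (\<tau>1 \<union> \<tau>2) = (-1) ^ p * L (slice2 c \<tau>1) \<tau>2" if "\<tau>1 \<subseteq> - W" "\<tau>2 \<subseteq> W" for \<tau>1 \<tau>2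
    by (simp add: g_def split_parts[OF that])
  have L_nz: "\<sigma> \<in> \<Delta>2 \<and> card \<sigma> = Suc r" if "L v \<sigma> \<noteq> 0" for v \<sigma>
    using L1 that by (simp add: simplicial_chain_def)
  show ?thesis
  proof
    show "simplicial_chain \<Delta> (Suc (p + r)) g"
      unfolding simplicial_chain_def
    proof (intro allI impI)
      fix \<sigma> assume "g \<sigma> \<noteq> 0"
      then have nz: "L (slice2 c (\<sigma> - W)) (\<sigma> \<inter> W) \<noteq> 0"
        by (auto simp: g_def)
      then have "slice2 c (\<sigma> - W) \<noteq> (\<lambda>_. 0)"
        using L0 by metis
      then have "\<sigma> - W \<in> \<Delta>1 \<and> card (\<sigma> - W) = p"
        using slice2_0[of "\<sigma> - W"] by blast
      then show "\<sigma> \<in> \<Delta> \<and> card \<sigma> = Suc (p + r)"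
        using L_nz[OF nz] card_split[of \<sigma>] by simp
    qed
    show "bd g = c"
    proof (rule bd_eqI)
      fix \<tau>1 \<tau>2 assume \<tau>: "\<tau>1 \<subseteq> - W" "\<tau>2 \<subseteq> W"
      have "bd (slice1 g \<tau>2) \<tau>1 = (\<Sum>x\<in>- W - \<tau>1. sgn_at enc x \<tau>1 * 1 * slice1 g \<tau>2 (insert x \<tau>1))"
        unfolding boundary_def by (intro sum.mono_neutral_right) (auto simp: slice1_def)
      also have "\<dots> = (\<Sum>x\<in>- W - \<tau>1. (-1) ^ p * (sgn_at enc x \<tau>1 * L (slice2 c (insert x \<tau>1)) \<tau>2))"
      proof (rule sum.cong[OF refl])
        fix x assume "x \<in> - W - \<tau>1"
        then have "insert x \<tau>1 \<subseteq> - W"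
          using \<tau>(1) by blast
        then show "sgn_at enc x \<tau>1 * 1 * slice1 g \<tau>2 (insert x \<tau>1) = (-1) ^ p * (sgn_at enc x \<tau>1 * L (slice2 c (insert x \<tau>1)) \<tau>2)"
          using g_split[OF _ \<tau>(2), of "insert x \<tau>1"] by (simp add: slice1_def)
      qed
      also have "\<dots> = (-1) ^ p * L (\<lambda>\<sigma>. \<Sum>x\<in>- W - \<tau>1. sgn_at enc x \<tau>1 * slice2 c (insert x \<tau>1) \<sigma>) \<tau>2"
        using L3 by (simp add: sum_distrib_left)
      also have "(\<lambda>\<sigma>. \<Sum>x\<in>- W - \<tau>1. sgn_at enc x \<tau>1 * slice2 c (insert x \<tau>1) \<sigma>) = (\<lambda>_. 0)"
      proof
        fix \<sigma>
        show "(\<Sum>x\<in>- W - \<tau>1. sgn_at enc x \<tau>1 * slice2 c (insert x \<tau>1) \<sigma>) = 0"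
        proof (cases "\<sigma> \<subseteq> W")
          case True
          have "(\<Sum>x\<in>- W - \<tau>1. sgn_at enc x \<tau>1 * slice2 c (insert x \<tau>1) \<sigma>) =
              (\<Sum>x\<in>- W - \<tau>1. sgn_at enc x \<tau>1 * 1 * slice1 c \<sigma> (insert x \<tau>1))"
            using True \<tau>(1) by (intro sum.cong) (auto simp: slice1_def slice2_def)
          also have "\<dots> = bd (slice1 c \<sigma>) \<tau>1"
            unfolding boundary_def by (intro sum.mono_neutral_left) (auto simp: slice1_def)
          also have "\<dots> = 0"
            by (rule bd1[OF \<tau>(1) True])
          finally show ?thesis .
        qed (simp add: slice2_def)
      qed
      finally have s1: "bd (slice1 g \<tau>2) \<tau>1 = 0"
        by (simp add: L0)
      have s2: "bd (slice2 g \<tau>1) \<tau>2 = (-1) ^ p * slice2 c \<tau>1 \<tau>2"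
      proof -
        have "bd (slice2 g \<tau>1) \<tau>2 = (\<Sum>x\<in>UNIV - \<tau>2. (-1) ^ p * (sgn_at enc x \<tau>2 * 1 * L (slice2 c \<tau>1) (insert x \<tau>2)))"
          unfolding boundary_def
        proof (rule sum.cong[OF refl])
          fix x
          have "slice2 g \<tau>1 (insert x \<tau>2) = (-1) ^ p * L (slice2 c \<tau>1) (insert x \<tau>2)"
          proof (cases "insert x \<tau>2 \<subseteq> W")
            case True
            then show ?thesis
              using g_split[OF \<tau>(1) True] by (simp add: slice2_def)
          next
            case False
            then have "L (slice2 c \<tau>1) (insert x \<tau>2) = 0"
              using L_nz sub2 by blast
            moreover have "slice2 g \<tau>1 (insert x \<tau>2) = 0"
              unfolding slice2_def by (rule if_not_P[OF False])
            ultimately show ?thesis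
              by simp
          qed
          then show "sgn_at enc x \<tau>2 * 1 * slice2 g \<tau>1 (insert x \<tau>2) =
              (-1) ^ p * (sgn_at enc x \<tau>2 * 1 * L (slice2 c \<tau>1) (insert x \<tau>2))"
            by simp
        qed
        also have "\<dots> = (-1) ^ p * bd (L (slice2 c \<tau>1)) \<tau>2"
          unfolding boundary_def by (simp only: sum_distrib_left)
        finally show ?thesis
          by (simp add: L_inv[OF \<tau>(1)])
      qed
      have "bd g (\<tau>1 \<union> \<tau>2) = (-1) ^ card \<tau>1 * ((-1) ^ p * slice2 c \<tau>1 \<tau>2)"
        using bd_slices[OF \<tau>, of g] s1 s2 by simp
      also have "\<dots> = c (\<tau>1 \<union> \<tau>2)"
      proof (cases "card \<tau>1 = p")
        case True
        have "(-1) ^ p * (-1) ^ p = (1 :: 'k)"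
          by (simp flip: power_mult_distrib)
        then show ?thesis
          using True \<tau>(2) by (simp add: slice2_def flip: mult.assoc)
      next
        case False
        then have "c (\<tau>1 \<union> \<tau>2) = 0"
          using c_nz[OF _ \<tau>] by blast
        then show ?thesis
          using \<tau>(2) by (simp add: slice2_def)
      qed
      finally show "bd g (\<tau>1 \<union> \<tau>2) = c (\<tau>1 \<union> \<tau>2)" .
    qed
  qed
qed

text \<open>
  A special case of the Kuenneth formula: if one factor has homology only in its top position \<open>p\<close>
  and the other one only in positions from \<open>q\<close> on, then the join has homology only in positions
  from \<open>p + q\<close> on.
\<close>

theorem exact_at_join:
  assumes dim1: "\<And>\<sigma>. \<sigma> \<in> \<Delta>1 \<Longrightarrow> card \<sigma> \<le> p"
    and exact1: "\<And>k. k < p \<Longrightarrow> exact_at ty enc \<Delta>1 k"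
    and exact2: "\<And>k. k < q \<Longrightarrow> exact_at ty enc \<Delta>2 k"
    and n: "n < p + q"
  shows "exact_at ty enc \<Delta> n"
  unfolding exact_at_def
proof (intro allI impI, elim conjE)
  fix c :: "'x set \<Rightarrow> 'k"
  assume c: "simplicial_chain \<Delta> n c" and cycle: "bd c = (\<lambda>_. 0)"
  have "\<exists>g. simplicial_chain \<Delta> (Suc n) g \<and> (\<forall>\<sigma>. c \<sigma> - bd g \<sigma> \<noteq> 0 \<longrightarrow> k \<le> card (\<sigma> - W))" if "k \<le> p" for k
    using that
  proof (induction k)
    case 0
    show ?case
      by (rule exI[of _ "\<lambda>_. 0"]) (simp add: simplicial_chain_def)
  next
    case (Suc k)
    then obtain g where g: "simplicial_chain \<Delta> (Suc n) g" "\<And>\<sigma>. c \<sigma> - bd g \<sigma> \<noteq> 0 \<Longrightarrow> k \<le> card (\<sigma> - W)"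
      by auto
    let ?c = "\<lambda>\<sigma>. c \<sigma> - bd g \<sigma>"
    have 1: "simplicial_chain \<Delta> n ?c"
      by (rule simplicial_chain_diff[OF c simplicial_chain_boundary[OF g(1) down]])
    have 2: "bd ?c \<tau> = 0" for \<tau>
      unfolding sboundary_diff sboundary_sboundary[OF enc(1)] by (simp add: cycle)
    have 3: "exact_at ty enc \<Delta>1 k"
      using Suc.prems by (intro exact1) simp
    obtain g' where g': "simplicial_chain \<Delta> (Suc n) g'" "\<forall>\<sigma>. ?c \<sigma> - bd g' \<sigma> \<noteq> 0 \<longrightarrow> Suc k \<le> card (\<sigma> - W)"
      by (rule push_up[OF 3 1 2 g(2)])
    have "\<forall>\<sigma>. c \<sigma> - bd (\<lambda>\<sigma>. g \<sigma> + g' \<sigma>) \<sigma> \<noteq> 0 \<longrightarrow> Suc k \<le> card (\<sigma> - W)"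
      using g'(2) unfolding sboundary_add by (simp add: algebra_simps)
    then show ?case
      using simplicial_chain_add[OF g(1) g'(1)] by blast
  qed
  from this[of p] obtain g where g: "simplicial_chain \<Delta> (Suc n) g" "\<And>\<sigma>. c \<sigma> - bd g \<sigma> \<noteq> 0 \<Longrightarrow> p \<le> card (\<sigma> - W)"
    by auto
  let ?c = "\<lambda>\<sigma>. c \<sigma> - bd g \<sigma>"
  have 1: "simplicial_chain \<Delta> n ?c"
    by (rule simplicial_chain_diff[OF c simplicial_chain_boundary[OF g(1) down]])
  have 2: "bd ?c \<tau> = 0" for \<tau>
    unfolding sboundary_diff sboundary_sboundary[OF enc(1)] by (simp add: cycle)
  show "\<exists>h. simplicial_chain \<Delta> (Suc n) h \<and> bd h = c"
  proof (cases "n < p")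
    case True
    have "?c \<sigma> = 0" for \<sigma>
    proof (rule ccontr)
      assume nz: "?c \<sigma> \<noteq> 0"
      then have "card \<sigma> = n"
        using 1 by (simp add: simplicial_chain_def)
      then show False
        using g(2)[OF nz] True card_split[of \<sigma>] by simp
    qed
    then have "bd g = c"
      by (auto simp: fun_eq_iff)
    then show ?thesis
      using g(1) by blast
  next
    case False
    define r where "r = n - p"
    have n_eq: "n = p + r" "r < q"
      using False n by (auto simp: r_def)
    obtain g' where g': "simplicial_chain \<Delta> (Suc (p + r)) g'" "bd g' = ?c"
      by (rule top_row[OF dim1 exact2[OF n_eq(2)] 1[unfolded n_eq(1)] 2 g(2)])
    have "bd (\<lambda>\<sigma>. g \<sigma> + g' \<sigma>) = c"
      by (rule ext) (simp add: sboundary_add g'(2))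
    then show ?thesis
      using simplicial_chain_add[OF g(1)] g'(1) n_eq(1) by blast
  qed
qed

end


section \<open>Intersections of monomial ideals in disjoint variables\<close>

text \<open>
  Membership can be tested on the exponents of the variables in \<open>Y\<close>: the ideal is extended from
  the polynomial ring in these variables.
\<close>

definition depends_on :: "('x \<Rightarrow>\<^sub>0 nat) set \<Rightarrow> 'x set \<Rightarrow> bool" where
  "depends_on U Y \<longleftrightarrow> (\<forall>u v. (\<forall>x\<in>Y. Poly_Mapping.lookup u x = Poly_Mapping.lookup v x) \<longrightarrow> (u \<in> U \<longleftrightarrow> v \<in> U))"

lemma depends_onD:
  "depends_on U Y \<Longrightarrow> (\<And>x. x \<in> Y \<Longrightarrow> Poly_Mapping.lookup u x = Poly_Mapping.lookup v x) \<Longrightarrow> u \<in> U \<longleftrightarrow> v \<in> U"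
  unfolding depends_on_def by blast

definition restrict_mono :: "'x set \<Rightarrow> ('x::finite \<Rightarrow>\<^sub>0 nat) \<Rightarrow> 'x \<Rightarrow>\<^sub>0 nat" where
  "restrict_mono Y b = Abs_poly_mapping (\<lambda>x. if x \<in> Y then Poly_Mapping.lookup b x else 0)"

lemma lookup_restrict_mono [simp]:
  "Poly_Mapping.lookup (restrict_mono Y b) x = (if x \<in> Y then Poly_Mapping.lookup b x else 0)"
  by (simp add: restrict_mono_def)

lemma restrict_mono_split: "b = restrict_mono (- W) b + restrict_mono W b"
  by (rule poly_mapping_eqI) (simp add: lookup_add)

lemma total_degree_split: "total_degree b = total_degree (restrict_mono (- W) b) + total_degree (restrict_mono W b)"
  using arg_cong[OF restrict_mono_split[of b W], of total_degree] by simp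

text \<open>
  The upper Koszul complex of an intersection in disjoint variables is the join of the two upper
  Koszul complexes.
\<close>

lemma koszul_complex_Int:
  assumes U1: "depends_on U1 (- W)" and U2: "depends_on U2 W"
  shows "koszul_complex (U1 \<inter> U2) b =
    {\<sigma>. \<sigma> - W \<in> koszul_complex U1 (restrict_mono (- W) b) \<and> \<sigma> \<inter> W \<in> koszul_complex U2 (restrict_mono W b)}"
proof (rule Set.set_eqI)
  fix \<sigma>
  have "indicator_mono \<sigma> \<preceq> b \<longleftrightarrow> indicator_mono (\<sigma> - W) \<preceq> restrict_mono (- W) b \<and> indicator_mono (\<sigma> \<inter> W) \<preceq> restrict_mono W b"
    by (auto simp: indicator_mono_dvd)
  moreover have "b - indicator_mono \<sigma> \<in> U1 \<longleftrightarrow> restrict_mono (- W) b - indicator_mono (\<sigma> - W) \<in> U1"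
    by (rule depends_onD[OF U1]) (simp add: lookup_minus)
  moreover have "b - indicator_mono \<sigma> \<in> U2 \<longleftrightarrow> restrict_mono W b - indicator_mono (\<sigma> \<inter> W) \<in> U2"
    by (rule depends_onD[OF U2]) (simp add: lookup_minus)
  ultimately show "\<sigma> \<in> koszul_complex (U1 \<inter> U2) b \<longleftrightarrow>
      \<sigma> \<in> {\<sigma>. \<sigma> - W \<in> koszul_complex U1 (restrict_mono (- W) b) \<and> \<sigma> \<inter> W \<in> koszul_complex U2 (restrict_mono W b)}"
    unfolding koszul_complex_def by auto
qed

lemma koszul_complex_subset: "\<sigma> \<in> koszul_complex U (restrict_mono Y b) \<Longrightarrow> \<sigma> \<subseteq> Y"
  unfolding koszul_complex_def indicator_mono_dvd by (auto split: if_splits)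

lemma koszul_complex_down:
  assumes U: "generated_in_degree d U" and \<sigma>: "\<sigma> \<in> koszul_complex U b" and sub: "\<tau> \<subseteq> \<sigma>"
  shows "\<tau> \<in> koszul_complex U b"
proof -
  have "b - indicator_mono \<sigma> \<preceq> b - indicator_mono \<tau>"
    using sub unfolding mono_dvd_def by (auto simp: lookup_minus)
  then have "b - indicator_mono \<tau> \<in> U"
    using generated_upward[OF U] \<sigma> unfolding koszul_complex_def by blast
  then show ?thesis
    using \<sigma> sub unfolding koszul_complex_def indicator_mono_dvd by blast
qed

lemma exact_at_cone:
  fixes ty :: "'k::field itself" and \<Delta> :: "'x::finite set set"
  assumes enc: "inj enc" and cone: "\<And>\<sigma>. \<sigma> \<in> \<Delta> \<Longrightarrow> insert x \<sigma> \<in> \<Delta>"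
  shows "exact_at ty enc \<Delta> n"
  unfolding exact_at_def
proof (intro allI impI, elim conjE)
  fix c :: "'x set \<Rightarrow> 'k"
  assume c: "simplicial_chain \<Delta> n c" and cycle: "sboundary enc UNIV c = (\<lambda>_. 0)"
  have "simplicial_chain \<Delta> (Suc n) (cone enc x c)"
    unfolding simplicial_chain_def
  proof (intro allI impI)
    fix \<sigma> assume "cone enc x c \<sigma> \<noteq> 0"
    then have x: "x \<in> \<sigma>" "c (\<sigma> - {x}) \<noteq> 0"
      unfolding cone_def by (simp_all split: if_splits)
    then have "\<sigma> - {x} \<in> \<Delta>" and n: "card (\<sigma> - {x}) = n"
      using c unfolding simplicial_chain_def by blast+
    then have "insert x (\<sigma> - {x}) \<in> \<Delta>"
      by (intro cone)
    moreover have "insert x (\<sigma> - {x}) = \<sigma>"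
      using x(1) by blast
    moreover have "card \<sigma> = Suc n"
      using card_Suc_Diff1[OF finite x(1)] n by simp
    ultimately show "\<sigma> \<in> \<Delta> \<and> card \<sigma> = Suc n"
      by simp
  qed
  moreover have "sboundary enc UNIV (cone enc x c) = c"
  proof
    fix \<tau>
    have "cone enc x (sboundary enc UNIV c) \<tau> = 0"
      unfolding cycle by (simp add: cone_def)
    then show "sboundary enc UNIV (cone enc x c) \<tau> = c \<tau>"
      using boundary_cone[of UNIV enc \<tau> x "\<lambda>_. 1" c] enc by simp
  qed
  ultimately show "\<exists>h. simplicial_chain \<Delta> (Suc n) h \<and> sboundary enc UNIV h = c"
    by blast
qed

text \<open>
  Multiply a multidegree \<open>b\<close> of the first ideal by a minimal generator \<open>u\<close> of the second one. The
  upper Koszul complex of \<open>u\<close> is the empty face, so the join is the upper Koszul complex of \<open>b\<close>.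
  If \<open>b\<close> involves a variable of the second ideal, then the complex is a cone over that variable
  and carries no homology anyway.
\<close>

lemma linear_at_factor:
  fixes ty :: "'k::field itself" and enc :: "'x::finite \<Rightarrow> nat"
  assumes enc: "inj enc" and U1: "depends_on U1 (- W)" and U2: "depends_on U2 W"
    and gen2: "generated_in_degree d2 U2" and lin: "linear_at ty enc (U1 \<inter> U2) (d1 + d2)"
  shows "linear_at ty enc U1 d1"
  unfolding linear_at_def
proof (intro allI impI)
  fix n and b :: "'x \<Rightarrow>\<^sub>0 nat"
  assume deg: "total_degree b \<noteq> n + d1"
  show "exact_at ty enc (koszul_complex U1 b) n"
  proof (cases "\<exists>x\<in>W. Poly_Mapping.lookup b x \<ge> 1")
    case True
    then obtain x where x: "x \<in> W" "Poly_Mapping.lookup b x \<ge> 1"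
      by blast
    show ?thesis
    proof (rule exact_at_cone[OF enc])
      fix \<sigma> assume \<sigma>: "\<sigma> \<in> koszul_complex U1 b"
      have "b - indicator_mono (insert x \<sigma>) \<in> U1 \<longleftrightarrow> b - indicator_mono \<sigma> \<in> U1"
        by (rule depends_onD[OF U1]) (use x(1) in \<open>auto simp: lookup_minus\<close>)
      then show "insert x \<sigma> \<in> koszul_complex U1 b"
        using \<sigma> x(2) by (simp add: koszul_complex_def indicator_mono_dvd)
    qed
  next
    case False
    obtain u0 where u0: "u0 \<in> U2" "total_degree u0 = d2"
      by (rule generated_obtain[OF gen2])
    define u where "u = restrict_mono W u0"
    have u: "u \<in> U2"
      using depends_onD[OF U2, of u u0] u0(1) by (simp add: u_def)
    have "total_degree u \<le> d2"
      using total_degree_split[of u0 W] u0(2) by (simp add: u_def)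
    then have du: "total_degree u = d2"
      using generated_degree_le[OF gen2 u] by simp
    have r: "restrict_mono (- W) (b + u) = b" "restrict_mono W (b + u) = u"
      using False by (auto intro!: poly_mapping_eqI simp: lookup_add u_def not_le)
    have "koszul_complex (U1 \<inter> U2) (b + u) = {\<sigma>. \<sigma> - W \<in> koszul_complex U1 b \<and> \<sigma> \<inter> W = {}}"
      unfolding koszul_complex_Int[OF U1 U2] r koszul_minimal[OF gen2 u du] by simp
    also have "\<dots> = koszul_complex U1 b"
    proof -
      have "\<sigma> \<subseteq> - W" if "\<sigma> \<in> koszul_complex U1 b" for \<sigma>
        using koszul_complex_subset[of \<sigma> U1 "- W" "b + u"] that by (simp add: r)
      then show ?thesis
        by (auto simp: Diff_triv)
          (metis Diff_triv inf.commute disjoint_eq_subset_Compl)+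
    qed
    finally have "koszul_complex (U1 \<inter> U2) (b + u) = koszul_complex U1 b" .
    moreover have "total_degree (b + u) \<noteq> n + (d1 + d2)"
      using deg du by simp
    ultimately show ?thesis
      using lin unfolding linear_at_def by metis
  qed
qed

text \<open>
  A face of an upper Koszul complex has at most as many elements as the degree of \<open>b\<close> exceeds that
  of the generators. So linearity says that homology occurs only in the largest possible position,
  and this property is inherited by joins.
\<close>

lemma linear_at_Int:
  fixes ty :: "'k::field itself" and enc :: "'x::finite \<Rightarrow> nat"
  assumes enc: "inj enc" "\<And>x y. x \<notin> W \<Longrightarrow> y \<in> W \<Longrightarrow> enc x < enc y"
    and U1: "depends_on U1 (- W)" and U2: "depends_on U2 W"
    and gen1: "generated_in_degree d1 U1" and gen2: "generated_in_degree d2 U2"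
    and lin1: "linear_at ty enc U1 d1" and lin2: "linear_at ty enc U2 d2"
  shows "linear_at ty enc (U1 \<inter> U2) (d1 + d2)"
  unfolding linear_at_def
proof (intro allI impI)
  fix n and b :: "'x \<Rightarrow>\<^sub>0 nat"
  assume deg: "total_degree b \<noteq> n + (d1 + d2)"
  let ?\<Delta>1 = "koszul_complex U1 (restrict_mono (- W) b)" and ?\<Delta>2 = "koszul_complex U2 (restrict_mono W b)"
  let ?b1 = "total_degree (restrict_mono (- W) b)" and ?b2 = "total_degree (restrict_mono W b)"
  note split = total_degree_split[of b W]
  have dim1: "card \<sigma> + d1 \<le> ?b1" if "\<sigma> \<in> ?\<Delta>1" for \<sigma>
    by (rule total_degree_koszul[OF gen1 that])
  have dim2: "card \<sigma> + d2 \<le> ?b2" if "\<sigma> \<in> ?\<Delta>2" for \<sigma>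
    by (rule total_degree_koszul[OF gen2 that])
  interpret join enc W ?\<Delta>1 ?\<Delta>2 ty
  proof
    show "\<sigma> \<subseteq> - W" if "\<sigma> \<in> ?\<Delta>1" for \<sigma>
      by (rule koszul_complex_subset[OF that])
    show "\<sigma> \<subseteq> W" if "\<sigma> \<in> ?\<Delta>2" for \<sigma>
      by (rule koszul_complex_subset[OF that])
    show "\<tau> \<in> ?\<Delta>1" if "\<sigma> \<in> ?\<Delta>1" "\<tau> \<subseteq> \<sigma>" for \<sigma> \<tau>
      by (rule koszul_complex_down[OF gen1 that])
    show "\<tau> \<in> ?\<Delta>2" if "\<sigma> \<in> ?\<Delta>2" "\<tau> \<subseteq> \<sigma>" for \<sigma> \<tau>
      by (rule koszul_complex_down[OF gen2 that])
  qed (use enc in auto)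
  show "exact_at ty enc (koszul_complex (U1 \<inter> U2) b) n"
    unfolding koszul_complex_Int[OF U1 U2]
  proof (cases "n + (d1 + d2) < total_degree b \<and> (\<exists>\<sigma>. \<sigma> \<in> \<Delta>)")
    case True
    then obtain \<sigma> where \<sigma>: "\<sigma> - W \<in> ?\<Delta>1" "\<sigma> \<inter> W \<in> ?\<Delta>2"
      by blast
    have le: "d1 \<le> ?b1" "d2 \<le> ?b2"
      using dim1[OF \<sigma>(1)] dim2[OF \<sigma>(2)] by simp_all
    show "exact_at ty enc \<Delta> n"
    proof (rule exact_at_join)
      show "card \<sigma> \<le> ?b1 - d1" if "\<sigma> \<in> ?\<Delta>1" for \<sigma>
        using dim1[OF that] by linarith
      show "exact_at ty enc ?\<Delta>1 k" if "k < ?b1 - d1" for k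
      proof -
        have "?b1 \<noteq> k + d1"
          using that by simp
        then show ?thesis
          using lin1 unfolding linear_at_def by blast
      qed
      show "exact_at ty enc ?\<Delta>2 k" if "k < ?b2 - d2" for k
      proof -
        have "?b2 \<noteq> k + d2"
          using that by simp
        then show ?thesis
          using lin2 unfolding linear_at_def by blast
      qed
      show "n < (?b1 - d1) + (?b2 - d2)"
        using conjunct1[OF True] le split by linarith
    qed
  next
    case False
    show "exact_at ty enc \<Delta> n"
    proof (rule exact_at_no_chains)
      fix \<sigma> assume \<sigma>: "\<sigma> \<in> \<Delta>"
      then have "\<sigma> - W \<in> ?\<Delta>1" "\<sigma> \<inter> W \<in> ?\<Delta>2"
        by simp_all
      then have "card (\<sigma> - W) + d1 \<le> ?b1" "card (\<sigma> \<inter> W) + d2 \<le> ?b2"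
        by (simp_all only: dim1 dim2)
      moreover have "\<exists>\<sigma>. \<sigma> \<in> \<Delta>"
        by (rule exI[of _ \<sigma>]) (rule \<sigma>)
      then have "\<not> n + (d1 + d2) < total_degree b"
        using False by argo
      ultimately show "card \<sigma> \<noteq> n"
        using card_split[of \<sigma>] deg split by linarith
    qed
  qed
qed

text \<open>
  The sign conventions for joins need an order of the variables in which the two groups are
  separated.
\<close>

lemma enc_separating:
  obtains enc :: "'x::finite \<Rightarrow> nat" where "inj enc" "\<And>x y. x \<notin> W \<Longrightarrow> y \<in> W \<Longrightarrow> enc x < enc y"
proof -
  obtain e :: "'x \<Rightarrow> nat" where e: "inj e"
    using finite_imp_inj_to_nat_seg[of "UNIV :: 'x set"] by auto
  define m where "m = Suc (Max (range e))"
  have lt: "e x < m" for x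
    unfolding m_def by (simp add: le_imp_less_Suc)
  show ?thesis
  proof
    show "inj (\<lambda>x. if x \<in> W then e x + m else e x)"
    proof (rule injI)
      fix x y assume "(if x \<in> W then e x + m else e x) = (if y \<in> W then e y + m else e y)"
      then have "e x = e y"
        using lt[of x] lt[of y] by (auto split: if_splits)
      then show "x = y"
        using e by (simp add: inj_eq)
    qed
    show "(if x \<in> W then e x + m else e x) < (if y \<in> W then e y + m else e y)" if "x \<notin> W" "y \<in> W" for x y
      using that lt[of x] by simp
  qed
qed

lemma generated_in_degree_Int:
  fixes U1 U2 :: "('x::finite \<Rightarrow>\<^sub>0 nat) set"
  assumes U1: "depends_on U1 (- W)" "generated_in_degree d1 U1" and U2: "depends_on U2 W" "generated_in_degree d2 U2"
  shows "generated_in_degree (d1 + d2) (U1 \<inter> U2)"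
proof -
  obtain S1 where S1: "finite S1" "S1 \<noteq> {}" "U1 = upset S1" "\<forall>s\<in>S1. total_degree s = d1"
    using U1(2) unfolding generated_in_degree_def by blast
  obtain S2 where S2: "finite S2" "S2 \<noteq> {}" "U2 = upset S2" "\<forall>s\<in>S2. total_degree s = d2"
    using U2(2) unfolding generated_in_degree_def by blast
  let ?S = "(\<lambda>(s1, s2). restrict_mono (- W) s1 + restrict_mono W s2) ` (S1 \<times> S2)"
  have in1: "restrict_mono (- W) s \<in> U1" "total_degree (restrict_mono (- W) s) = d1" if "s \<in> S1" for s
  proof -
    have "s \<in> U1"
      using that S1(3) unfolding upset_def using mono_dvd_refl by blast
    then show *: "restrict_mono (- W) s \<in> U1"
      using depends_onD[OF U1(1), of "restrict_mono (- W) s" s] by simp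
    have "total_degree (restrict_mono (- W) s) \<le> d1"
      using total_degree_split[of s W] S1(4) that by auto
    then show "total_degree (restrict_mono (- W) s) = d1"
      using generated_degree_le[OF U1(2) *] by simp
  qed
  have in2: "restrict_mono W s \<in> U2" "total_degree (restrict_mono W s) = d2" if "s \<in> S2" for s
  proof -
    have "s \<in> U2"
      using that S2(3) unfolding upset_def using mono_dvd_refl by blast
    then show *: "restrict_mono W s \<in> U2"
      using depends_onD[OF U2(1), of "restrict_mono W s" s] by simp
    have "total_degree (restrict_mono W s) \<le> d2"
      using total_degree_split[of s W] S2(4) that by auto
    then show "total_degree (restrict_mono W s) = d2"
      using generated_degree_le[OF U2(2) *] by simp
  qed
  have "U1 \<inter> U2 = upset ?S"
  proof (intro equalityI subsetI)
    fix u assume "u \<in> U1 \<inter> U2"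
    then obtain s1 s2 where s: "s1 \<in> S1" "s1 \<preceq> u" "s2 \<in> S2" "s2 \<preceq> u"
      unfolding S1(3) S2(3) upset_def by blast
    have "restrict_mono (- W) s1 + restrict_mono W s2 \<preceq> u"
      using s(2,4) by (auto simp: mono_dvd_def lookup_add)
    then show "u \<in> upset ?S"
      unfolding upset_def using s(1,3) by force
  next
    fix u assume "u \<in> upset ?S"
    then obtain s1 s2 where s: "s1 \<in> S1" "s2 \<in> S2" "restrict_mono (- W) s1 + restrict_mono W s2 \<preceq> u"
      unfolding upset_def by auto
    have "restrict_mono (- W) s1 \<preceq> u" "restrict_mono W s2 \<preceq> u"
      by (rule mono_dvd_trans[OF _ s(3)], simp)+
    then show "u \<in> U1 \<inter> U2"
      using generated_upward[OF U1(2) in1(1)[OF s(1)]] generated_upward[OF U2(2) in2(1)[OF s(2)]] by blast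
  qed
  moreover have "\<forall>s\<in>?S. total_degree s = d1 + d2"
    using in1(2) in2(2) by auto
  moreover have "finite ?S" "?S \<noteq> {}"
    using S1 S2 by auto
  ultimately show ?thesis
    unfolding generated_in_degree_def by blast
qed

theorem has_linear_resolution_Int:
  fixes U1 U2 :: "('x::finite \<Rightarrow>\<^sub>0 nat) set"
  assumes U1: "depends_on U1 (- W)" "generated_in_degree d1 U1" "d1 \<ge> 1"
    and U2: "depends_on U2 W" "generated_in_degree d2 U2" "d2 \<ge> 1"
  shows "has_linear_resolution (monomial_ideal (U1 \<inter> U2) :: ('x, 'k::field) mpoly set) \<longleftrightarrow>
    has_linear_resolution (monomial_ideal U1 :: ('x, 'k) mpoly set) \<and>
    has_linear_resolution (monomial_ideal U2 :: ('x, 'k) mpoly set)"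
proof -
  obtain enc :: "'x \<Rightarrow> nat" where enc: "inj enc" "\<And>x y. x \<notin> W \<Longrightarrow> y \<in> W \<Longrightarrow> enc x < enc y"
    using enc_separating[of W] by metis
  have gen: "generated_in_degree (d1 + d2) (U1 \<inter> U2)"
    by (rule generated_in_degree_Int[OF U1(1,2) U2(1,2)])
  have iff: "has_linear_resolution (monomial_ideal U :: ('x, 'k) mpoly set) \<longleftrightarrow> linear_at TYPE('k) enc U d"
    if "generated_in_degree d U" "d \<ge> 1" for U d
    by (rule has_linear_resolution_iff[OF that enc(1)])
  have W: "depends_on U1 (- W)" "depends_on U2 (- (- W))"
    using U1(1) U2(1) by simp_all
  have lin1: "linear_at TYPE('k) enc U1 d1" if "linear_at TYPE('k) enc (U1 \<inter> U2) (d1 + d2)"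
    by (rule linear_at_factor[OF enc(1) U1(1) U2(1) U2(2) that])
  have lin2: "linear_at TYPE('k) enc U2 d2" if "linear_at TYPE('k) enc (U1 \<inter> U2) (d1 + d2)"
    using linear_at_factor[OF enc(1) W(2) W(1) U1(2), of "TYPE('k)" d2] that by (simp add: Int_commute add.commute)
  have lin: "linear_at TYPE('k) enc (U1 \<inter> U2) (d1 + d2)" if "linear_at TYPE('k) enc U1 d1" "linear_at TYPE('k) enc U2 d2"
    by (rule linear_at_Int[OF enc U1(1) U2(1) U1(2) U2(2) that])
  have d: "1 \<le> d1 + d2"
    using U1(3) by simp
  show ?thesis
    unfolding iff[OF U1(2,3)] iff[OF U2(2,3)] iff[OF gen d] using lin1 lin2 lin by blast
qed


section \<open>Monomial primes and Krull dimension\<close>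

interpretation poly_ring: cring "poly_ring :: ('x, 'k::field) mpoly ring"
  by (rule cring_from_type_algebra)

lemma poly_ring_simps [simp]:
  "carrier (poly_ring :: ('x, 'k::field) mpoly ring) = UNIV"
  "monoid.mult (poly_ring :: ('x, 'k) mpoly ring) = (\<lambda>f g. f * g)"
  "one (poly_ring :: ('x, 'k) mpoly ring) = 1"
  "ring.zero (poly_ring :: ('x, 'k) mpoly ring) = 0"
  "add (poly_ring :: ('x, 'k) mpoly ring) = (\<lambda>f g. f + g)"
  by (simp_all add: ring_of_type_algebra_def)

lemma poly_ring_uminus [simp]: "a_inv (poly_ring :: ('x, 'k::field) mpoly ring) f = - f"
  by (rule poly_ring.minus_equality) simp_all

lemma poly_ring_minus [simp]: "a_minus (poly_ring :: ('x, 'k::field) mpoly ring) f g = f - g"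
  by (simp add: a_minus_def)

text \<open>Ideals of the polynomial ring in terms of the arithmetic of the type of polynomials.\<close>

lemma ideal_poly_ring_iff:
  fixes J :: "('x, 'k::field) mpoly set"
  shows "ideal J poly_ring \<longleftrightarrow> 0 \<in> J \<and> (\<forall>f\<in>J. \<forall>g\<in>J. f + g \<in> J) \<and> (\<forall>f\<in>J. \<forall>g. g * f \<in> J)"
proof
  assume "ideal J poly_ring"
  then interpret ideal J poly_ring .
  show "0 \<in> J \<and> (\<forall>f\<in>J. \<forall>g\<in>J. f + g \<in> J) \<and> (\<forall>f\<in>J. \<forall>g. g * f \<in> J)"
    using zero_closed a_closed I_l_closed by simp
next
  assume *: "0 \<in> J \<and> (\<forall>f\<in>J. \<forall>g\<in>J. f + g \<in> J) \<and> (\<forall>f\<in>J. \<forall>g. g * f \<in> J)"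
  have um: "- f \<in> J" if "f \<in> J" for f
  proof -
    have "(- 1) * f \<in> J"
      using * that by blast
    then show ?thesis
      by simp
  qed
  show "ideal J poly_ring"
  proof (rule idealI)
    show "ring (poly_ring :: ('x, 'k) mpoly ring)"
      by (rule poly_ring.ring_axioms)
    show "subgroup J (add_monoid poly_ring)"
      using * um by (intro poly_ring.add.subgroupI) (auto simp: a_inv_def[symmetric])
  qed (use * in \<open>auto simp: mult.commute\<close>)
qed

lemma ideal_diff:
  fixes J :: "('x, 'k::field) mpoly set"
  assumes "ideal J poly_ring" "f \<in> J" "g \<in> J"
  shows "f - g \<in> J"
proof -
  have "(- 1) * g \<in> J"
    using assms unfolding ideal_poly_ring_iff by blast
  then have "f + (- 1) * g \<in> J"
    using assms unfolding ideal_poly_ring_iff by blast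
  then show ?thesis
    by simp
qed

lemma ideal_sum:
  fixes J :: "('x, 'k::field) mpoly set"
  assumes "ideal J poly_ring" "\<And>a. a \<in> A \<Longrightarrow> f a \<in> J"
  shows "(\<Sum>a\<in>A. f a) \<in> J"
  using assms(2)
proof (induction A rule: infinite_finite_induct)
  case (insert a A)
  then show ?case
    using assms(1) unfolding ideal_poly_ring_iff by simp
qed (use assms(1) in \<open>auto simp: ideal_poly_ring_iff\<close>)

lemma ideal_monomial_ideal:
  fixes U :: "('x \<Rightarrow>\<^sub>0 nat) set"
  assumes "\<And>u v. u \<in> U \<Longrightarrow> u \<preceq> v \<Longrightarrow> v \<in> U"
  shows "ideal (monomial_ideal U :: ('x, 'k::field) mpoly set) poly_ring"
  unfolding ideal_poly_ring_iff monomial_ideal_def mem_Collect_eq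
proof (intro conjI ballI allI)
  fix f g :: "('x, 'k) mpoly" assume f: "f \<in> {f. Poly_Mapping.keys f \<subseteq> U}"
  show "Poly_Mapping.keys (g * f) \<subseteq> U"
  proof
    fix w assume "w \<in> Poly_Mapping.keys (g * f)"
    then obtain u v where "w = u + v" "v \<in> Poly_Mapping.keys f"
      using keys_mult[of g f] by auto
    then show "w \<in> U"
      using f assms[of v w] by auto
  qed
  assume "g \<in> {f. Poly_Mapping.keys f \<subseteq> U}"
  then show "Poly_Mapping.keys (f + g) \<subseteq> U"
    using f keys_add[of f g] by auto
qed simp

lemma upset_upward: "u \<in> upset S \<Longrightarrow> u \<preceq> v \<Longrightarrow> v \<in> upset S"
  unfolding upset_def using mono_dvd_trans by blast

lemma upset_base: "s \<in> S \<Longrightarrow> s \<in> upset S"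
  unfolding upset_def by (rule CollectI, rule bexI[of _ s]) simp_all

text \<open>
  An ideal generated by monomials contains exactly the polynomials all of whose monomials are
  divisible by a generator.
\<close>

lemma Idl_monomials:
  fixes S :: "('x \<Rightarrow>\<^sub>0 nat) set"
  shows "Idl\<^bsub>poly_ring\<^esub> ((\<lambda>s. Poly_Mapping.single s 1) ` S) = (monomial_ideal (upset S) :: ('x, 'k::field) mpoly set)"
    (is "Idl\<^bsub>poly_ring\<^esub> ?G = _")
proof
  have "?G \<subseteq> (monomial_ideal (upset S) :: ('x, 'k) mpoly set)"
    using upset_base[of _ S] by (auto simp: monomial_ideal_def)
  moreover have "ideal (monomial_ideal (upset S) :: ('x, 'k) mpoly set) poly_ring"
    by (rule ideal_monomial_ideal) (rule upset_upward)
  ultimately show "Idl\<^bsub>poly_ring\<^esub> ?G \<subseteq> (monomial_ideal (upset S) :: ('x, 'k) mpoly set)"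
    by (intro poly_ring.genideal_minimal)
  have G: "ideal (Idl\<^bsub>poly_ring\<^esub> ?G) (poly_ring :: ('x, 'k) mpoly ring)" "?G \<subseteq> Idl\<^bsub>poly_ring\<^esub> ?G"
    using poly_ring.genideal_ideal[of ?G] poly_ring.genideal_self[of ?G] by simp_all
  show "(monomial_ideal (upset S) :: ('x, 'k) mpoly set) \<subseteq> Idl\<^bsub>poly_ring\<^esub> ?G"
  proof
    fix f :: "('x, 'k) mpoly" assume f: "f \<in> monomial_ideal (upset S)"
    have "f = (\<Sum>u\<in>Poly_Mapping.keys f. Poly_Mapping.single u (Poly_Mapping.lookup f u))"
      by (rule poly_mapping_eqI) (simp add: lookup_sum lookup_single when_def in_keys_iff)
    also have "\<dots> \<in> Idl\<^bsub>poly_ring\<^esub> ?G"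
    proof (rule ideal_sum[OF G(1)])
      fix u assume "u \<in> Poly_Mapping.keys f"
      then have "u \<in> upset S"
        using f by (auto simp: monomial_ideal_def)
      then obtain s where s: "s \<in> S" "s \<preceq> u"
        unfolding upset_def by (elim CollectE bexE)
      have "Poly_Mapping.single s 1 \<in> Idl\<^bsub>poly_ring\<^esub> ?G"
        using s(1) G(2) by blast
      then have "Poly_Mapping.single (u - s) (Poly_Mapping.lookup f u) * Poly_Mapping.single s 1 \<in> Idl\<^bsub>poly_ring\<^esub> ?G"
        using G(1) unfolding ideal_poly_ring_iff by blast
      then show "Poly_Mapping.single u (Poly_Mapping.lookup f u) \<in> Idl\<^bsub>poly_ring\<^esub> ?G"
        by (simp add: mult_single mono_diff_add[OF s(2)])
    qed
    finally show "f \<in> Idl\<^bsub>poly_ring\<^esub> ?G" .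
  qed
qed

definition monomial_prime :: "'x set \<Rightarrow> ('x, 'k::field) mpoly set" where
  "monomial_prime Y = monomial_ideal {u. \<exists>y\<in>Y. 1 \<le> Poly_Mapping.lookup u y}"

lemma ideal_monomial_prime: "ideal (monomial_prime Y :: ('x, 'k::field) mpoly set) poly_ring"
  unfolding monomial_prime_def
proof (rule ideal_monomial_ideal)
  fix u v :: "'x \<Rightarrow>\<^sub>0 nat"
  assume "u \<in> {u. \<exists>y\<in>Y. 1 \<le> Poly_Mapping.lookup u y}" "u \<preceq> v"
  then show "v \<in> {u. \<exists>y\<in>Y. 1 \<le> Poly_Mapping.lookup u y}"
    unfolding mono_dvd_def mem_Collect_eq by (meson order_trans)
qed

lemma one_notin_monomial_prime: "1 \<notin> (monomial_prime Y :: ('x, 'k::field) mpoly set)"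
  by (simp add: monomial_prime_def monomial_ideal_def)

text \<open>
  An injective homomorphism into exponent vectors over the naturals, which carry a linear order
  that is compatible with addition; the variables themselves need not be ordered.
\<close>

definition rename_nat :: "('x::finite \<Rightarrow> nat) \<Rightarrow> ('x \<Rightarrow>\<^sub>0 nat) \<Rightarrow> nat \<Rightarrow>\<^sub>0 nat" where
  "rename_nat enc u = (\<Sum>x\<in>UNIV. Poly_Mapping.single (enc x) (Poly_Mapping.lookup u x))"

lemma rename_nat_add: "rename_nat enc (u + v) = rename_nat enc u + rename_nat enc v"
  by (simp add: rename_nat_def lookup_add single_add sum.distrib)

lemma rename_nat_inj:
  assumes "inj enc" "rename_nat enc u = rename_nat enc v"
  shows "u = v"
proof (rule poly_mapping_eqI)
  fix x
  have "Poly_Mapping.lookup (rename_nat enc w) (enc x) = Poly_Mapping.lookup w x" for w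
    using assms(1) by (simp add: rename_nat_def lookup_sum lookup_single when_def inj_eq)
  then show "Poly_Mapping.lookup u x = Poly_Mapping.lookup v x"
    using assms(2) by metis
qed

lemma obtain_leading:
  fixes A :: "('x::finite \<Rightarrow>\<^sub>0 nat) set"
  assumes "finite A" "A \<noteq> {}"
  obtains u where "u \<in> A" "\<And>v. v \<in> A \<Longrightarrow> rename_nat enc v \<le> rename_nat enc u"
proof -
  have "Max (rename_nat enc ` A) \<in> rename_nat enc ` A"
    using assms by (intro Max_in) auto
  then obtain u where "u \<in> A" "rename_nat enc u = Max (rename_nat enc ` A)"
    by (elim imageE) simp
  then show ?thesis
    using assms(1) by (intro that[of u]) auto
qed

text \<open>
  Among the monomials that avoid \<open>Y\<close>, the product of the leading ones of the two factors arises in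
  only one way, so it survives in the product.
\<close>

lemma monomial_prime_mult:
  fixes f g :: "('x::finite, 'k::field) mpoly"
  assumes "f \<notin> monomial_prime Y" "g \<notin> monomial_prime Y"
  shows "f * g \<notin> monomial_prime Y"
proof -
  obtain enc :: "'x \<Rightarrow> nat" where enc: "inj enc"
    using enc_separating[of "{}"] by metis
  define P where "P = {u :: 'x \<Rightarrow>\<^sub>0 nat. \<forall>y\<in>Y. Poly_Mapping.lookup u y = 0}"
  have P_iff: "h \<notin> monomial_prime Y \<longleftrightarrow> Poly_Mapping.keys h \<inter> P \<noteq> {}" for h :: "('x, 'k) mpoly"
    by (auto simp: monomial_prime_def monomial_ideal_def P_def not_le subset_iff)
  have P_add: "l + q \<in> P \<longleftrightarrow> l \<in> P \<and> q \<in> P" for l q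
    by (auto simp: P_def lookup_add)
  obtain u where u: "u \<in> Poly_Mapping.keys f \<inter> P" "\<And>l. l \<in> Poly_Mapping.keys f \<inter> P \<Longrightarrow> rename_nat enc l \<le> rename_nat enc u"
    using obtain_leading[of "Poly_Mapping.keys f \<inter> P" enc] assms(1) P_iff by (metis finite_Int finite_keys)
  obtain v where v: "v \<in> Poly_Mapping.keys g \<inter> P" "\<And>l. l \<in> Poly_Mapping.keys g \<inter> P \<Longrightarrow> rename_nat enc l \<le> rename_nat enc v"
    using obtain_leading[of "Poly_Mapping.keys g \<inter> P" enc] assms(2) P_iff by (metis finite_Int finite_keys)
  have uv: "u + v \<in> P"
    using u(1) v(1) P_add by simp
  have uniq: "l = u \<and> q = v" if "l \<in> Poly_Mapping.keys f" "q \<in> Poly_Mapping.keys g" "u + v = l + q" for l q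
  proof -
    have "l + q \<in> P"
      using uv that(3) by simp
    then have lq: "l \<in> P" "q \<in> P"
      using P_add by simp_all
    have le: "rename_nat enc l \<le> rename_nat enc u" "rename_nat enc q \<le> rename_nat enc v"
      using u(2)[of l] v(2)[of q] that lq by simp_all
    have eq: "rename_nat enc u + rename_nat enc v = rename_nat enc l + rename_nat enc q"
      using arg_cong[OF that(3), of "rename_nat enc"] by (simp only: rename_nat_add)
    have "rename_nat enc l = rename_nat enc u"
    proof (rule ccontr)
      assume "rename_nat enc l \<noteq> rename_nat enc u"
      then have "rename_nat enc l < rename_nat enc u"
        using le(1) by simp
      from add_less_le_mono[OF this le(2)] show False
        using eq by simp
    qed
    then have "l = u"
      by (rule rename_nat_inj[OF enc])
    then show ?thesis
      using that(3) by simp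
  qed
  have "Poly_Mapping.lookup (f * g) (u + v) =
      (\<Sum>l. Poly_Mapping.lookup f l * (\<Sum>q. Poly_Mapping.lookup g q when u + v = l + q))"
    by (simp add: lookup_mult)
  also have "\<dots> = (\<Sum>l. (Poly_Mapping.lookup f u * Poly_Mapping.lookup g v) when l = u)"
  proof (rule Sum_any.cong)
    fix l
    show "Poly_Mapping.lookup f l * (\<Sum>q. Poly_Mapping.lookup g q when u + v = l + q) =
        ((Poly_Mapping.lookup f u * Poly_Mapping.lookup g v) when l = u)"
    proof (cases "l = u")
      case True
      have "(\<Sum>q. Poly_Mapping.lookup g q when u + v = u + q) = (\<Sum>q. Poly_Mapping.lookup g q when q = v)"
        by (rule Sum_any.cong) (auto simp: when_def)
      then show ?thesis
        using True by simp
    next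
      case False
      have "Poly_Mapping.lookup f l = 0 \<or> (\<forall>q. (Poly_Mapping.lookup g q when u + v = l + q) = 0)"
        using uniq[of l] False by (auto simp: in_keys_iff when_def)
      then show ?thesis
        using False by auto
    qed
  qed
  also have "\<dots> = Poly_Mapping.lookup f u * Poly_Mapping.lookup g v"
    by simp
  also have "\<dots> \<noteq> 0"
    using u(1) v(1) by (simp add: in_keys_iff)
  finally have "u + v \<in> Poly_Mapping.keys (f * g)"
    by (simp add: in_keys_iff)
  then show ?thesis
    unfolding P_iff using uv by blast
qed

locale poly_quotient =
  fixes I :: "('x::finite, 'k::field) mpoly set"
  assumes ideal_I: "ideal I poly_ring"
begin

abbreviation Q :: "('x, 'k) mpoly set ring" where "Q \<equiv> poly_ring Quot I"

abbreviation cls :: "('x, 'k) mpoly \<Rightarrow> ('x, 'k) mpoly set" where "cls f \<equiv> I +>\<^bsub>poly_ring\<^esub> f"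

lemma cls_eq_iff: "cls f = cls g \<longleftrightarrow> f - g \<in> I"
  using poly_ring.quotient_eq_iff_same_a_r_cos[OF ideal_I, of f g] by simp

lemma carrier_Q: "carrier Q = range cls"
  unfolding FactRing_def by (auto simp: A_RCOSETS_def')

lemma cls_mult: "cls f \<otimes>\<^bsub>Q\<^esub> cls g = cls (f * g)"
  using ring_hom_mult[OF ideal.rcos_ring_hom[OF ideal_I], of f g] by simp

lemma cring_Q: "cring Q"
  by (rule ideal.quotient_is_cring[OF ideal_I poly_ring.is_cring])

lemma ideal_image: "ideal J poly_ring \<Longrightarrow> ideal (cls ` J) Q"
  by (rule poly_ring.ring_ideal_imp_quot_ideal[OF ideal_I])

lemma ideal_preimage:
  assumes "ideal K Q"
  shows "ideal {f. cls f \<in> K} poly_ring"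
  using ring_hom_ring.ideal_vimage[OF ideal.rcos_ring_hom_ring[OF ideal_I] assms] by simp

lemma cls_image_iff:
  assumes "ideal J poly_ring" "I \<subseteq> J"
  shows "cls f \<in> cls ` J \<longleftrightarrow> f \<in> J"
proof
  assume "cls f \<in> cls ` J"
  then obtain g where "g \<in> J" "f - g \<in> I"
    by (auto simp: cls_eq_iff)
  then have "g + (f - g) \<in> J"
    using assms unfolding ideal_poly_ring_iff by blast
  then show "f \<in> J"
    by simp
qed simp

lemma primeideal_image:
  assumes sub: "I \<subseteq> monomial_prime Y"
  shows "primeideal (cls ` monomial_prime Y) Q"
proof (rule primeidealI)
  note iff = cls_image_iff[OF ideal_monomial_prime sub]
  show "ideal (cls ` monomial_prime Y) Q"
    by (rule ideal_image[OF ideal_monomial_prime])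
  show "cring Q"
    by (rule cring_Q)
  have "cls 1 \<notin> cls ` monomial_prime Y"
    using one_notin_monomial_prime iff by blast
  then show "carrier Q \<noteq> cls ` monomial_prime Y"
    unfolding carrier_Q by blast
  fix a b assume "a \<in> carrier Q" "b \<in> carrier Q" and ab: "a \<otimes>\<^bsub>Q\<^esub> b \<in> cls ` monomial_prime Y"
  then obtain f g where fg: "a = cls f" "b = cls g"
    unfolding carrier_Q by blast
  then have "f * g \<in> monomial_prime Y"
    using ab iff by (simp add: cls_mult)
  then show "a \<in> cls ` monomial_prime Y \<or> b \<in> cls ` monomial_prime Y"
    using monomial_prime_mult unfolding fg iff by blast
qed

text \<open>Starting from the prime generated by \<open>Y\<close>, adjoin the remaining variables one after the other.\<close>

lemma krull_dim_ge:
  assumes sub: "I \<subseteq> monomial_prime Y"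
  shows "krull_dim Q \<ge> enat (card (UNIV :: 'x set) - card Y)"
proof -
  obtain xs where xs: "set xs = - Y" "distinct xs"
    using finite_distinct_list[of "- Y"] by auto
  define n where "n = length xs"
  have n: "n = card (UNIV :: 'x set) - card Y"
    using distinct_card[OF xs(2)] xs(1) by (simp add: n_def Compl_eq_Diff_UNIV card_Diff_subset)
  define Z where "Z i = Y \<union> set (take i xs)" for i
  define P where "P i = cls ` (monomial_prime (Z i) :: ('x, 'k) mpoly set)" for i
  have mono: "monomial_prime V \<subseteq> (monomial_prime W :: ('x, 'k) mpoly set)" if "V \<subseteq> W" for V W
    using that unfolding monomial_prime_def monomial_ideal_def by blast
  have sub_Z: "I \<subseteq> monomial_prime (Z i)" for i
    using sub mono[of Y "Z i"] by (auto simp: Z_def)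
  have prime: "primeideal (P i) Q" for i
    unfolding P_def by (rule primeideal_image[OF sub_Z])
  have strict: "P i \<subset> P (Suc i)" if i: "i < n" for i
  proof -
    have ZS: "Z (Suc i) = insert (xs ! i) (Z i)"
      using i by (simp add: Z_def n_def take_Suc_conv_app_nth)
    have notin: "xs ! i \<notin> Z i"
    proof -
      have "xs ! i \<in> set xs"
        using i by (simp add: n_def)
      moreover have "xs ! i \<notin> set (take i xs)"
        using i xs(2) by (auto simp: n_def in_set_conv_nth nth_eq_iff_index_eq)
      ultimately show ?thesis
        using xs(1) by (auto simp: Z_def)
    qed
    have "var (xs ! i) \<in> (monomial_prime (Z (Suc i)) :: ('x, 'k) mpoly set)"
      by (simp add: monomial_prime_def monomial_ideal_def var_def ZS)
    moreover have "var (xs ! i) \<notin> (monomial_prime (Z i) :: ('x, 'k) mpoly set)"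
      using notin by (auto simp: monomial_prime_def monomial_ideal_def var_def lookup_single when_def)
    ultimately have "cls (var (xs ! i)) \<in> P (Suc i)" "cls (var (xs ! i)) \<notin> P i"
      unfolding P_def using cls_image_iff[OF ideal_monomial_prime sub_Z] by blast+
    moreover have "P i \<subseteq> P (Suc i)"
      unfolding P_def by (intro image_mono mono) (auto simp: ZS)
    ultimately show ?thesis
      by blast
  qed
  show ?thesis
    unfolding krull_dim_def n[symmetric]
    by (rule Sup_upper) (use prime strict in blast)
qed

end


section \<open>Depth and the Koszul complex\<close>

lemma graded_maximal_ideal_decompose:
  fixes f :: "('x::finite, 'k::field) mpoly"
  assumes "f \<in> graded_maximal_ideal"
  obtains a where "f = (\<Sum>x\<in>UNIV. var x * a x)"
proof -
  let ?J = "{f. \<exists>a. f = (\<Sum>x\<in>UNIV. var x * a x)} :: ('x, 'k) mpoly set"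
  have "ideal ?J poly_ring"
    unfolding ideal_poly_ring_iff
  proof (intro conjI ballI allI)
    show "0 \<in> ?J"
      by (auto intro: exI[of _ "\<lambda>_. 0"])
    fix f g :: "('x, 'k) mpoly" assume "f \<in> ?J"
    then obtain a where a: "f = (\<Sum>x\<in>UNIV. var x * a x)"
      by blast
    have "g * f = (\<Sum>x\<in>UNIV. var x * (g * a x))"
      by (simp add: a sum_distrib_left mult_ac)
    then show "g * f \<in> ?J"
      by (intro CollectI exI[of _ "\<lambda>x. g * a x"])
    assume "g \<in> ?J"
    then obtain b where b: "g = (\<Sum>x\<in>UNIV. var x * b x)"
      by blast
    have "f + g = (\<Sum>x\<in>UNIV. var x * (a x + b x))"
      by (simp add: a b sum.distrib distrib_left)
    then show "f + g \<in> ?J"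
      by (intro CollectI exI[of _ "\<lambda>x. a x + b x"])
  qed
  moreover have "range var \<subseteq> ?J"
  proof
    fix g :: "('x, 'k) mpoly" assume "g \<in> range var"
    then obtain y where "g = var y"
      by blast
    then have "g = (\<Sum>x\<in>UNIV. var x * (if x = y then 1 else 0))"
      by (simp add: if_distrib cong: if_cong)
    then show "g \<in> ?J"
      by (intro CollectI exI[of _ "\<lambda>x. if x = y then 1 else 0"])
  qed
  ultimately have "graded_maximal_ideal \<subseteq> ?J"
    unfolding graded_maximal_ideal_def by (rule poly_ring.genideal_minimal)
  then show ?thesis
    using assms that by blast
qed

context koszul
begin

text \<open>
  The Koszul homology of the residue ring modulo \<open>J\<close> does not vanish in position \<open>h\<close>. Chains are
  represented by polynomials, and all equations hold modulo \<open>J\<close>.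
\<close>

definition koszul_nonzero :: "nat \<Rightarrow> ('x, 'k::field) mpoly set \<Rightarrow> bool" where
  "koszul_nonzero h J \<longleftrightarrow> (\<exists>z. (\<forall>\<sigma>. card \<sigma> \<noteq> h \<longrightarrow> z \<sigma> = 0) \<and> (\<forall>\<tau>. koszul_d z \<tau> \<in> J) \<and>
     \<not> (\<exists>v. (\<forall>\<sigma>. card \<sigma> \<noteq> Suc h \<longrightarrow> v \<sigma> = 0) \<and> (\<forall>\<tau>. z \<tau> - koszul_d v \<tau> \<in> J)))"

lemma koszul_nonzero_le:
  assumes J: "ideal J poly_ring" and nz: "koszul_nonzero h J"
  shows "h \<le> card (UNIV :: 'x set)"
proof (rule ccontr)
  assume "\<not> h \<le> card (UNIV :: 'x set)"
  then have "card \<sigma> \<noteq> h" for \<sigma> :: "'x set"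
    using card_mono[of UNIV \<sigma>] by auto
  moreover obtain z where z: "\<forall>\<sigma>. card \<sigma> \<noteq> h \<longrightarrow> z \<sigma> = 0"
      "\<not> (\<exists>v. (\<forall>\<sigma>. card \<sigma> \<noteq> Suc h \<longrightarrow> v \<sigma> = 0) \<and> (\<forall>\<tau>. z \<tau> - koszul_d v \<tau> \<in> J))"
    using nz unfolding koszul_nonzero_def by blast
  ultimately have "z \<tau> - koszul_d (\<lambda>_. 0) \<tau> = 0" for \<tau>
    by (simp add: boundary_def)
  then have "\<forall>\<tau>. z \<tau> - koszul_d (\<lambda>_. 0) \<tau> \<in> J"
    using J unfolding ideal_poly_ring_iff by simp
  then show False
    using z(2) by auto
qed

text \<open>
  Let \<open>z\<close> be a nonbounding cycle modulo \<open>J\<close>. As \<open>f\<close> lies in the maximal ideal, \<open>f z\<close> is the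
  boundary of some \<open>w\<close> modulo \<open>J\<close>, so \<open>w\<close> is a cycle modulo \<open>J' = J + (f)\<close>. If \<open>w\<close> were the
  boundary of \<open>v\<close> modulo \<open>J'\<close>, say up to \<open>f u\<close> modulo \<open>J\<close>, then \<open>f z\<close> would be \<open>f\<close> times the
  boundary of \<open>u\<close>; cancelling the nonzerodivisor \<open>f\<close> shows that \<open>z\<close> bounds.
\<close>

lemma koszul_nonzero_Suc:
  fixes J J' :: "('x, 'k::field) mpoly set"
  assumes J: "ideal J poly_ring" and J': "ideal J' poly_ring" and sub: "J \<subseteq> J'"
    and f: "f \<in> graded_maximal_ideal" "f \<in> J'"
    and J'_eq: "\<And>a. a \<in> J' \<Longrightarrow> \<exists>a0\<in>J. \<exists>u. a = a0 + f * u"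
    and regular: "\<And>g. f * g \<in> J \<Longrightarrow> g \<in> J"
    and nz: "koszul_nonzero h J"
  shows "koszul_nonzero (Suc h) J'"
proof -
  obtain z where z: "\<And>\<sigma>. card \<sigma> \<noteq> h \<Longrightarrow> z \<sigma> = 0" "\<And>\<tau>. koszul_d z \<tau> \<in> J"
      and nb: "\<not> (\<exists>v. (\<forall>\<sigma>. card \<sigma> \<noteq> Suc h \<longrightarrow> v \<sigma> = 0) \<and> (\<forall>\<tau>. z \<tau> - koszul_d v \<tau> \<in> J))"
    using nz unfolding koszul_nonzero_def by blast
  obtain a where a: "f = (\<Sum>x\<in>UNIV. var x * a x)"
    by (rule graded_maximal_ideal_decompose[OF f(1)])
  \<comment> \<open>The homotopies for the variables combine to one for \<open>f\<close>.\<close>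
  define w where "w \<sigma> = (\<Sum>x\<in>UNIV. a x * cone enc x z \<sigma>)" for \<sigma>
  have w_card: "w \<sigma> = 0" if "card \<sigma> \<noteq> Suc h" for \<sigma>
  proof -
    have "cone enc x z \<sigma> = 0" for x
    proof (cases "x \<in> \<sigma>")
      case True
      have "card (\<sigma> - {x}) \<noteq> h"
        using card_Suc_Diff1[OF finite True] that by auto
      from z(1)[OF this] show ?thesis
        by (simp add: cone_def)
    qed (simp add: cone_def)
    then show ?thesis
      by (simp add: w_def)
  qed
  have kd_w: "f * z \<tau> - koszul_d w \<tau> \<in> J" for \<tau>
  proof -
    have "koszul_d w \<tau> = (\<Sum>x\<in>UNIV. a x * koszul_d (cone enc x z) \<tau>)"
    proof -
      have "koszul_d w \<tau> = (\<Sum>y\<in>UNIV - \<tau>. \<Sum>x\<in>UNIV. a x * (sgn_at enc y \<tau> * var y * cone enc x z (insert y \<tau>)))"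
        by (simp add: boundary_def w_def sum_distrib_left mult_ac)
      also have "\<dots> = (\<Sum>x\<in>UNIV. \<Sum>y\<in>UNIV - \<tau>. a x * (sgn_at enc y \<tau> * var y * cone enc x z (insert y \<tau>)))"
        by (rule sum.swap)
      finally show ?thesis
        by (simp add: boundary_def sum_distrib_left)
    qed
    also have "\<dots> = (\<Sum>x\<in>UNIV. a x * (var x * z \<tau> - cone enc x (koszul_d z) \<tau>))"
    proof (rule sum.cong[OF refl])
      fix x
      have "koszul_d (cone enc x z) \<tau> + cone enc x (koszul_d z) \<tau> = var x * z \<tau>"
        by (rule boundary_cone) (use inj_enc in auto)
      then have "koszul_d (cone enc x z) \<tau> = var x * z \<tau> - cone enc x (koszul_d z) \<tau>"
        by (simp add: eq_diff_eq)
      then show "a x * koszul_d (cone enc x z) \<tau> = a x * (var x * z \<tau> - cone enc x (koszul_d z) \<tau>)"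
        by simp
    qed
    also have "\<dots> = f * z \<tau> - (\<Sum>x\<in>UNIV. a x * cone enc x (koszul_d z) \<tau>)"
    proof -
      have "f * z \<tau> = (\<Sum>x\<in>UNIV. a x * (var x * z \<tau>))"
        unfolding a sum_distrib_right by (rule sum.cong) (simp_all add: mult_ac)
      then show ?thesis
        by (simp add: right_diff_distrib sum_subtractf)
    qed
    finally have "f * z \<tau> - koszul_d w \<tau> = (\<Sum>x\<in>UNIV. a x * cone enc x (koszul_d z) \<tau>)"
      by simp
    also have "\<dots> \<in> J"
    proof (rule ideal_sum[OF J])
      fix x
      have "cone enc x (koszul_d z) \<tau> \<in> J"
        using z(2) J unfolding cone_def ideal_poly_ring_iff by simp
      then show "a x * cone enc x (koszul_d z) \<tau> \<in> J"
        using J unfolding ideal_poly_ring_iff by blast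
    qed
    finally show ?thesis .
  qed
  have "koszul_d w \<tau> \<in> J'" for \<tau>
  proof -
    have "z \<tau> * f \<in> J'"
      using f(2) J' unfolding ideal_poly_ring_iff by blast
    then have "f * z \<tau> \<in> J'"
      by (simp only: mult.commute)
    from ideal_diff[OF J' this subsetD[OF sub kd_w[of \<tau>]]] show ?thesis
      by simp
  qed
  moreover have "\<not> (\<exists>v. (\<forall>\<sigma>. card \<sigma> \<noteq> Suc (Suc h) \<longrightarrow> v \<sigma> = 0) \<and> (\<forall>\<tau>. w \<tau> - koszul_d v \<tau> \<in> J'))"
  proof
    assume "\<exists>v. (\<forall>\<sigma>. card \<sigma> \<noteq> Suc (Suc h) \<longrightarrow> v \<sigma> = 0) \<and> (\<forall>\<tau>. w \<tau> - koszul_d v \<tau> \<in> J')"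
    then obtain v where v: "\<And>\<sigma>. card \<sigma> \<noteq> Suc (Suc h) \<Longrightarrow> v \<sigma> = 0" "\<And>\<tau>. w \<tau> - koszul_d v \<tau> \<in> J'"
      by blast
    have kv: "koszul_d v \<tau> = 0" if "card \<tau> \<noteq> Suc h" for \<tau>
      unfolding boundary_def using v(1) that by (intro sum.neutral) auto
    have "\<exists>a0 u. w \<tau> - koszul_d v \<tau> = a0 + f * u \<and> a0 \<in> J \<and> (card \<tau> \<noteq> Suc h \<longrightarrow> u = 0)" for \<tau>
    proof (cases "card \<tau> = Suc h")
      case True
      then show ?thesis
        using J'_eq[OF v(2)[of \<tau>]] by blast
    next
      case False
      then have "w \<tau> - koszul_d v \<tau> = 0 + f * 0 \<and> 0 \<in> J"
        using J unfolding ideal_poly_ring_iff by (simp add: w_card kv)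
      then show ?thesis
        using False by blast
    qed
    then have "\<forall>\<tau>. \<exists>p. w \<tau> - koszul_d v \<tau> = fst p + f * snd p \<and> fst p \<in> J \<and> (card \<tau> \<noteq> Suc h \<longrightarrow> snd p = 0)"
      by simp
    from choice[OF this] obtain p where p: "\<forall>\<tau>. w \<tau> - koszul_d v \<tau> = fst (p \<tau>) + f * snd (p \<tau>) \<and> fst (p \<tau>) \<in> J \<and> (card \<tau> \<noteq> Suc h \<longrightarrow> snd (p \<tau>) = 0)" ..
    define a0 where "a0 \<tau> = fst (p \<tau>)" for \<tau>
    define u where "u \<tau> = snd (p \<tau>)" for \<tau>
    have au: "w \<tau> - koszul_d v \<tau> = a0 \<tau> + f * u \<tau>" "a0 \<tau> \<in> J" "card \<tau> \<noteq> Suc h \<Longrightarrow> u \<tau> = 0" for \<tau>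
      using spec[OF p, of \<tau>] by (simp_all add: a0_def u_def)
    have w_eq: "w = (\<lambda>\<tau>. koszul_d v \<tau> + (a0 \<tau> + f * u \<tau>))"
      by (rule ext) (simp add: au(1)[symmetric])
    have "z \<tau> - koszul_d u \<tau> \<in> J" for \<tau>
    proof -
      have "koszul_d w \<tau> = koszul_d (koszul_d v) \<tau> + (koszul_d a0 \<tau> + f * koszul_d u \<tau>)"
        unfolding w_eq by (simp add: boundary_def distrib_left sum.distrib sum_distrib_left mult_ac)
      then have "koszul_d w \<tau> = koszul_d a0 \<tau> + f * koszul_d u \<tau>"
        by (simp add: kd_kd)
      then have "f * (z \<tau> - koszul_d u \<tau>) = (f * z \<tau> - koszul_d w \<tau>) + koszul_d a0 \<tau>"
        by (simp add: right_diff_distrib)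
      moreover have "koszul_d a0 \<tau> \<in> J"
        unfolding boundary_def
        by (rule ideal_sum[OF J]) (use au(2) J in \<open>auto simp: ideal_poly_ring_iff\<close>)
      ultimately have "f * (z \<tau> - koszul_d u \<tau>) \<in> J"
        using kd_w[of \<tau>] J unfolding ideal_poly_ring_iff by simp
      then show ?thesis
        by (rule regular)
    qed
    then show False
      using nb au(3) by blast
  qed
  ultimately show ?thesis
    unfolding koszul_nonzero_def using w_card by blast
qed

text \<open>
  Every member of a regular sequence raises the position of a nonzero Koszul homology class by
  one, and there is no homology beyond the number of variables.
\<close>

lemma regular_sequence_length_le:
  fixes I :: "('x, 'k::field) mpoly set"
  assumes I: "ideal I poly_ring" and nz: "koszul_nonzero h I"
    and reg: "regular_sequence (poly_ring Quot I) fs" and fs: "set fs \<subseteq> (\<lambda>f. I +>\<^bsub>poly_ring\<^esub> f) ` graded_maximal_ideal"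
  shows "h + length fs \<le> card (UNIV :: 'x set)"
proof -
  interpret poly_quotient I
    by (rule poly_quotient.intro) (rule I)
  interpret Q: cring Q
    by (rule cring_Q)
  define T where "T k = Idl\<^bsub>Q\<^esub> (set (take k fs))" for k
  define J where "J k = {f. cls f \<in> T k}" for k
  have fsQ: "set (take k fs) \<subseteq> carrier Q" for k
    using reg set_take_subset[of k fs] unfolding regular_sequence_def by blast
  have T: "ideal (T k) Q" for k
    unfolding T_def by (rule Q.genideal_ideal[OF fsQ])
  have J: "ideal (J k) poly_ring" for k
    unfolding J_def by (rule ideal_preimage[OF T])
  have I_J: "I \<subseteq> J k" for k
  proof
    fix g assume "g \<in> I"
    then have "cls g = cls 0"
      by (simp add: cls_eq_iff)
    moreover have "cls 0 \<in> T k"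
      using J[of k] by (simp add: ideal_poly_ring_iff J_def)
    ultimately show "g \<in> J k"
      by (simp add: J_def)
  qed
  have "koszul_nonzero (h + k) (J k)" if "k \<le> length fs" for k
    using that
  proof (induction k)
    case 0
    have "T 0 \<subseteq> cls ` I"
      unfolding T_def by (rule Q.genideal_minimal[OF ideal_image[OF I]]) simp
    then have "J 0 \<subseteq> I"
      unfolding J_def using cls_image_iff[OF I subset_refl] by blast
    then have "J 0 = I"
      using I_J by blast
    then show ?case
      using nz by simp
  next
    case (Suc k)
    then have k: "k < length fs"
      by simp
    obtain f where f: "f \<in> graded_maximal_ideal" "fs ! k = cls f"
      using fs nth_mem[OF k] by blast
    have set_Suc: "set (take (Suc k) fs) = insert (cls f) (set (take k fs))"
      using k f(2) by (simp add: take_Suc_conv_app_nth)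
    have J_mono: "J k \<subseteq> J (Suc k)"
    proof -
      have "T k \<subseteq> T (Suc k)"
        unfolding T_def by (rule Q.genideal_minimal[OF Q.genideal_ideal[OF fsQ]])
          (use Q.genideal_self[OF fsQ[of "Suc k"]] in \<open>auto simp: set_Suc\<close>)
      then show ?thesis
        by (auto simp: J_def)
    qed
    have f_in: "f \<in> J (Suc k)"
      using Q.genideal_self[OF fsQ[of "Suc k"]] by (auto simp: J_def T_def set_Suc)
    let ?L = "{a0 + f * u | a0 u. a0 \<in> J k}"
    have J0: "0 \<in> J k" "\<And>a b. a \<in> J k \<Longrightarrow> b \<in> J k \<Longrightarrow> a + b \<in> J k" "\<And>a b. a \<in> J k \<Longrightarrow> b * a \<in> J k"
      using J[of k] unfolding ideal_poly_ring_iff by blast+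
    have L: "ideal ?L poly_ring"
      unfolding ideal_poly_ring_iff
    proof (intro conjI ballI allI)
      show "0 \<in> ?L"
        using J0(1) by (auto intro!: exI[of _ 0])
      fix a b assume "a \<in> ?L"
      then obtain a0 u where a: "a = a0 + f * u" "a0 \<in> J k"
        by blast
      have "b * a = b * a0 + f * (b * u)"
        by (simp add: a(1) distrib_left mult_ac)
      then show "b * a \<in> ?L"
        using J0(3)[OF a(2)] by blast
      assume "b \<in> ?L"
      then obtain b0 v where b: "b = b0 + f * v" "b0 \<in> J k"
        by blast
      have "a + b = (a0 + b0) + f * (u + v)"
        by (simp add: a(1) b(1) distrib_left)
      then show "a + b \<in> ?L"
        using J0(2)[OF a(2) b(2)] by blast
    qed
    have J_L: "J k \<subseteq> ?L"
    proof
      fix a assume "a \<in> J k"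
      moreover have "a = a + f * 0"
        by simp
      ultimately show "a \<in> ?L"
        by blast
    qed
    have f_L: "f \<in> ?L"
    proof -
      have "f = 0 + f * 1"
        by simp
      then show ?thesis
        using J0(1) by blast
    qed
    have "set (take (Suc k) fs) \<subseteq> cls ` ?L"
    proof
      fix c assume c: "c \<in> set (take (Suc k) fs)"
      then obtain g where g: "c = cls g"
        using fsQ[of "Suc k"] unfolding carrier_Q by blast
      show "c \<in> cls ` ?L"
      proof (cases "c = cls f")
        case True
        then show ?thesis
          using f_L by blast
      next
        case False
        then have "c \<in> T k"
          using c Q.genideal_self[OF fsQ[of k]] by (auto simp: set_Suc T_def)
        then have "g \<in> J k"
          by (simp add: J_def g)
        then show ?thesis
          unfolding g using J_L by blast
      qed
    qed
    then have T_L: "T (Suc k) \<subseteq> cls ` ?L"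
      unfolding T_def by (rule Q.genideal_minimal[OF ideal_image[OF L]])
    have I_L: "I \<subseteq> ?L"
      using I_J J_L by blast
    have J_eq: "\<exists>a0\<in>J k. \<exists>u. a = a0 + f * u" if "a \<in> J (Suc k)" for a
    proof -
      have "cls a \<in> cls ` ?L"
        using that T_L unfolding J_def by blast
      then have "a \<in> ?L"
        using cls_image_iff[OF L I_L] by blast
      then show ?thesis
        by blast
    qed
    have regular: "g \<in> J k" if "f * g \<in> J k" for g
    proof -
      have "fs ! k \<otimes>\<^bsub>Q\<^esub> cls g \<in> T k"
        using that by (simp add: f(2) cls_mult J_def)
      moreover have "cls g \<in> carrier Q"
        unfolding carrier_Q by blast
      ultimately have "cls g \<in> T k"
        using reg k unfolding regular_sequence_def T_def by blast
      then show ?thesis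
        by (simp add: J_def)
    qed
    have "koszul_nonzero (h + k) (J k)"
      using Suc by simp
    then have "koszul_nonzero (Suc (h + k)) (J (Suc k))"
      by (intro koszul_nonzero_Suc[OF J J J_mono f(1) f_in]) (erule J_eq, erule regular)
    then show ?case
      by simp
  qed
  from koszul_nonzero_le[OF J this[OF order_refl]] show ?thesis .
qed

end

text \<open>
  The complex is the disjoint union of the full simplices on \<open>A1\<close> and \<open>A2\<close>, apart from the common
  empty face.
\<close>

definition two_simplices :: "'x set set \<Rightarrow> 'x set \<Rightarrow> 'x set \<Rightarrow> bool" where
  "two_simplices \<Delta> A1 A2 \<longleftrightarrow> A1 \<noteq> {} \<and> A2 \<noteq> {} \<and> A1 \<inter> A2 = {} \<and> (\<forall>\<sigma>. \<sigma> \<in> \<Delta> \<longleftrightarrow> \<sigma> \<subseteq> A1 \<or> \<sigma> \<subseteq> A2)"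

text \<open>
  The join of two disconnected complexes contains the four-cycle through \<open>a1\<close>, \<open>b1\<close>, \<open>a2\<close>, \<open>b2\<close>,
  which bounds in the full simplex: it is the boundary of the chain \<open>c\<close> on two triangles. Hence
  \<open>c\<close> gives a Koszul cycle modulo the ideal. The four-cycle does not bound in the join itself,
  because the sum \<open>\<phi>\<close> of the coefficients of all edges between \<open>A1\<close> and \<open>B1\<close> vanishes on
  boundaries and not on the four-cycle.
\<close>

lemma (in koszul) koszul_nonzero_3:
  fixes U1 U2 :: "('x \<Rightarrow>\<^sub>0 nat) set"
  assumes sep: "\<And>x y. x \<notin> W \<Longrightarrow> y \<in> W \<Longrightarrow> enc x < enc y"
    and dep: "depends_on U1 (- W)" "depends_on U2 W"
    and A: "two_simplices (koszul_complex U1 (restrict_mono (- W) b)) A1 A2"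
    and B: "two_simplices (koszul_complex U2 (restrict_mono W b)) B1 B2"
  shows "koszul_nonzero 3 (monomial_ideal (U1 \<inter> U2) :: ('x, 'k::field) mpoly set)"
proof -
  let ?\<Delta> = "koszul_complex (U1 \<inter> U2) b"
  let ?bd = "sboundary enc UNIV :: ('x set \<Rightarrow> 'k) \<Rightarrow> _"
  have \<Delta>: "\<sigma> \<in> ?\<Delta> \<longleftrightarrow> (\<sigma> - W \<subseteq> A1 \<or> \<sigma> - W \<subseteq> A2) \<and> (\<sigma> \<inter> W \<subseteq> B1 \<or> \<sigma> \<inter> W \<subseteq> B2)" for \<sigma>
    using A B unfolding koszul_complex_Int[OF dep] two_simplices_def by simp
  have AB: "A1 \<noteq> {}" "A2 \<noteq> {}" "A1 \<inter> A2 = {}" "B1 \<noteq> {}" "B2 \<noteq> {}" "B1 \<inter> B2 = {}"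
    using A B unfolding two_simplices_def by argo+
  have mem: "A1 \<in> koszul_complex U1 (restrict_mono (- W) b)" "A2 \<in> koszul_complex U1 (restrict_mono (- W) b)"
      "B1 \<in> koszul_complex U2 (restrict_mono W b)" "B2 \<in> koszul_complex U2 (restrict_mono W b)"
    using A B unfolding two_simplices_def by simp_all
  have AW: "A1 \<inter> W = {}" "A2 \<inter> W = {}"
    using koszul_complex_subset[OF mem(1)] koszul_complex_subset[OF mem(2)] by blast+
  have BW: "B1 \<subseteq> W" "B2 \<subseteq> W"
    using koszul_complex_subset[OF mem(3)] koszul_complex_subset[OF mem(4)] by blast+
  note disj = AB(3,6)
  obtain a1 a2 b1 b2 where ab: "a1 \<in> A1" "a2 \<in> A2" "b1 \<in> B1" "b2 \<in> B2"
    using AB by blast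
  have W: "a1 \<notin> W" "a2 \<notin> W" "b1 \<in> W" "b2 \<in> W"
    using ab AW BW by blast+
  have ne: "a1 \<noteq> a2" "b1 \<noteq> b2" "a1 \<noteq> b1" "a1 \<noteq> b2" "a2 \<noteq> b1" "a2 \<noteq> b2"
    using ab disj W by blast+
  let ?s1 = "{a1, a2, b1}" and ?s2 = "{a1, a2, b2}"
  \<comment> \<open>Two triangles with common edge \<open>{a1, a2}\<close>, which is not a face; the signs make it cancel in the boundary.\<close>
  define c :: "'x set \<Rightarrow> 'k" where "c \<sigma> = (if \<sigma> = ?s1 then 1 else if \<sigma> = ?s2 then -1 else 0)" for \<sigma>
  have s12: "?s1 \<noteq> ?s2"
  proof
    assume "?s1 = ?s2"
    then have "b1 \<in> ?s2"
      by blast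
    then show False
      using ne by simp
  qed
  have lkp: "1 \<le> Poly_Mapping.lookup b x" if "x \<in> {a1, a2, b1, b2}" for x
  proof -
    have "{x} \<in> ?\<Delta>"
      using that ab W unfolding \<Delta> by auto
    then show ?thesis
      by (auto simp: koszul_complex_def indicator_mono_dvd)
  qed
  have c_supp: "indicator_mono \<sigma> \<preceq> b \<and> card \<sigma> = 3" if "c \<sigma> \<noteq> 0" for \<sigma>
    using that ne lkp unfolding c_def by (auto simp: indicator_mono_dvd split: if_splits)
  have bdc: "\<tau> \<in> ?\<Delta>" if nz: "?bd c \<tau> \<noteq> 0" for \<tau>
  proof -
    obtain x where x: "x \<in> UNIV - \<tau>" "sgn_at enc x \<tau> * 1 * c (insert x \<tau>) \<noteq> 0"
      using nz unfolding boundary_def by (rule sum.not_neutral_contains_not_neutral)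
    then have "insert x \<tau> = ?s1 \<or> insert x \<tau> = ?s2"
      by (auto simp: c_def split: if_splits)
    then have cases: "\<tau> = ?s1 - {x} \<and> x \<in> ?s1 \<or> \<tau> = ?s2 - {x} \<and> x \<in> ?s2"
      using x(1) by blast
    \<comment> \<open>Both triangles contain this edge with the same sign, since \<open>b1\<close> and \<open>b2\<close> come after \<open>a1\<close> and \<open>a2\<close>.\<close>
    have not_aa: "\<tau> \<noteq> {a1, a2}"
    proof
      assume \<tau>: "\<tau> = {a1, a2}"
      have "?bd c \<tau> = (\<Sum>x\<in>{b1, b2}. sgn_at enc x \<tau> * 1 * c (insert x \<tau>))"
        unfolding boundary_def
      proof (rule sum.mono_neutral_right)
        show "\<forall>x\<in>UNIV - \<tau> - {b1, b2}. sgn_at enc x \<tau> * 1 * c (insert x \<tau>) = 0"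
        proof
          fix x assume "x \<in> UNIV - \<tau> - {b1, b2}"
          then have "insert x \<tau> \<noteq> ?s1" "insert x \<tau> \<noteq> ?s2"
            using \<tau> by auto
          then show "sgn_at enc x \<tau> * 1 * c (insert x \<tau>) = 0"
            by (simp add: c_def)
        qed
      qed (use ne \<tau> in auto)
      also have "\<dots> = sgn_at enc b1 \<tau> - sgn_at enc b2 \<tau>"
      proof -
        have "insert b1 \<tau> = ?s1" "insert b2 \<tau> = ?s2"
          using \<tau> by auto
        then show ?thesis
          using ne s12 by (simp add: c_def)
      qed
      also have "\<dots> = 0"
      proof -
        have "{y \<in> \<tau>. enc y < enc b} = \<tau>" if "b \<in> W" for b
          using sep[OF _ that] W \<tau> by auto
        then show ?thesis
          using W by (simp add: sgn_at_def)
      qed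
      finally show False
        using nz by simp
    qed
    have faces: "\<tau> = {a2, d} \<or> \<tau> = {a1, d} \<or> \<tau> = {a1, a2}"
      if \<tau>: "\<tau> = {a1, a2, d} - {x}" "x \<in> {a1, a2, d}" "a1 \<noteq> d" "a2 \<noteq> d" for d
    proof -
      consider "x = a1" | "x = a2" | "x = d"
        using \<tau>(2) by blast
      then show ?thesis
      proof cases
        case 1
        then have "\<tau> = {a2, d}"
          using \<tau> ne(1) by blast
        then show ?thesis ..
      next
        case 2
        then have "\<tau> = {a1, d}"
          using \<tau> ne(1) by blast
        then show ?thesis
          by simp
      next
        case 3
        then have "\<tau> = {a1, a2}"
          using \<tau> by blast
        then show ?thesis
          by simp
      qed
    qed
    from cases have "\<tau> = {a1, b1} \<or> \<tau> = {a2, b1} \<or> \<tau> = {a1, b2} \<or> \<tau> = {a2, b2}"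
    proof (elim disjE conjE)
      assume "\<tau> = ?s1 - {x}" "x \<in> ?s1"
      from faces[OF this ne(3,5)] not_aa show ?thesis
        by (elim disjE) simp_all
    next
      assume "\<tau> = ?s2 - {x}" "x \<in> ?s2"
      from faces[OF this ne(4,6)] not_aa show ?thesis
        by (elim disjE) simp_all
    qed
    then show ?thesis
      using ab W unfolding \<Delta> by auto
  qed
  let ?z = "assemble {b} (\<lambda>_. c)"
  have part_z: "part b' ?z = (if b' = b then c else (\<lambda>_. 0))" for b'
    using part_assemble[of "{b}" "\<lambda>_. c" b'] c_supp by (auto simp: fun_eq_iff)
  have z_card: "?z \<sigma> = 0" if "card \<sigma> \<noteq> 3" for \<sigma>
    using c_supp[of \<sigma>] that by (intro assemble_eq_0) auto
  have kd_z: "koszul_d ?z \<tau> \<in> monomial_ideal (U1 \<inter> U2)" for \<tau>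
    unfolding monomial_ideal_def mem_Collect_eq
  proof
    fix u assume u: "u \<in> Poly_Mapping.keys (koszul_d ?z \<tau>)"
    have "part (u + indicator_mono \<tau>) (koszul_d ?z) \<tau> \<noteq> 0"
      using u by (simp add: part_def in_keys_iff)
    then have nz: "?bd (part (u + indicator_mono \<tau>) ?z) \<tau> \<noteq> 0"
      by (simp add: kd_weight part_boundary)
    have "u + indicator_mono \<tau> = b"
    proof (rule ccontr)
      assume "u + indicator_mono \<tau> \<noteq> b"
      then show False
        using nz by (simp add: part_z boundary_def)
    qed
    moreover from this have "\<tau> \<in> ?\<Delta>"
      using nz bdc[of \<tau>] by (simp add: part_z)
    ultimately show "u \<in> U1 \<inter> U2"
      by (auto simp: koszul_complex_def)
  qed
  have nb: "\<not> (\<exists>v. (\<forall>\<sigma>. card \<sigma> \<noteq> Suc 3 \<longrightarrow> v \<sigma> = 0) \<and> (\<forall>\<tau>. ?z \<tau> - koszul_d v \<tau> \<in> monomial_ideal (U1 \<inter> U2)))"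
  proof
    assume "\<exists>v. (\<forall>\<sigma>. card \<sigma> \<noteq> Suc 3 \<longrightarrow> v \<sigma> = 0) \<and> (\<forall>\<tau>. ?z \<tau> - koszul_d v \<tau> \<in> monomial_ideal (U1 \<inter> U2))"
    then obtain v where v: "\<And>\<tau>. ?z \<tau> - koszul_d v \<tau> \<in> monomial_ideal (U1 \<inter> U2)"
      by blast
    define g where "g = part b (\<lambda>\<tau>. ?z \<tau> - koszul_d v \<tau>)"
    have g_supp: "\<sigma> \<in> ?\<Delta>" if "g \<sigma> \<noteq> 0" for \<sigma>
    proof -
      have "indicator_mono \<sigma> \<preceq> b" "b - indicator_mono \<sigma> \<in> Poly_Mapping.keys (?z \<sigma> - koszul_d v \<sigma>)"
        using that unfolding g_def part_def by (auto simp: in_keys_iff split: if_splits)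
      then show ?thesis
        using v[of \<sigma>] unfolding monomial_ideal_def koszul_complex_def by blast
    qed
    have g_eq: "g = (\<lambda>\<sigma>. c \<sigma> - ?bd (part b v) \<sigma>)"
    proof
      fix \<sigma>
      have "g \<sigma> = part b ?z \<sigma> - part b (koszul_d v) \<sigma>"
        by (simp add: g_def part_def lookup_minus)
      then show "g \<sigma> = c \<sigma> - ?bd (part b v) \<sigma>"
        by (simp add: part_z kd_weight part_boundary)
    qed
    have bdg: "?bd g = ?bd c"
      unfolding g_eq by (rule ext) (simp only: sboundary_diff sboundary_sboundary[OF inj_enc] diff_zero)
    define \<phi> where "\<phi> f = (\<Sum>a\<in>A1. \<Sum>e\<in>B1. f {a, e})" for f :: "'x set \<Rightarrow> 'k"
    have "\<phi> (?bd c) \<noteq> 0"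
    proof -
      have val: "?bd c {a, e} = (if a = a1 \<and> e = b1 then sgn_at enc a2 {a1, b1} else 0)" if ae: "a \<in> A1" "e \<in> B1" for a e
      proof -
        have aW: "a \<notin> W" "e \<in> W" "a \<noteq> a2" "e \<noteq> b2"
          using ae AW BW disj ab by blast+
        have c_val: "c (insert x {a, e}) = (if x = a2 \<and> a = a1 \<and> e = b1 then 1 else 0)" if "x \<notin> {a, e}" for x
        proof -
          have "insert x {a, e} \<noteq> ?s2"
          proof
            assume eq: "insert x {a, e} = ?s2"
            then have "e \<in> ?s2" by blast
            then show False
              using aW W by auto
          qed
          moreover have "insert x {a, e} = ?s1 \<longleftrightarrow> x = a2 \<and> a = a1 \<and> e = b1"
          proof
            assume eq: "insert x {a, e} = ?s1"
            then have "e \<in> ?s1" "a \<in> ?s1" "a2 \<in> insert x {a, e}" by blast+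
            then show "x = a2 \<and> a = a1 \<and> e = b1"
              using aW W by auto
          qed auto
          ultimately show ?thesis
            by (simp add: c_def)
        qed
        have "?bd c {a, e} = (\<Sum>x\<in>UNIV - {a, e}. if x = a2 then (if a = a1 \<and> e = b1 then sgn_at enc a2 {a1, b1} else 0) else 0)"
          unfolding boundary_def by (rule sum.cong[OF refl]) (use c_val in auto)
        moreover have "a2 \<in> UNIV - {a, e}"
          using aW W by auto
        ultimately show ?thesis
          by simp
      qed
      have "\<phi> (?bd c) = (\<Sum>a\<in>A1. \<Sum>e\<in>B1. if a = a1 \<and> e = b1 then sgn_at enc a2 {a1, b1} else 0)"
        unfolding \<phi>_def by (intro sum.cong refl val)
      also have "\<dots> = (\<Sum>a\<in>A1. if a = a1 then sgn_at enc a2 {a1, b1} else 0)"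
      proof (rule sum.cong[OF refl])
        fix a assume "a \<in> A1"
        show "(\<Sum>e\<in>B1. if a = a1 \<and> e = b1 then sgn_at enc a2 {a1, b1} else 0) = (if a = a1 then sgn_at enc a2 {a1, b1} else (0 :: 'k))"
          using ab(3) by (cases "a = a1") simp_all
      qed
      also have "\<dots> = sgn_at enc a2 {a1, b1}"
        using ab(1) by simp
      also have "\<dots> \<noteq> 0"
        by (simp add: sgn_at_def)
      finally show ?thesis .
    qed
    moreover have "\<phi> (?bd g) = 0"
    proof -
      let ?t = "\<lambda>a e x. sgn_at enc x {a, e} * 1 * g (insert x {a, e})"
      have split: "?bd g {a, e} = (\<Sum>x\<in>A1 - {a}. ?t a e x) + (\<Sum>x\<in>B1 - {e}. ?t a e x)" if ae: "a \<in> A1" "e \<in> B1" for a e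
      proof -
        have "?bd g {a, e} = (\<Sum>x\<in>(A1 - {a}) \<union> (B1 - {e}). ?t a e x)"
          unfolding boundary_def
        proof (rule sum.mono_neutral_right)
          show "(A1 - {a}) \<union> (B1 - {e}) \<subseteq> UNIV - {a, e}"
            using ae AW BW by blast
          show "\<forall>x\<in>UNIV - {a, e} - (A1 - {a} \<union> (B1 - {e})). ?t a e x = 0"
          proof
            fix x assume x: "x \<in> UNIV - {a, e} - (A1 - {a} \<union> (B1 - {e}))"
            have "insert x {a, e} \<notin> ?\<Delta>"
            proof
              assume d: "insert x {a, e} \<in> ?\<Delta>"
              show False
              proof (cases "x \<in> W")
                case True
                then have "insert x {a, e} \<inter> W = {x, e}"
                  using ae AW BW by blast
                then have "{x, e} \<subseteq> B1 \<or> {x, e} \<subseteq> B2"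
                  using d unfolding \<Delta> by simp
                then show False
                  using x ae disj by blast
              next
                case False
                then have "insert x {a, e} - W = {x, a}"
                  using ae AW BW by blast
                then have "{x, a} \<subseteq> A1 \<or> {x, a} \<subseteq> A2"
                  using d unfolding \<Delta> by simp
                then show False
                  using x ae disj by blast
              qed
            qed
            then have "g (insert x {a, e}) = 0"
              using g_supp by blast
            then show "?t a e x = 0"
              by simp
          qed
        qed simp
        also have "\<dots> = (\<Sum>x\<in>A1 - {a}. ?t a e x) + (\<Sum>x\<in>B1 - {e}. ?t a e x)"
          by (rule sum.union_disjoint) (use AW BW in auto)
        finally show ?thesis .
      qed
      have sgn_pair: "sgn_at enc x {a, e} = (if enc e < enc x then -1 else 1) * (if enc a < enc x then -1 else 1 :: 'k)"
        if "a \<noteq> e" for x a e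
      proof -
        have "sgn_at enc x {a, e} = (if enc a < enc x then - sgn_at enc x {e} else sgn_at enc x {e} :: 'k)"
          by (rule sgn_at_insert) (use that in auto)
        moreover have "sgn_at enc x (insert e {}) = (if enc e < enc x then - sgn_at enc x {} else sgn_at enc x {} :: 'k)"
          by (rule sgn_at_insert) simp_all
        then have "sgn_at enc x {e} = (if enc e < enc x then - 1 else 1 :: 'k)"
          by (simp add: sgn_at_def[of enc x "{}"])
        ultimately show ?thesis
          by simp
      qed
      have anti1: "(\<Sum>a\<in>A1. \<Sum>x\<in>A1 - {a}. ?t a e x) = 0" if e: "e \<in> B1" for e
      proof (rule sum_antisymmetric)
        fix a x assume ax: "a \<in> A1" "x \<in> A1" "a \<noteq> x"
        have "a \<notin> W" "x \<notin> W" "e \<in> W"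
          using ax e AW BW by blast+
        then have lt: "enc a < enc e" "enc x < enc e"
          by (auto intro: sep)
        have ne: "enc a \<noteq> enc x" "a \<noteq> e" "x \<noteq> e"
          using inj_enc ax(3) lt by (auto simp: inj_eq)
        have "insert x {a, e} = insert a {x, e}"
          by blast
        then show "?t a e x = - ?t x e a"
          using lt ne by (auto simp: sgn_pair)
      qed simp
      have anti2: "(\<Sum>e\<in>B1. \<Sum>x\<in>B1 - {e}. ?t a e x) = 0" if a: "a \<in> A1" for a
      proof (rule sum_antisymmetric)
        fix e x assume ex: "e \<in> B1" "x \<in> B1" "e \<noteq> x"
        have "a \<notin> W" "x \<in> W" "e \<in> W"
          using ex a AW BW by blast+
        then have lt: "enc a < enc e" "enc a < enc x"
          by (auto intro: sep)
        have ne: "enc e \<noteq> enc x" "a \<noteq> e" "a \<noteq> x"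
          using inj_enc ex(3) lt by (auto simp: inj_eq)
        have "insert x {a, e} = insert e {a, x}"
          by blast
        then show "?t a e x = - ?t a x e"
          using lt ne by (auto simp: sgn_pair)
      qed simp
      have "\<phi> (?bd g) = (\<Sum>a\<in>A1. \<Sum>e\<in>B1. (\<Sum>x\<in>A1 - {a}. ?t a e x) + (\<Sum>x\<in>B1 - {e}. ?t a e x))"
        unfolding \<phi>_def by (intro sum.cong refl split)
      also have "\<dots> = (\<Sum>a\<in>A1. \<Sum>e\<in>B1. \<Sum>x\<in>A1 - {a}. ?t a e x) + (\<Sum>a\<in>A1. \<Sum>e\<in>B1. \<Sum>x\<in>B1 - {e}. ?t a e x)"
        by (simp only: sum.distrib)
      also have "(\<Sum>a\<in>A1. \<Sum>e\<in>B1. \<Sum>x\<in>A1 - {a}. ?t a e x) = (\<Sum>e\<in>B1. \<Sum>a\<in>A1. \<Sum>x\<in>A1 - {a}. ?t a e x)"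
        by (rule sum.swap)
      also have "\<dots> = 0"
        by (rule sum.neutral) (use anti1 in blast)
      also have "(\<Sum>a\<in>A1. \<Sum>e\<in>B1. \<Sum>x\<in>B1 - {e}. ?t a e x) = 0"
        by (rule sum.neutral) (use anti2 in blast)
      finally show ?thesis
        by simp
    qed
    ultimately show False
      using bdg by simp
  qed
  show ?thesis
    unfolding koszul_nonzero_def using z_card kd_z nb by blast
qed

text \<open>
  The prime generated by \<open>Y\<close> shows that the codimension is at most two, while the Koszul class in
  position three shows that the depth is less than the number of variables minus two.
\<close>

theorem not_cohen_macaulay_Int:
  fixes U1 U2 :: "('x::finite \<Rightarrow>\<^sub>0 nat) set"
  assumes up: "\<And>u v. u \<in> U1 \<inter> U2 \<Longrightarrow> u \<preceq> v \<Longrightarrow> v \<in> U1 \<inter> U2"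
    and dep: "depends_on U1 (- W)" "depends_on U2 W"
    and A: "two_simplices (koszul_complex U1 (restrict_mono (- W) b)) A1 A2"
    and B: "two_simplices (koszul_complex U2 (restrict_mono W b)) B1 B2"
    and Y: "card Y \<le> 2" "\<And>u. u \<in> U1 \<inter> U2 \<Longrightarrow> \<exists>y\<in>Y. 1 \<le> Poly_Mapping.lookup u y"
  shows "\<not> quotient_cohen_macaulay (monomial_ideal (U1 \<inter> U2) :: ('x, 'k::field) mpoly set)"
proof -
  let ?I = "monomial_ideal (U1 \<inter> U2) :: ('x, 'k) mpoly set"
  let ?m = "(\<lambda>f. ?I +>\<^bsub>poly_ring\<^esub> f) ` graded_maximal_ideal"
  obtain enc :: "'x \<Rightarrow> nat" where enc: "inj enc" "\<And>x y. x \<notin> W \<Longrightarrow> y \<in> W \<Longrightarrow> enc x < enc y"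
    using enc_separating[of W] by metis
  interpret koszul enc
    by unfold_locales (rule enc(1))
  have I: "ideal ?I poly_ring"
    by (rule ideal_monomial_ideal) (rule up)
  interpret poly_quotient ?I
    by (rule poly_quotient.intro) (rule I)
  have nz: "koszul_nonzero 3 ?I"
    by (rule koszul_nonzero_3[OF enc(2) dep A B])
  have le: "3 + length fs \<le> card (UNIV :: 'x set)" if "regular_sequence Q fs" "set fs \<subseteq> ?m" for fs
    by (rule regular_sequence_length_le[OF I nz that])
  have "3 \<le> card (UNIV :: 'x set)"
    by (rule koszul_nonzero_le[OF I nz])
  have "depth Q ?m \<le> enat (card (UNIV :: 'x set) - 3)"
    unfolding depth_def
  proof (rule Sup_least)
    fix n assume "n \<in> {enat (length fs) | fs. regular_sequence Q fs \<and> set fs \<subseteq> ?m}"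
    then obtain fs where fs: "n = enat (length fs)" "regular_sequence Q fs" "set fs \<subseteq> ?m"
      by (elim CollectE exE conjE)
    from le[OF fs(2,3)] fs(1) show "n \<le> enat (card (UNIV :: 'x set) - 3)"
      by simp
  qed
  also have "\<dots> < enat (card (UNIV :: 'x set) - card Y)"
    using \<open>3 \<le> card (UNIV :: 'x set)\<close> Y(1) by simp
  also have "\<dots> \<le> krull_dim Q"
    by (rule krull_dim_ge) (use Y(2) in \<open>auto simp: monomial_prime_def monomial_ideal_def\<close>)
  finally show ?thesis
    unfolding quotient_cohen_macaulay_def cohen_macaulay_def by simp
qed


section \<open>Cut ideals of glued graphs\<close>

instance cut_var :: (finite) finite
proof
  have "UNIV = range S_var \<union> (range T_var :: 'a cut_var set)"
  proof (intro equalityI subsetI)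
    fix x :: "'a cut_var"
    show "x \<in> range S_var \<union> range T_var"
      by (cases x) auto
  qed simp
  then show "finite (UNIV :: 'a cut_var set)"
    by (metis finite_UnI finite finite_imageI)
qed

text \<open>The exponent vector of a cut monomial; \<open>P\<close> tells which edges the cut separates.\<close>

definition cut_exponent :: "'e set \<Rightarrow> ('e \<Rightarrow> bool) \<Rightarrow> 'e cut_var \<Rightarrow>\<^sub>0 nat" where
  "cut_exponent E P = (\<Sum>i\<in>E. Poly_Mapping.single (if P i then S_var i else T_var i) 1)"

lemma lookup_cut_exponent:
  fixes E :: "'e::finite set"
  shows "Poly_Mapping.lookup (cut_exponent E P) (S_var i) = (if i \<in> E \<and> P i then 1 else 0)"
    and "Poly_Mapping.lookup (cut_exponent E P) (T_var i) = (if i \<in> E \<and> \<not> P i then 1 else 0)"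
proof -
  have "Poly_Mapping.lookup (cut_exponent E P) (S_var i) = (\<Sum>j\<in>E. if j = i then if P i then 1 else 0 else 0)"
    unfolding cut_exponent_def lookup_sum by (intro sum.cong) (auto simp: lookup_single when_def)
  then show "Poly_Mapping.lookup (cut_exponent E P) (S_var i) = (if i \<in> E \<and> P i then 1 else 0)"
    by simp
  have "Poly_Mapping.lookup (cut_exponent E P) (T_var i) = (\<Sum>j\<in>E. if j = i then if P i then 0 else 1 else 0)"
    unfolding cut_exponent_def lookup_sum by (intro sum.cong) (auto simp: lookup_single when_def)
  then show "Poly_Mapping.lookup (cut_exponent E P) (T_var i) = (if i \<in> E \<and> \<not> P i then 1 else 0)"
    by simp
qed

lemma cut_exponent_cong: "(\<And>i. i \<in> E \<Longrightarrow> P i = Q i) \<Longrightarrow> cut_exponent E P = cut_exponent E Q"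
  unfolding cut_exponent_def by (rule sum.cong) simp_all

lemma total_degree_cut_exponent: "total_degree (cut_exponent (E :: 'e::finite set) P) = card E"
proof -
  have "total_degree (\<Sum>i\<in>A. Poly_Mapping.single (if P i then S_var i else T_var i) 1 :: 'e cut_var \<Rightarrow>\<^sub>0 nat) = card A"
    if "finite A" for A
    using that by (induction A) simp_all
  then show ?thesis
    by (simp add: cut_exponent_def)
qed

lemma cut_exponent_dvd_iff:
  fixes E :: "'e::finite set"
  shows "cut_exponent E P \<preceq> u \<longleftrightarrow>
    (\<forall>i\<in>E. 1 \<le> Poly_Mapping.lookup u (if P i then S_var i else T_var i))"
proof
  assume *: "cut_exponent E P \<preceq> u"
  show "\<forall>i\<in>E. 1 \<le> Poly_Mapping.lookup u (if P i then S_var i else T_var i)"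
  proof
    fix i assume "i \<in> E"
    then have "Poly_Mapping.lookup (cut_exponent E P) (if P i then S_var i else T_var i) = 1"
      by (simp add: lookup_cut_exponent)
    then show "1 \<le> Poly_Mapping.lookup u (if P i then S_var i else T_var i)"
      using * unfolding mono_dvd_def by metis
  qed
next
  assume *: "\<forall>i\<in>E. 1 \<le> Poly_Mapping.lookup u (if P i then S_var i else T_var i)"
  show "cut_exponent E P \<preceq> u"
    unfolding mono_dvd_def
  proof
    fix x
    show "Poly_Mapping.lookup (cut_exponent E P) x \<le> Poly_Mapping.lookup u x"
    proof (cases x)
      case (S_var i)
      then show ?thesis
        using bspec[OF *, of i] by (cases "i \<in> E"; cases "P i") (simp_all add: lookup_cut_exponent)
    next
      case (T_var i)
      then show ?thesis
        using bspec[OF *, of i] by (cases "i \<in> E"; cases "P i") (simp_all add: lookup_cut_exponent)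
    qed
  qed
qed

definition edge_set :: "('e \<Rightarrow> 'v set) \<Rightarrow> 'v graph \<Rightarrow> 'e set" where
  "edge_set e H = {i. e i \<in> edges H}"

definition crosses :: "('e \<Rightarrow> 'v set) \<Rightarrow> 'v set \<Rightarrow> 'e \<Rightarrow> bool" where
  "crosses e A i \<longleftrightarrow> card (e i \<inter> A) = 1"

definition cut_monomials :: "('e \<Rightarrow> 'v set) \<Rightarrow> 'v graph \<Rightarrow> ('e cut_var \<Rightarrow>\<^sub>0 nat) set" where
  "cut_monomials e H = upset ((\<lambda>A. cut_exponent (edge_set e H) (crosses e A)) ` Pow (verts H))"

definition edge_vars :: "('e \<Rightarrow> 'v set) \<Rightarrow> 'v graph \<Rightarrow> 'e cut_var set" where
  "edge_vars e H = S_var ` edge_set e H \<union> T_var ` edge_set e H"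

lemma prod_single:
  "(\<Prod>i\<in>A. Poly_Mapping.single (u i) (1 :: 'k::field)) = Poly_Mapping.single (\<Sum>i\<in>A. u i :: 'x \<Rightarrow>\<^sub>0 nat) 1"
  by (induction A rule: infinite_finite_induct) (simp_all add: mult_single)

lemma cut_monomial_eq: "(cut_monomial e H A :: ('e cut_var, 'k::field) mpoly) =
    Poly_Mapping.single (cut_exponent (edge_set e H) (crosses e A)) 1"
proof -
  have "(cut_monomial e H A :: ('e cut_var, 'k) mpoly) =
      (\<Prod>i\<in>edge_set e H. Poly_Mapping.single (Poly_Mapping.single (if crosses e A i then S_var i else T_var i) 1) 1)"
    unfolding cut_monomial_def edge_set_def crosses_def by (rule prod.cong) (simp_all add: var_def)
  then show ?thesis
    by (simp only: prod_single cut_exponent_def)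
qed

text \<open>This turns the cut ideal into the set of its monomials.\<close>

lemma cut_ideal_eq: "(cut_ideal e H :: ('e cut_var, 'k::field) mpoly set) = monomial_ideal (cut_monomials e H)"
proof -
  have "{cut_monomial e H A | A. A \<subseteq> verts H} =
      (\<lambda>s. Poly_Mapping.single s (1 :: 'k)) ` (\<lambda>A. cut_exponent (edge_set e H) (crosses e A)) ` Pow (verts H)"
    unfolding cut_monomial_eq by blast
  then show ?thesis
    unfolding cut_ideal_def cut_monomials_def by (simp only: Idl_monomials)
qed

lemma cut_monomials_iff:
  "u \<in> cut_monomials e H \<longleftrightarrow> (\<exists>A\<subseteq>verts H. cut_exponent (edge_set e H) (crosses e A) \<preceq> u)"
  unfolding cut_monomials_def upset_def by blast

lemma cut_monomials_generated:
  assumes "finite (verts H)"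
  shows "generated_in_degree (card (edge_set (e :: 'e::finite \<Rightarrow> 'v set) H)) (cut_monomials e H)"
  unfolding generated_in_degree_def cut_monomials_def
  by (rule exI[of _ "(\<lambda>A. cut_exponent (edge_set e H) (crosses e A)) ` Pow (verts H)"])
    (use assms in \<open>auto simp: total_degree_cut_exponent\<close>)

lemma cut_monomials_depends: "depends_on (cut_monomials (e :: 'e::finite \<Rightarrow> 'v set) H) (edge_vars e H)"
  unfolding depends_on_def
proof (intro allI impI)
  fix u v :: "'e cut_var \<Rightarrow>\<^sub>0 nat"
  assume eq: "\<forall>x\<in>edge_vars e H. Poly_Mapping.lookup u x = Poly_Mapping.lookup v x"
  have "cut_exponent (edge_set e H) P \<preceq> u \<longleftrightarrow> cut_exponent (edge_set e H) P \<preceq> v" for P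
    unfolding cut_exponent_dvd_iff
  proof (rule ball_cong[OF refl])
    fix i assume "i \<in> edge_set e H"
    then have "(if P i then S_var i else T_var i) \<in> edge_vars e H"
      by (simp add: edge_vars_def)
    then show "1 \<le> Poly_Mapping.lookup u (if P i then S_var i else T_var i) \<longleftrightarrow>
        1 \<le> Poly_Mapping.lookup v (if P i then S_var i else T_var i)"
      by (simp only: bspec[OF eq])
  qed
  then show "u \<in> cut_monomials e H \<longleftrightarrow> v \<in> cut_monomials e H"
    unfolding cut_monomials_iff by simp
qed

lemma depends_on_mono: "depends_on U Y \<Longrightarrow> Y \<subseteq> Z \<Longrightarrow> depends_on U Z"
  unfolding depends_on_def by (meson subsetD)

lemma edge_props:
  assumes "finite_simple_graph H" "d \<in> edges H"
  shows "d \<subseteq> verts H" "card d = 2"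
  using assms unfolding finite_simple_graph_def by auto

text \<open>A cut and its complement separate the same edges.\<close>

lemma crosses_complement:
  assumes "finite_simple_graph H" "e i \<in> edges H"
  shows "crosses e (verts H - A) i \<longleftrightarrow> crosses e A i"
proof -
  note d = edge_props[OF assms]
  have fin: "finite (e i)"
    by (rule card_ge_0_finite) (simp add: d(2))
  have eq: "e i \<inter> (verts H - A) = e i - (e i \<inter> A)"
    using d(1) by blast
  have "card (e i \<inter> (verts H - A)) = card (e i) - card (e i \<inter> A)"
    unfolding eq by (rule card_Diff_subset[OF finite_subset[OF Int_lower1 fin] Int_lower1])
  moreover have "card (e i \<inter> A) \<le> 2"
    using card_mono[OF fin Int_lower1, of A] unfolding d(2) .
  ultimately show ?thesis
    unfolding crosses_def d(2) by linarith
qed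

lemma crosses_restrict:
  assumes "finite_simple_graph H" "e i \<in> edges H"
  shows "crosses e (A \<inter> verts H) i \<longleftrightarrow> crosses e A i"
proof -
  have "e i \<inter> (A \<inter> verts H) = e i \<inter> A"
    using edge_props(1)[OF assms] by blast
  then show ?thesis
    by (simp add: crosses_def)
qed

text \<open>
  If the two cuts disagree at the common vertex, the second one is replaced by its complement.
  This is where at most one common vertex is needed.
\<close>

lemma glue_cuts:
  assumes H2: "finite_simple_graph H2" and fin: "finite (verts H1 \<inter> verts H2)" and one: "card (verts H1 \<inter> verts H2) \<le> 1"
    and A: "A1 \<subseteq> verts H1" "A2 \<subseteq> verts H2"
  obtains A where "A \<subseteq> verts H1 \<union> verts H2" "A \<inter> verts H1 = A1"
    "\<And>i. e i \<in> edges H2 \<Longrightarrow> crosses e (A \<inter> verts H2) i = crosses e A2 i"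
proof -
  have "\<exists>A2'\<subseteq>verts H2. (\<forall>w\<in>verts H1 \<inter> verts H2. w \<in> A1 \<longleftrightarrow> w \<in> A2') \<and> (\<forall>i. e i \<in> edges H2 \<longrightarrow> crosses e A2' i = crosses e A2 i)"
  proof (cases "\<forall>w\<in>verts H1 \<inter> verts H2. w \<in> A1 \<longleftrightarrow> w \<in> A2")
    case True
    then show ?thesis
      using A(2) by blast
  next
    case False
    then obtain w where w: "w \<in> verts H1 \<inter> verts H2" "\<not> (w \<in> A1 \<longleftrightarrow> w \<in> A2)"
      by blast
    have only: "w' = w" if "w' \<in> verts H1 \<inter> verts H2" for w'
      using one w(1) that unfolding One_nat_def card_le_Suc0_iff_eq[OF fin] by blast
    have "\<forall>w'\<in>verts H1 \<inter> verts H2. w' \<in> A1 \<longleftrightarrow> w' \<in> verts H2 - A2"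
    proof
      fix w' assume "w' \<in> verts H1 \<inter> verts H2"
      from only[OF this] show "w' \<in> A1 \<longleftrightarrow> w' \<in> verts H2 - A2"
        using w by simp
    qed
    moreover have "\<forall>i. e i \<in> edges H2 \<longrightarrow> crosses e (verts H2 - A2) i = crosses e A2 i"
    proof (intro allI impI)
      fix i assume "e i \<in> edges H2"
      then show "crosses e (verts H2 - A2) i = crosses e A2 i"
        by (rule crosses_complement[OF H2])
    qed
    ultimately show ?thesis
      using Diff_subset[of "verts H2" A2] by (intro exI[of _ "verts H2 - A2"] conjI)
  qed
  then obtain A2' where *: "A2' \<subseteq> verts H2" "\<forall>w\<in>verts H1 \<inter> verts H2. w \<in> A1 \<longleftrightarrow> w \<in> A2'"
      "\<forall>i. e i \<in> edges H2 \<longrightarrow> crosses e A2' i = crosses e A2 i"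
    by (elim exE conjE)
  then have A2': "A2' \<subseteq> verts H2" "\<And>w. w \<in> verts H1 \<inter> verts H2 \<Longrightarrow> w \<in> A1 \<longleftrightarrow> w \<in> A2'"
      "\<And>i. e i \<in> edges H2 \<Longrightarrow> crosses e A2' i = crosses e A2 i"
    by simp_all
  have "(A1 \<union> A2') \<inter> verts H1 = A1" "(A1 \<union> A2') \<inter> verts H2 = A2'"
    using A A2'(1,2) by blast+
  then show ?thesis
    using A A2'(1,3) by (intro that[of "A1 \<union> A2'"]) auto
qed

text \<open>
  Restricting a cut to a piece keeps the edges that it separates there, and conversely any two
  cuts of the pieces glue.
\<close>

lemma cut_monomials_glue:
  fixes e :: "'e::finite \<Rightarrow> 'v set"
  assumes H1: "finite_simple_graph H1" and H2: "finite_simple_graph H2"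
    and one: "card (verts H1 \<inter> verts H2) \<le> 1"
    and G: "verts G = verts H1 \<union> verts H2" "edges G = edges H1 \<union> edges H2"
  shows "cut_monomials e G = cut_monomials e H1 \<inter> cut_monomials e H2"
proof (intro equalityI subsetI)
  fix u assume "u \<in> cut_monomials e G"
  then obtain A where A: "A \<subseteq> verts G" "cut_exponent (edge_set e G) (crosses e A) \<preceq> u"
    unfolding cut_monomials_iff by blast
  have "u \<in> cut_monomials e H" if H: "finite_simple_graph H" and sub: "edges H \<subseteq> edges G" for H
  proof -
    have "cut_exponent (edge_set e H) (crosses e (A \<inter> verts H)) = cut_exponent (edge_set e H) (crosses e A)"
    proof (rule cut_exponent_cong)
      fix i assume "i \<in> edge_set e H"
      then have "e i \<in> edges H"
        by (simp add: edge_set_def)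
      then show "crosses e (A \<inter> verts H) i = crosses e A i"
        by (rule crosses_restrict[OF H])
    qed
    moreover have "cut_exponent (edge_set e H) (crosses e A) \<preceq> u"
      using A(2) sub unfolding cut_exponent_dvd_iff edge_set_def by blast
    ultimately show ?thesis
      unfolding cut_monomials_iff by (intro exI[of _ "A \<inter> verts H"]) simp
  qed
  then show "u \<in> cut_monomials e H1 \<inter> cut_monomials e H2"
    using H1 H2 G(2) by blast
next
  fix u assume "u \<in> cut_monomials e H1 \<inter> cut_monomials e H2"
  then obtain A1 A2 where A1: "A1 \<subseteq> verts H1" "cut_exponent (edge_set e H1) (crosses e A1) \<preceq> u"
      and A2: "A2 \<subseteq> verts H2" "cut_exponent (edge_set e H2) (crosses e A2) \<preceq> u"
    unfolding Int_iff cut_monomials_iff by blast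
  have fin: "finite (verts H1 \<inter> verts H2)"
    using H1 by (simp add: finite_simple_graph_def)
  obtain A where A: "A \<subseteq> verts H1 \<union> verts H2" "A \<inter> verts H1 = A1"
      "\<And>i. e i \<in> edges H2 \<Longrightarrow> crosses e (A \<inter> verts H2) i = crosses e A2 i"
    by (rule glue_cuts[OF H2 fin one A1(1) A2(1), of e]) blast
  have "cut_exponent (edge_set e G) (crosses e A) \<preceq> u"
    unfolding cut_exponent_dvd_iff
  proof
    fix i assume "i \<in> edge_set e G"
    then consider "e i \<in> edges H1" | "e i \<in> edges H2"
      by (auto simp: edge_set_def G)
    then show "1 \<le> Poly_Mapping.lookup u (if crosses e A i then S_var i else T_var i)"
    proof cases
      case 1
      then have "crosses e A i = crosses e A1 i"
        using crosses_restrict[OF H1, of e i A] A(2) by simp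
      then show ?thesis
        using A1(2) 1 unfolding cut_exponent_dvd_iff by (simp add: edge_set_def)
    next
      case 2
      then have "crosses e A i = crosses e A2 i"
        using crosses_restrict[OF H2, of e i A] A(3) by simp
      then show ?thesis
        using A2(2) 2 unfolding cut_exponent_dvd_iff by (simp add: edge_set_def)
    qed
  qed
  then show "u \<in> cut_monomials e G"
    unfolding cut_monomials_iff G(1) using A(1) by blast
qed

lemma edge_vars_disjoint:
  assumes H1: "finite_simple_graph H1" and H2: "finite_simple_graph H2"
    and one: "card (verts H1 \<inter> verts H2) \<le> 1"
  shows "edge_vars e H1 \<inter> edge_vars e H2 = {}"
proof -
  have "edges H1 \<inter> edges H2 = {}"
  proof (rule ccontr)
    assume "edges H1 \<inter> edges H2 \<noteq> {}"
    then obtain d where d: "d \<in> edges H1" "d \<in> edges H2"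
      by blast
    have "finite (verts H1 \<inter> verts H2)"
      using H1 by (simp add: finite_simple_graph_def)
    moreover have "d \<subseteq> verts H1 \<inter> verts H2"
      using edge_props(1)[OF H1 d(1)] edge_props(1)[OF H2 d(2)] by blast
    ultimately have "card d \<le> 1"
      using card_mono one le_trans by blast
    then show False
      using edge_props(2)[OF H1 d(1)] by simp
  qed
  then show ?thesis
    by (auto simp: edge_vars_def edge_set_def)
qed

text \<open>
  Take two cuts that separate different edges and for which the set of edges treated differently
  is as small as possible, and let \<open>b\<close> be the least common multiple of their monomials \<open>u\<close> and
  \<open>v\<close>. By minimality no other cut monomial divides \<open>b\<close>. Removing a squarefree monomial from \<open>b\<close>
  leaves a multiple of \<open>u\<close> if and only if it only involves variables of \<open>v\<close> that are missing in
  \<open>u\<close>, and symmetrically.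
\<close>

lemma cut_monomials_two_simplices:
  fixes e :: "'e::finite \<Rightarrow> 'v set"
  assumes H: "finite_simple_graph H" and ne: "edge_set e H \<noteq> {}"
  obtains b A1 A2 where "two_simplices (koszul_complex (cut_monomials e H) b) A1 A2"
    and "\<And>x. x \<notin> edge_vars e H \<Longrightarrow> Poly_Mapping.lookup b x = 0"
proof -
  let ?E = "edge_set e H"
  define D where "D A B = {i \<in> ?E. crosses e A i \<noteq> crosses e B i}" for A B
  obtain i0 where i0: "i0 \<in> ?E"
    using ne by blast
  then have d: "e i0 \<subseteq> verts H" "card (e i0) = 2"
    using edge_props[OF H, of "e i0"] by (simp_all add: edge_set_def)
  obtain p where p: "p \<in> e i0"
    using d(2) by fastforce
  have "e i0 \<inter> {p} = {p}"
    using p by blast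
  then have "crosses e {p} i0" "\<not> crosses e {} i0"
    by (simp_all add: crosses_def)
  then have "i0 \<in> D {} {p}"
    using i0 by (simp add: D_def)
  then have ex: "\<exists>n. \<exists>A B. A \<subseteq> verts H \<and> B \<subseteq> verts H \<and> D A B \<noteq> {} \<and> card (D A B) = n"
    using d(1) p by blast
  define n where "n = (LEAST n. \<exists>A B. A \<subseteq> verts H \<and> B \<subseteq> verts H \<and> D A B \<noteq> {} \<and> card (D A B) = n)"
  obtain A B where AB: "A \<subseteq> verts H" "B \<subseteq> verts H" "D A B \<noteq> {}" "card (D A B) = n"
    using LeastI_ex[OF ex] unfolding n_def by blast
  have minimal: "n \<le> card (D A C)" if "C \<subseteq> verts H" "D A C \<noteq> {}" for C
    unfolding n_def by (rule Least_le) (use AB(1) that in blast)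
  define u where "u = cut_exponent ?E (crosses e A)"
  define v where "v = cut_exponent ?E (crosses e B)"
  \<comment> \<open>Subtraction of exponents is truncated, so this is the least common multiple.\<close>
  define b where "b = u + (v - u)"
  have b: "Poly_Mapping.lookup b x = max (Poly_Mapping.lookup u x) (Poly_Mapping.lookup v x)" for x
    by (simp add: b_def lookup_add lookup_minus)
  have le1: "Poly_Mapping.lookup (cut_exponent ?E P) x \<le> 1" for P x
    by (cases x) (simp_all add: lookup_cut_exponent)
  have only: "cut_exponent ?E (crosses e C) = u \<or> cut_exponent ?E (crosses e C) = v"
    if C: "C \<subseteq> verts H" "cut_exponent ?E (crosses e C) \<preceq> b" for C
  proof -
    have sub: "D A C \<subseteq> D A B"
    proof
      fix i assume i: "i \<in> D A C"
      show "i \<in> D A B"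
      proof (rule ccontr)
        assume "i \<notin> D A B"
        then have same: "crosses e A i = crosses e B i" "crosses e C i \<noteq> crosses e A i" "i \<in> ?E"
          using i by (auto simp: D_def)
        have "1 \<le> Poly_Mapping.lookup b (if crosses e C i then S_var i else T_var i)"
          using C(2) same(3) unfolding cut_exponent_dvd_iff by blast
        then show False
          using same unfolding b u_def v_def by (auto simp: lookup_cut_exponent split: if_splits)
      qed
    qed
    show ?thesis
    proof (cases "D A C = {}")
      case True
      then have "cut_exponent ?E (crosses e C) = u"
        unfolding u_def by (intro cut_exponent_cong) (auto simp: D_def)
      then show ?thesis ..
    next
      case False
      have "D A C = D A B"
        by (rule card_seteq[OF _ sub]) (use minimal[OF C(1) False] AB(4) in auto)
      then have "crosses e C i = crosses e B i" if "i \<in> ?E" for i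
        using that unfolding D_def by blast
      then have "cut_exponent ?E (crosses e C) = v"
        unfolding v_def by (intro cut_exponent_cong)
      then show ?thesis ..
    qed
  qed
  define A1 where "A1 = {x. Poly_Mapping.lookup v x < Poly_Mapping.lookup u x}"
  define A2 where "A2 = {x. Poly_Mapping.lookup u x < Poly_Mapping.lookup v x}"
  have uv1: "Poly_Mapping.lookup u x \<le> 1" "Poly_Mapping.lookup v x \<le> 1" for x
    unfolding u_def v_def by (rule le1)+
  have dvd_iff: "indicator_mono \<sigma> \<preceq> b \<and> w \<preceq> b - indicator_mono \<sigma> \<longleftrightarrow>
      (\<forall>x. (if x \<in> \<sigma> then 1 else 0) + Poly_Mapping.lookup w x \<le> Poly_Mapping.lookup b x)" for w \<sigma>
  proof -
    have "i \<le> m \<and> k \<le> m - i \<longleftrightarrow> i + k \<le> m" for i k m :: nat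
      by linarith
    then show ?thesis
      unfolding mono_dvd_def lookup_minus lookup_indicator_mono all_conj_distrib[symmetric] by (simp only:)
  qed
  have u_face: "indicator_mono \<sigma> \<preceq> b \<and> u \<preceq> b - indicator_mono \<sigma> \<longleftrightarrow> \<sigma> \<subseteq> A2" for \<sigma>
    unfolding dvd_iff
  proof
    assume *: "\<forall>x. (if x \<in> \<sigma> then 1 else 0) + Poly_Mapping.lookup u x \<le> Poly_Mapping.lookup b x"
    show "\<sigma> \<subseteq> A2"
    proof
      fix x assume "x \<in> \<sigma>"
      then show "x \<in> A2"
        using spec[OF *, of x] unfolding A2_def b by simp
    qed
  next
    assume *: "\<sigma> \<subseteq> A2"
    show "\<forall>x. (if x \<in> \<sigma> then 1 else 0) + Poly_Mapping.lookup u x \<le> Poly_Mapping.lookup b x"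
    proof
      fix x
      show "(if x \<in> \<sigma> then 1 else 0) + Poly_Mapping.lookup u x \<le> Poly_Mapping.lookup b x"
      proof (cases "x \<in> \<sigma>")
        case True
        then have "Poly_Mapping.lookup u x < Poly_Mapping.lookup v x"
          using * unfolding A2_def by blast
        then show ?thesis
          using True b[of x] by simp
      qed (simp add: b)
    qed
  qed
  have v_face: "indicator_mono \<sigma> \<preceq> b \<and> v \<preceq> b - indicator_mono \<sigma> \<longleftrightarrow> \<sigma> \<subseteq> A1" for \<sigma>
    unfolding dvd_iff
  proof
    assume *: "\<forall>x. (if x \<in> \<sigma> then 1 else 0) + Poly_Mapping.lookup v x \<le> Poly_Mapping.lookup b x"
    show "\<sigma> \<subseteq> A1"
    proof
      fix x assume "x \<in> \<sigma>"
      then show "x \<in> A1"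
        using spec[OF *, of x] unfolding A1_def b by simp
    qed
  next
    assume *: "\<sigma> \<subseteq> A1"
    show "\<forall>x. (if x \<in> \<sigma> then 1 else 0) + Poly_Mapping.lookup v x \<le> Poly_Mapping.lookup b x"
    proof
      fix x
      show "(if x \<in> \<sigma> then 1 else 0) + Poly_Mapping.lookup v x \<le> Poly_Mapping.lookup b x"
      proof (cases "x \<in> \<sigma>")
        case True
        then have "Poly_Mapping.lookup v x < Poly_Mapping.lookup u x"
          using * unfolding A1_def by blast
        then show ?thesis
          using True b[of x] by simp
      qed (simp add: b)
    qed
  qed
  have face: "\<sigma> \<in> koszul_complex (cut_monomials e H) b \<longleftrightarrow> \<sigma> \<subseteq> A1 \<or> \<sigma> \<subseteq> A2" for \<sigma>
  proof
    assume "\<sigma> \<in> koszul_complex (cut_monomials e H) b"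
    then obtain C where \<sigma>: "indicator_mono \<sigma> \<preceq> b" and C: "C \<subseteq> verts H" "cut_exponent ?E (crosses e C) \<preceq> b - indicator_mono \<sigma>"
      unfolding koszul_complex_def cut_monomials_iff by blast
    have "b - indicator_mono \<sigma> \<preceq> b"
      by (simp add: mono_dvd_def lookup_minus)
    then have "cut_exponent ?E (crosses e C) \<preceq> b"
      by (rule mono_dvd_trans[OF C(2)])
    from only[OF C(1) this] show "\<sigma> \<subseteq> A1 \<or> \<sigma> \<subseteq> A2"
      using u_face[of \<sigma>] v_face[of \<sigma>] \<sigma> C(2) by auto
  next
    assume "\<sigma> \<subseteq> A1 \<or> \<sigma> \<subseteq> A2"
    then show "\<sigma> \<in> koszul_complex (cut_monomials e H) b"
      unfolding koszul_complex_def cut_monomials_iff mem_Collect_eq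
      using u_face[of \<sigma>] v_face[of \<sigma>] AB(1,2) unfolding u_def v_def by blast
  qed
  obtain i where i: "i \<in> ?E" "crosses e A i \<noteq> crosses e B i"
    using AB(3) unfolding D_def by blast
  have "A1 \<noteq> {}" "A2 \<noteq> {}"
  proof -
    have "(if crosses e A i then S_var i else T_var i) \<in> A1" "(if crosses e A i then T_var i else S_var i) \<in> A2"
      using i by (auto simp: A1_def A2_def u_def v_def lookup_cut_exponent)
    then show "A1 \<noteq> {}" "A2 \<noteq> {}"
      by blast+
  qed
  moreover have "A1 \<inter> A2 = {}"
    by (auto simp: A1_def A2_def)
  ultimately have "two_simplices (koszul_complex (cut_monomials e H) b) A1 A2"
    unfolding two_simplices_def using face by blast
  moreover have "Poly_Mapping.lookup b x = 0" if "x \<notin> edge_vars e H" for x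
    using that unfolding b u_def v_def by (cases x) (auto simp: lookup_cut_exponent edge_vars_def)
  ultimately show ?thesis
    by (rule that)
qed

context
  fixes e :: "'e::finite \<Rightarrow> 'v set" and H1 H2 G :: "'v graph"
  assumes H1: "finite_simple_graph H1" "edge_set e H1 \<noteq> {}" and H2: "finite_simple_graph H2" "edge_set e H2 \<noteq> {}"
    and one: "card (verts H1 \<inter> verts H2) \<le> 1"
    and G: "verts G = verts H1 \<union> verts H2" "edges G = edges H1 \<union> edges H2"
begin

lemma depends_factors:
  "depends_on (cut_monomials e H1) (- edge_vars e H2)" "depends_on (cut_monomials e H2) (edge_vars e H2)"
proof -
  have "edge_vars e H1 \<subseteq> - edge_vars e H2"
    using edge_vars_disjoint[OF H1(1) H2(1) one, of e] by blast
  then show "depends_on (cut_monomials e H1) (- edge_vars e H2)"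
    by (rule depends_on_mono[OF cut_monomials_depends])
qed (rule cut_monomials_depends)

lemma generated_factor:
  assumes "finite_simple_graph H" "edge_set e H \<noteq> {}"
  shows "generated_in_degree (card (edge_set e H)) (cut_monomials e H)" "1 \<le> card (edge_set e H)"
proof -
  show "generated_in_degree (card (edge_set e H)) (cut_monomials e H)"
    by (rule cut_monomials_generated) (use assms(1) in \<open>simp add: finite_simple_graph_def\<close>)
  show "1 \<le> card (edge_set e H)"
    using assms(2) by (simp add: Suc_le_eq card_gt_0_iff)
qed

theorem has_linear_resolution_glue:
  "has_linear_resolution (cut_ideal e G :: ('e cut_var, 'k::field) mpoly set) \<longleftrightarrow>
    has_linear_resolution (cut_ideal e H1 :: ('e cut_var, 'k) mpoly set) \<and>
    has_linear_resolution (cut_ideal e H2 :: ('e cut_var, 'k) mpoly set)"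
  unfolding cut_ideal_eq cut_monomials_glue[OF H1(1) H2(1) one G]
  by (rule has_linear_resolution_Int[OF depends_factors(1) generated_factor[OF H1] depends_factors(2) generated_factor[OF H2]])

text \<open>
  Every cut monomial contains one of the two variables of any fixed edge, so the codimension is at
  most two.
\<close>

theorem not_cohen_macaulay_glue:
  "\<not> quotient_cohen_macaulay (cut_ideal e G :: ('e cut_var, 'k::field) mpoly set)"
proof -
  obtain b1 A1 A2 where A: "two_simplices (koszul_complex (cut_monomials e H1) b1) A1 A2"
      and b1: "\<And>x. x \<notin> edge_vars e H1 \<Longrightarrow> Poly_Mapping.lookup b1 x = 0"
    using cut_monomials_two_simplices[OF H1] by metis
  obtain b2 B1 B2 where B: "two_simplices (koszul_complex (cut_monomials e H2) b2) B1 B2"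
      and b2: "\<And>x. x \<notin> edge_vars e H2 \<Longrightarrow> Poly_Mapping.lookup b2 x = 0"
    using cut_monomials_two_simplices[OF H2] by metis
  let ?W = "edge_vars e H2"
  have disj: "x \<notin> edge_vars e H1" if "x \<in> ?W" for x
    using edge_vars_disjoint[OF H1(1) H2(1) one, of e] that by blast
  have r: "restrict_mono (- ?W) (b1 + b2) = b1" "restrict_mono ?W (b1 + b2) = b2"
    using b1 b2 disj by (auto intro!: poly_mapping_eqI simp: lookup_add)
  obtain i where i: "i \<in> edge_set e H1"
    using H1(2) by blast
  show ?thesis
    unfolding cut_ideal_eq cut_monomials_glue[OF H1(1) H2(1) one G]
  proof (rule not_cohen_macaulay_Int[OF _ depends_factors])
    show "v \<in> cut_monomials e H1 \<inter> cut_monomials e H2"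
      if "u \<in> cut_monomials e H1 \<inter> cut_monomials e H2" "u \<preceq> v" for u v
      using that generated_upward[OF generated_factor(1)[OF H1]] generated_upward[OF generated_factor(1)[OF H2]] by blast
    show "two_simplices (koszul_complex (cut_monomials e H1) (restrict_mono (- ?W) (b1 + b2))) A1 A2"
      unfolding r by (rule A)
    show "two_simplices (koszul_complex (cut_monomials e H2) (restrict_mono ?W (b1 + b2))) B1 B2"
      unfolding r by (rule B)
    show "card {S_var i, T_var i} \<le> 2"
      by simp
    show "\<exists>y\<in>{S_var i, T_var i}. 1 \<le> Poly_Mapping.lookup u y"
      if u: "u \<in> cut_monomials e H1 \<inter> cut_monomials e H2" for u
    proof -
      obtain A where "cut_exponent (edge_set e H1) (crosses e A) \<preceq> u"
        using u unfolding Int_iff cut_monomials_iff by blast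
      then have "1 \<le> Poly_Mapping.lookup u (if crosses e A i then S_var i else T_var i)"
        using i unfolding cut_exponent_dvd_iff by blast
      then show ?thesis
        by (cases "crosses e A i") simp_all
    qed
  qed
qed

end

lemma finite_simple_graph_Union:
  assumes "finite J" "\<And>i. i \<in> J \<Longrightarrow> finite_simple_graph (H i)"
  shows "finite_simple_graph (graph_Union J H)"
  using assms unfolding finite_simple_graph_def graph_Union_def by fastforce

theorem proposition4p2:
  fixes H :: "nat \<Rightarrow> 'v graph" and G :: "'v graph" and r :: nat
    and e :: "'e::finite \<Rightarrow> 'v set"
  assumes "r \<ge> 1"
    and "\<forall>i\<in>{1..r}. finite_simple_graph (H i) \<and> edges (H i) \<noteq> {}"
    and "\<forall>i\<in>{2..r}. card ((\<Union>j\<in>{1..<i}. verts (H j)) \<inter> verts (H i)) \<le> 1"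
    and "G = graph_Union {1..r} H"
    and "bij_betw e UNIV (edges G)"
  shows "(quotient_cohen_macaulay (cut_ideal e G :: ('e cut_var, 'k::field) mpoly set) \<longrightarrow> r = 1) \<and>
    (has_linear_resolution (cut_ideal e G :: ('e cut_var, 'k::field) mpoly set) \<longleftrightarrow>
       (\<forall>i\<in>{1..r}. has_linear_resolution (cut_ideal e (H i) :: ('e cut_var, 'k::field) mpoly set)))"
proof -
  let ?U = "\<lambda>n. graph_Union {1..n} H"
  have range_e: "range e = edges G"
    using assms(5) by (rule bij_betw_imp_surj_on)
  have nonempty: "edge_set e K \<noteq> {}" if "edges K \<noteq> {}" "edges K \<subseteq> edges G" for K
  proof -
    obtain d where d: "d \<in> edges K"
      using \<open>edges K \<noteq> {}\<close> by blast
    then have "d \<in> range e"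
      using \<open>edges K \<subseteq> edges G\<close> unfolding range_e by blast
    then obtain i where "d = e i"
      by (rule imageE)
    then have "i \<in> edge_set e K"
      using d by (simp add: edge_set_def)
    then show ?thesis
      by blast
  qed
  have sub: "edges (H i) \<subseteq> edges G" if "i \<in> {1..r}" for i
    using that by (auto simp: assms(4) graph_Union_def)
  have fsg: "finite_simple_graph (?U n)" if "n \<le> r" for n
    by (rule finite_simple_graph_Union) (use assms(2) that in auto)
  have union_step: "verts (?U (Suc n)) = verts (?U n) \<union> verts (H (Suc n))"
    "edges (?U (Suc n)) = edges (?U n) \<union> edges (H (Suc n))" for n
    by (auto simp: graph_Union_def atLeastAtMostSuc_conv)
  have glue: "finite_simple_graph (?U n)" "edge_set e (?U n) \<noteq> {}"
    "finite_simple_graph (H (Suc n))" "edge_set e (H (Suc n)) \<noteq> {}"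
    "card (verts (?U n) \<inter> verts (H (Suc n))) \<le> 1"
    if n: "1 \<le> n" "Suc n \<le> r" for n
  proof -
    have "1 \<in> {1..r}"
      using n by simp
    have edges_U: "edges (?U n) = (\<Union>j\<in>{1..n}. edges (H j))"
      by (simp add: graph_Union_def)
    have "edges (H 1) \<subseteq> edges (?U n)"
      unfolding edges_U using n(1) by (intro UN_upper) simp
    moreover have "edges (H 1) \<noteq> {}"
      using bspec[OF assms(2) \<open>1 \<in> {1..r}\<close>] by simp
    ultimately have "edges (?U n) \<noteq> {}"
      by blast
    moreover have "edges (?U n) \<subseteq> edges G"
      unfolding edges_U using n by (intro UN_least sub) simp
    ultimately show "edge_set e (?U n) \<noteq> {}"
      by (rule nonempty)
    show "finite_simple_graph (?U n)"
      using n by (intro fsg) simp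
    have Suc_n: "Suc n \<in> {1..r}"
      using n by simp
    from bspec[OF assms(2) this] show "finite_simple_graph (H (Suc n))"
      by simp
    from bspec[OF assms(2) Suc_n] sub[OF Suc_n] show "edge_set e (H (Suc n)) \<noteq> {}"
      by (intro nonempty) simp_all
    have "Suc n \<in> {2..r}"
      using n by simp
    from bspec[OF assms(3) this] show "card (verts (?U n) \<inter> verts (H (Suc n))) \<le> 1"
      by (simp add: graph_Union_def atLeastLessThanSuc_atLeastAtMost)
  qed
  have "has_linear_resolution (cut_ideal e (?U n) :: ('e cut_var, 'k) mpoly set) \<longleftrightarrow>
      (\<forall>i\<in>{1..n}. has_linear_resolution (cut_ideal e (H i) :: ('e cut_var, 'k) mpoly set))"
    if "1 \<le> n" "n \<le> r" for n
    using that
  proof (induction n rule: dec_induct)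
    case base
    have "?U 1 = H 1"
      by (simp add: graph_Union_def)
    then show ?case
      by simp
  next
    case (step n)
    have "has_linear_resolution (cut_ideal e (?U (Suc n)) :: ('e cut_var, 'k) mpoly set) \<longleftrightarrow>
        has_linear_resolution (cut_ideal e (?U n) :: ('e cut_var, 'k) mpoly set) \<and>
        has_linear_resolution (cut_ideal e (H (Suc n)) :: ('e cut_var, 'k) mpoly set)"
      by (rule has_linear_resolution_glue[OF glue[OF step.hyps(1) step.prems] union_step])
    then show ?case
      using step.IH step.prems by (simp add: atLeastAtMostSuc_conv conj_commute)
  qed
  from this[OF assms(1) order_refl] have b: "has_linear_resolution (cut_ideal e G :: ('e cut_var, 'k) mpoly set) \<longleftrightarrow>
      (\<forall>i\<in>{1..r}. has_linear_resolution (cut_ideal e (H i) :: ('e cut_var, 'k) mpoly set))"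
    by (simp only: assms(4))
  have a: "r = 1" if cm: "quotient_cohen_macaulay (cut_ideal e G :: ('e cut_var, 'k) mpoly set)"
  proof (rule ccontr)
    assume "r \<noteq> 1"
    then obtain n where n: "1 \<le> n" "r = Suc n"
      using assms(1) by (cases r) auto
    have "\<not> quotient_cohen_macaulay (cut_ideal e (?U (Suc n)) :: ('e cut_var, 'k) mpoly set)"
      by (rule not_cohen_macaulay_glue[OF glue[OF n(1) n(2)[symmetric, THEN eq_imp_le]] union_step])
    then show False
      using cm by (simp add: assms(4) n(2))
  qed
  show ?thesis
    using a b by blast
qed

end
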